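(* Let $d\ge3$ and let $F\in\mathcal C^{\lfloor d/2\rfloor}([0,\infty))$ be a function whose $\lfloor\frac d2\rfloor$-th derivative is slowly increasing. Then $$f:=(\mathcal F_1^{-1}\circ\mathcal R_d^\star\circ\mathcal F_d)[\mathcal R_dF]$$ is continuous and regular (i.e. it is a regular tempered distribution on $\mathbb R$ generated by a continuous function, again denoted by $f$) and satisfies the slicing relation $$F(\|z\|)=\mathbb E_{\xi\sim\mathcal U_{\mathbb S^{d-1}}}\big[f(|\langle z,\xi\rangle|)\big]\qquad\text{for all }z\in\mathbb R^d.$$
   Context: $\|\cdot\|$ and $\langle\cdot,\cdot\rangle$ are the Euclidean norm and inner product; $\mathcal U_{\mathbb S^{d-1}}$ is the uniform distribution on the unit sphere $\mathbb S^{d-1}\subset\mathbb R^d$. $F$ is real-valued. $\mathcal S(\mathbb R^d)$ is the Schwartz space and $\mathcal S'(\mathbb R^d)$ the space of tempered distributions; $T\in\mathcal S'(\mathbb R^d)$ is radial if $\langle T,\varphi\circ Q\rangle=\langle T,\varphi\rangle$ for all orthogonal $Q$ and $\varphi\in\mathcal S(\mathbb R^d)$, and $\mathcal S'_{\mathrm{rad}}(\mathbb R^d)$ is the space of these. A distribution is regular if it is generated by a function $T\in L^1_{\mathrm{loc}}(\mathbb R^d)$ via $\langle T,\varphi\rangle=\int_{\mathbb R^d}T(x)\varphi(x)\,\mathrm dx$, $\varphi\in\mathcal S(\mathbb R^d)$. A locally integrable function $T$ (on $\mathbb R^d$, or on $[0,\infty)$) is slowly increasing if there exist $c,k,R>1$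 such that $|T(x)|\le c\|x\|^k$ for all $x$ in its domain with $\|x\|>R$; slowly increasing functions on $\mathbb R^d$ are identified with the regular tempered distributions they generate. Fourier transform: $\mathcal F_d[\varphi](v)=\int_{\mathbb R^d}e^{-2\pi i\langle x,v\rangle}\varphi(x)\,\mathrm dx$ on $\mathcal S(\mathbb R^d)$, and $\langle\mathcal F_dT,\varphi\rangle:=\langle T,\mathcal F_d\varphi\rangle$ on $\mathcal S'(\mathbb R^d)$; $\mathcal F_d^{-1}$ is its inverse. Rotation operator: $\mathcal R_dF(x):=F(\|x\|)$, $x\in\mathbb R^d$, for $F$ on $[0,\infty)$ or $F$ an even function on $\mathbb R$. For $\psi\in\mathcal S(\mathbb R)$, $\mathcal A_1\psi(r):=\frac12(\psi(r)+\psi(-r))$. The operator $\mathcal R_d^\star\colon\mathcal S'(\mathbb R^d)\to\mathcal S'_{\mathrm{rad}}(\mathbb R)$ is defined by $\langle\mathcal R_d^\star T,\psi\rangle:=\langle T,(\mathcal R_d\circ\mathcal A_1)\psi\rangle$ for all $\psi\in\mathcal S(\mathbb R)$. *)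

theory Defs
  imports "HOL-Probability.Probability"
begin

section \<open>Schwartz functions and tempered distributions\<close>

text \<open>
  A multi-index is represented by a list of basis vectors: \<open>iter_partial [b1, ..., bm] \<phi>\<close> is
  \<open>\<partial>_b1 ... \<partial>_bm \<phi>\<close>. For a smooth \<open>\<phi>\<close> the order of the list is irrelevant.
\<close>

definition iter_partial ::
    "'a::euclidean_space list \<Rightarrow> ('a \<Rightarrow> complex) \<Rightarrow> 'a \<Rightarrow> complex" where
  "iter_partial bs \<phi> = foldr (\<lambda>b g x. frechet_derivative g (at x) b) bs \<phi>"

text \<open>
  Differentiability of all iterated partial derivatives is equivalent to \<open>C^\<infinity>\<close>-smoothness:
  a partial derivative that is itself differentiable is continuous.
\<close>

definition schwartz :: "('a::euclidean_space \<Rightarrow> complex) set" where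
  "schwartz = {\<phi>. \<forall>bs \<in> lists Basis.
     (\<forall>x. iter_partial bs \<phi> differentiable (at x)) \<and>
     (\<forall>k. bounded (range (\<lambda>x. norm x ^ k *\<^sub>R iter_partial bs \<phi> x)))}"

definition schwartz_seminorm ::
    "nat \<Rightarrow> 'a::euclidean_space list \<Rightarrow> ('a \<Rightarrow> complex) \<Rightarrow> real" where
  "schwartz_seminorm k bs \<phi> = (SUP x. norm x ^ k * norm (iter_partial bs \<phi> x))"

definition schwartz_tendsto ::
    "(nat \<Rightarrow> 'a::euclidean_space \<Rightarrow> complex) \<Rightarrow> ('a \<Rightarrow> complex) \<Rightarrow> bool" where
  "schwartz_tendsto \<Phi> \<phi> \<longleftrightarrow>
     (\<forall>k. \<forall>bs \<in> lists Basis.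
        (\<lambda>n. schwartz_seminorm k bs (\<lambda>x. \<Phi> n x - \<phi> x)) \<longlonglongrightarrow> 0)"

text \<open>
  Functionals on the Schwartz space are required to be \<^const>\<open>extensional\<close>, i.e. they take a fixed
  dummy value outside \<^const>\<open>schwartz\<close>. Thus equality of HOL functions is equality of
  distributions. The Schwartz space is metrizable, so continuity is sequential continuity.
\<close>

definition tempered :: "(('a::euclidean_space \<Rightarrow> complex) \<Rightarrow> complex) set" where
  "tempered = {T \<in> extensional schwartz.
     (\<forall>\<phi> \<in> schwartz. \<forall>\<psi> \<in> schwartz. \<forall>a b.
        T (\<lambda>x. a * \<phi> x + b * \<psi> x) = a * T \<phi> + b * T \<psi>) \<and>
     (\<forall>\<Phi>. \<forall>\<phi> \<in> schwartz. (\<forall>n. \<Phi> n \<in> schwartz) \<longrightarrow> schwartz_tendsto \<Phi> \<phi> \<longrightarrow>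
        (\<lambda>n. T (\<Phi> n)) \<longlonglongrightarrow> T \<phi>)}"


section \<open>Regular distributions and slowly increasing functions\<close>

definition locally_integrable_on ::
    "('a::euclidean_space \<Rightarrow> 'b::{banach, second_countable_topology}) \<Rightarrow> 'a set \<Rightarrow> bool" where
  "locally_integrable_on f D \<longleftrightarrow>
     (\<forall>K. compact K \<longrightarrow> K \<subseteq> D \<longrightarrow> f absolutely_integrable_on K)"

definition slowly_increasing_on ::
    "('a::euclidean_space \<Rightarrow> 'b::{banach, second_countable_topology}) \<Rightarrow> 'a set \<Rightarrow> bool" where
  "slowly_increasing_on f D \<longleftrightarrow> locally_integrable_on f D \<and>
     (\<exists>c k R :: real. c > 1 \<and> k > 1 \<and> R > 1 \<and>
        (\<forall>x \<in> D. norm x > R \<longrightarrow> norm (f x) \<le> c * norm x powr k))"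

definition regular_dist ::
    "('a::euclidean_space \<Rightarrow> complex) \<Rightarrow> ('a \<Rightarrow> complex) \<Rightarrow> complex" where
  "regular_dist g = (\<lambda>\<phi> \<in> schwartz. \<integral>x. g x * \<phi> x \<partial>lebesgue)"

text \<open>
  The integrability of \<open>g \<cdot> \<phi>\<close> is stated explicitly because the Bochner integral of a
  non-integrable function is 0.
\<close>

definition regular_tempered_generated_by ::
    "(('a::euclidean_space \<Rightarrow> complex) \<Rightarrow> complex) \<Rightarrow> ('a \<Rightarrow> complex) \<Rightarrow> bool" where
  "regular_tempered_generated_by T g \<longleftrightarrow>
     T \<in> tempered \<and> locally_integrable_on g UNIV \<and>
     (\<forall>\<phi> \<in> schwartz. integrable lebesgue (\<lambda>x. g x * \<phi> x)) \<and> T = regular_dist g"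


section \<open>Fourier transform\<close>

definition fourier :: "('a::euclidean_space \<Rightarrow> complex) \<Rightarrow> 'a \<Rightarrow> complex" where
  "fourier \<phi> v = (\<integral>x. exp (- 2 * of_real pi * \<i> * of_real (x \<bullet> v)) * \<phi> x \<partial>lebesgue)"

definition fourier_dist ::
    "(('a::euclidean_space \<Rightarrow> complex) \<Rightarrow> complex) \<Rightarrow> ('a \<Rightarrow> complex) \<Rightarrow> complex" where
  "fourier_dist T = (\<lambda>\<phi> \<in> schwartz. T (fourier \<phi>))"

definition inv_fourier_dist ::
    "(('a::euclidean_space \<Rightarrow> complex) \<Rightarrow> complex) \<Rightarrow> ('a \<Rightarrow> complex) \<Rightarrow> complex" where
  "inv_fourier_dist = inv_into tempered fourier_dist"


section \<open>Rotation operators\<close>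

definition rot :: "(real \<Rightarrow> 'b) \<Rightarrow> 'a::euclidean_space \<Rightarrow> 'b" where
  "rot F x = F (norm x)"

definition even_part :: "(real \<Rightarrow> complex) \<Rightarrow> real \<Rightarrow> complex" where
  "even_part \<psi> r = (\<psi> r + \<psi> (- r)) / 2"

definition rot_adjoint ::
    "(('a::euclidean_space \<Rightarrow> complex) \<Rightarrow> complex) \<Rightarrow> (real \<Rightarrow> complex) \<Rightarrow> complex" where
  "rot_adjoint T = (\<lambda>\<psi> \<in> schwartz. T (rot (even_part \<psi>)))"


section \<open>Functions of class \<open>C^n\<close> on a subset of the real line\<close>

text \<open>Derivatives are taken within \<open>S\<close>, hence are one-sided at 0 when \<open>S = {0..}\<close>.\<close>

definition nth_deriv_on :: "nat \<Rightarrow> real set \<Rightarrow> (real \<Rightarrow> real) \<Rightarrow> real \<Rightarrow> real" where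
  "nth_deriv_on n S f = ((\<lambda>g x. vector_derivative g (at x within S)) ^^ n) f"

definition C_k_on :: "nat \<Rightarrow> real set \<Rightarrow> (real \<Rightarrow> real) \<Rightarrow> bool" where
  "C_k_on n S f \<longleftrightarrow>
     (\<forall>m<n. nth_deriv_on m S f differentiable_on S) \<and>
     (\<forall>m\<le>n. continuous_on S (nth_deriv_on m S f))"


section \<open>The uniform distribution on the unit sphere\<close>

text \<open>
  Normalized surface measure, obtained from polar coordinates: the surface measure of a Borel
  subset \<open>A\<close> of the unit sphere in dimension \<open>d\<close> is \<open>d\<close> times the volume of the cone
  \<open>{t x | x \<in> A, 0 < t < 1}\<close>, so the normalized measure is the image of the uniform distribution
  on the unit ball under \<open>x \<mapsto> x / \<parallel>x\<parallel>\<close>, which is \<^const>\<open>sgn\<close>. It is regarded as a Borel measure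
  on the whole space; it is concentrated on the sphere.
\<close>

definition sphere_uniform :: "'a::euclidean_space measure" where
  "sphere_uniform = distr (uniform_measure lborel (ball 0 1)) borel sgn"

lemma prob_space_sphere_uniform: "prob_space (sphere_uniform :: 'a::euclidean_space measure)"
proof -
  have "emeasure lborel (ball (0::'a) 1) \<noteq> 0"
    by (simp add: emeasure_ball less_imp_neq[OF unit_ball_vol_pos, symmetric])
  moreover have "emeasure lborel (ball (0::'a) 1) \<noteq> \<infinity>"
    using emeasure_lborel_ball_finite[of "0::'a" 1] by auto
  ultimately have "prob_space (uniform_measure lborel (ball (0::'a) 1))"
    by (rule prob_space_uniform_measure)
  then show ?thesis
    unfolding sphere_uniform_def by (rule prob_space.prob_space_distr) simp
qed

lemma AE_sphere_uniform: "AE \<xi> in sphere_uniform. \<xi> \<in> sphere (0::'a::euclidean_space) 1"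
proof -
  have "AE x in lborel. x \<noteq> (0::'a)"
    by (rule AE_lborel_singleton)
  then have "AE x in uniform_measure lborel (ball (0::'a) 1). sgn x \<in> sphere 0 1"
    by (intro AE_uniform_measureI) (auto simp: norm_sgn)
  then show ?thesis
    unfolding sphere_uniform_def by (subst AE_distr_iff) auto
qed

end

theory Submission
  imports Defs
begin

text \<open>
  For continuous \<open>f\<close> the slicing relation \<open>F(\<parallel>z\<parallel>) = \<E> f(\<bar>\<langle>z, \<xi>\<rangle>\<bar>)\<close> can be inverted explicitly. Lowering
  the dimension from \<open>d + 2\<close> to \<open>d\<close> replaces \<open>F\<close> by \<open>r \<mapsto> F r + r F' r / d\<close>, which costs one derivative,
  and one ends in dimension 1, where \<open>f = F\<close>, or in dimension 2, where \<open>f\<close> is an Abel-type integral of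
  \<open>F'\<close>. Polynomial growth is inherited at each step. The marginal of the sphere enters only through its
  even moments, which determine it on continuous functions by Weierstrass' theorem.

  Conversely, a continuous even \<open>f\<close> of polynomial growth with the slicing relation is the distribution
  in question: with \<open>e\<close> the even part of \<open>\<psi>\<close>, Fubini and the Fourier slice theorem give
  \<open>\<integral> F(\<parallel>x\<parallel>) \<F>\<^sub>d[rot e](x) dx = \<E> \<integral> f(\<langle>x, \<xi>\<rangle>) \<F>\<^sub>d[rot e](x) dx = \<integral> f(t) \<F>\<^sub>1 e(t) dt = \<integral> f(t) \<F>\<^sub>1 \<psi>(t) dt\<close>,
  and \<open>\<F>\<^sub>1\<close> is injective on tempered distributions.
\<close>

section \<open>Schwartz functions\<close>

text \<open>The order floor(d/2) of differentiability is what the descent consumes: dimension 1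
  takes no derivative, dimension 2 takes one, and every step of two dimensions takes one more. The
  density of a coordinate of the sphere changes its shape with the dimension and is unbounded in
  dimension 2. Moments avoid it together with spherical coordinates: rotation invariance alone
  determines the even moments, and an iterated integral is shown to have the same ones. On the
  Fourier side f is merely continuous and of polynomial growth, so it has no Fourier transform as a
  function. In the slice theorem, instead of coordinates adapted to a direction b, f is smoothed by
  a narrow Gaussian, itself an average of characters. The pairing of f(x . b) with a Schwartz
  function then involves only the transform of that function on the line through b, so equal
  restrictions force equal integrals, even between different dimensions. Radial extension meets the
  singularity of |x| at the origin; it is removed by dividing the odd derivative of an even function
  by r.\<close>

definition partial_deriv :: "'a::euclidean_space \<Rightarrow> ('a \<Rightarrow> complex) \<Rightarrow> 'a \<Rightarrow> complex" where
  "partial_deriv b \<phi> = (\<lambda>x. frechet_derivative \<phi> (at x) b)"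

lemma iter_partial_Nil [simp]: "iter_partial [] \<phi> = \<phi>"
  by (simp add: iter_partial_def)

lemma iter_partial_Cons: "iter_partial (b # bs) \<phi> = partial_deriv b (iter_partial bs \<phi>)"
  by (simp add: iter_partial_def partial_deriv_def)

lemma iter_partial_snoc: "iter_partial (bs @ [b]) \<phi> = iter_partial bs (partial_deriv b \<phi>)"
  by (simp add: iter_partial_def partial_deriv_def)

text \<open>Derivatives of every order are handled at once by exhibiting a class that one partial
  derivative does not leave. Finding the class is the content of the closure proofs below: it must
  absorb the terms that the product rule creates.\<close>

lemma schwartz_coinduct:
  assumes "\<phi> \<in> X"
    and diff: "\<And>f x. f \<in> X \<Longrightarrow> f differentiable (at x)"
    and bdd: "\<And>f k. f \<in> X \<Longrightarrow> bounded (range (\<lambda>x. norm x ^ k *\<^sub>R f x))"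
    and pd: "\<And>f b. f \<in> X \<Longrightarrow> b \<in> Basis \<Longrightarrow> partial_deriv b f \<in> X"
  shows "\<phi> \<in> schwartz"
proof -
  have "iter_partial bs \<phi> \<in> X" if "bs \<in> lists Basis" for bs
    using that by (induction bs) (auto simp: iter_partial_Cons \<open>\<phi> \<in> X\<close> pd)
  then show ?thesis
    by (auto simp: schwartz_def diff bdd)
qed

lemma schwartz_differentiable: "\<phi> \<in> schwartz \<Longrightarrow> \<phi> differentiable (at x)"
  unfolding schwartz_def by (auto dest!: bspec[of _ _ "[]"])

lemma schwartz_bounded: "\<phi> \<in> schwartz \<Longrightarrow> bounded (range (\<lambda>x. norm x ^ k *\<^sub>R \<phi> x))"
  unfolding schwartz_def by (auto dest!: bspec[of _ _ "[]"])

lemma schwartz_partial_deriv: "\<phi> \<in> schwartz \<Longrightarrow> b \<in> Basis \<Longrightarrow> partial_deriv b \<phi> \<in> schwartz"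
  unfolding schwartz_def
  by (auto simp: iter_partial_snoc[symmetric] dest!: bspec[of _ _ "_ @ [b]"])

lemma schwartz_continuous_on: "\<phi> \<in> schwartz \<Longrightarrow> continuous_on S \<phi>"
  by (meson schwartz_differentiable continuous_at_imp_continuous_on differentiable_imp_continuous_within)

lemma schwartz_has_derivative:
  assumes "\<phi> \<in> schwartz"
  shows "(\<phi> has_derivative (\<lambda>h. \<Sum>b\<in>Basis. (h \<bullet> b) *\<^sub>R partial_deriv b \<phi> x)) (at x)"
proof -
  have 1: "(\<phi> has_derivative frechet_derivative \<phi> (at x)) (at x)"
    using schwartz_differentiable[OF assms] frechet_derivative_works by blast
  then interpret bounded_linear "frechet_derivative \<phi> (at x)"
    by (rule has_derivative_bounded_linear)
  have "frechet_derivative \<phi> (at x) h = (\<Sum>b\<in>Basis. (h \<bullet> b) *\<^sub>R partial_deriv b \<phi> x)" for h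
  proof -
    have "frechet_derivative \<phi> (at x) h = frechet_derivative \<phi> (at x) (\<Sum>b\<in>Basis. (h \<bullet> b) *\<^sub>R b)"
      by (simp add: euclidean_representation)
    then show ?thesis
      by (simp add: sum scaleR partial_deriv_def)
  qed
  then have "frechet_derivative \<phi> (at x) = (\<lambda>h. \<Sum>b\<in>Basis. (h \<bullet> b) *\<^sub>R partial_deriv b \<phi> x)"
    by blast
  then show ?thesis using 1 by simp
qed

lemma partial_deriv_eqI:
  assumes "\<And>x. (f has_derivative f' x) (at x)"
  shows "partial_deriv b f = (\<lambda>x. f' x b)"
  unfolding partial_deriv_def using frechet_derivative_at[OF assms] by metis

lemma one_plus_power_le:
  fixes y :: real
  assumes "y \<ge> 0"
  shows "(1 + y) ^ k \<le> 2 ^ k * (1 + y ^ k)"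
proof (cases "y \<le> 1")
  case True
  then have "(1 + y) ^ k \<le> 2 ^ k" using assms by (intro power_mono) auto
  also have "\<dots> \<le> 2 ^ k * (1 + y ^ k)" using assms by simp
  finally show ?thesis .
next
  case False
  then have "(1 + y) ^ k \<le> (2 * y) ^ k" using assms by (intro power_mono) auto
  also have "\<dots> \<le> 2 ^ k * (1 + y ^ k)" by (simp add: power_mult_distrib)
  finally show ?thesis .
qed

lemma schwartz_decay:
  assumes "\<phi> \<in> schwartz"
  obtains C where "C > 0" "\<And>x. (1 + norm x) ^ k * norm (\<phi> x) \<le> C"
proof -
  obtain A where A: "\<And>x. norm (\<phi> x) \<le> A"
    using schwartz_bounded[OF assms, of 0] by (auto simp: bounded_iff)
  obtain B where B: "\<And>x. norm x ^ k * norm (\<phi> x) \<le> B"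
    using schwartz_bounded[OF assms, of k] by (auto simp: bounded_iff)
  have "(1 + norm x) ^ k * norm (\<phi> x) \<le> 2 ^ k * (\<bar>A\<bar> + \<bar>B\<bar>) + 1" for x
  proof -
    have "(1 + norm x) ^ k \<le> 2 ^ k * (1 + norm x ^ k)"
      by (rule one_plus_power_le) simp
    then have "(1 + norm x) ^ k * norm (\<phi> x) \<le> 2 ^ k * (1 + norm x ^ k) * norm (\<phi> x)"
      by (rule mult_right_mono) auto
    also have "\<dots> = 2 ^ k * (norm (\<phi> x) + norm x ^ k * norm (\<phi> x))"
      by (simp add: algebra_simps)
    also have "\<dots> \<le> 2 ^ k * (\<bar>A\<bar> + \<bar>B\<bar>)"
      using A[of x] B[of x] by (intro mult_left_mono) auto
    finally show ?thesis by simp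
  qed
  moreover have "2 ^ k * (\<bar>A\<bar> + \<bar>B\<bar>) + 1 > 0"
    by (simp add: add_nonneg_pos)
  ultimately show ?thesis using that by blast
qed

lemma partial_deriv_sum_Basis:
  fixes g :: "'a::euclidean_space \<Rightarrow> 'b::real_vector"
  assumes "c \<in> Basis"
  shows "(\<Sum>b\<in>Basis. (c \<bullet> b) *\<^sub>R g b) = g c"
proof -
  have "(\<Sum>b\<in>Basis. (c \<bullet> b) *\<^sub>R g b) = (\<Sum>b\<in>Basis. if b = c then g b else 0)"
    using assms by (intro sum.cong) (auto simp: inner_Basis)
  then show ?thesis using assms by simp
qed

section \<open>Closure properties of the Schwartz space\<close>

lemma schwartz_lincomb:
  fixes \<phi> \<psi> :: "'a::euclidean_space \<Rightarrow> complex"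
  assumes "\<phi> \<in> schwartz" "\<psi> \<in> schwartz"
  shows "(\<lambda>x. a * \<phi> x + b * \<psi> x) \<in> schwartz"
proof (rule schwartz_coinduct[where X = "{(\<lambda>x. a * \<phi> x + b * \<psi> x) |\<phi> \<psi>. \<phi> \<in> schwartz \<and> \<psi> \<in> schwartz}"])
  fix f x assume "f \<in> {(\<lambda>x. a * \<phi> x + b * \<psi> x) |\<phi> \<psi>. \<phi> \<in> schwartz \<and> \<psi> \<in> schwartz}"
  then show "f differentiable at x"
    by (auto intro!: derivative_intros dest: schwartz_differentiable)
next
  fix f :: "'a \<Rightarrow> complex" and k
  assume "f \<in> {(\<lambda>x. a * \<phi> x + b * \<psi> x) |\<phi> \<psi>. \<phi> \<in> schwartz \<and> \<psi> \<in> schwartz}"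
  then obtain \<phi> \<psi> where *: "f = (\<lambda>x. a * \<phi> x + b * \<psi> x)" "\<phi> \<in> schwartz" "\<psi> \<in> schwartz" by blast
  have "bounded (range (\<lambda>x. a * (norm x ^ k *\<^sub>R \<phi> x) + b * (norm x ^ k *\<^sub>R \<psi> x)))"
    using bounded_linear_image[OF schwartz_bounded[OF *(2), of k] bounded_linear_mult_right[of a]]
      bounded_linear_image[OF schwartz_bounded[OF *(3), of k] bounded_linear_mult_right[of b]]
    unfolding image_image by (rule bounded_plus_comp)
  then show "bounded (range (\<lambda>x. norm x ^ k *\<^sub>R f x))"
    by (simp add: * algebra_simps)
next
  fix f :: "'a \<Rightarrow> complex" and c :: 'a
  assume "f \<in> {(\<lambda>x. a * \<phi> x + b * \<psi> x) |\<phi> \<psi>. \<phi> \<in> schwartz \<and> \<psi> \<in> schwartz}" and c: "c \<in> Basis"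
  then obtain \<phi> \<psi> where *: "f = (\<lambda>x. a * \<phi> x + b * \<psi> x)" "\<phi> \<in> schwartz" "\<psi> \<in> schwartz" by blast
  have "partial_deriv c f = (\<lambda>x. a * (\<Sum>b\<in>Basis. (c \<bullet> b) *\<^sub>R partial_deriv b \<phi> x) +
      b * (\<Sum>b\<in>Basis. (c \<bullet> b) *\<^sub>R partial_deriv b \<psi> x))"
    unfolding * by (rule partial_deriv_eqI) (auto intro!: derivative_eq_intros schwartz_has_derivative *)
  also have "\<dots> = (\<lambda>x. a * partial_deriv c \<phi> x + b * partial_deriv c \<psi> x)"
    unfolding partial_deriv_sum_Basis[OF c] ..
  finally show "partial_deriv c f \<in> {(\<lambda>x. a * \<phi> x + b * \<psi> x) |\<phi> \<psi>. \<phi> \<in> schwartz \<and> \<psi> \<in> schwartz}"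
    using schwartz_partial_deriv[OF *(2) c] schwartz_partial_deriv[OF *(3) c] by blast
qed (use assms in blast)

lemma schwartz_diff: "\<phi> \<in> schwartz \<Longrightarrow> \<psi> \<in> schwartz \<Longrightarrow> (\<lambda>x. \<phi> x - \<psi> x) \<in> schwartz"
  using schwartz_lincomb[of \<phi> \<psi> 1 "-1"] by simp

lemma schwartz_cmult: "\<phi> \<in> schwartz \<Longrightarrow> (\<lambda>x. a * \<phi> x) \<in> schwartz"
  using schwartz_lincomb[of \<phi> \<phi> a 0] by simp

lemma bounded_times_coordinate:
  fixes g :: "'a::euclidean_space \<Rightarrow> complex"
  assumes "\<And>k. bounded (range (\<lambda>x. norm x ^ k *\<^sub>R g x))"
  shows "bounded (range (\<lambda>x. norm x ^ k *\<^sub>R (of_real (x \<bullet> c) * g x)))"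
proof -
  obtain B where B: "\<And>x. norm x ^ Suc k * norm (g x) \<le> B"
    using assms[of "Suc k"] by (auto simp: bounded_iff)
  have "norm (norm x ^ k *\<^sub>R (of_real (x \<bullet> c) * g x)) \<le> norm c * B" for x
  proof -
    have "norm (norm x ^ k *\<^sub>R (of_real (x \<bullet> c) * g x)) = norm x ^ k * (\<bar>x \<bullet> c\<bar> * norm (g x))"
      by (simp add: norm_mult)
    also have "\<dots> \<le> norm x ^ k * ((norm x * norm c) * norm (g x))"
      by (intro mult_left_mono mult_right_mono Cauchy_Schwarz_ineq2) auto
    also have "\<dots> = norm c * (norm x ^ Suc k * norm (g x))" by simp
    also have "\<dots> \<le> norm c * B" using B by (intro mult_left_mono) auto
    finally show ?thesis .
  qed
  then show ?thesis by (auto simp: bounded_iff)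
qed

text \<open>Multiples of a coordinate alone do not form a closed class, since the product rule also
  yields \<phi> without the coordinate. Hence \<open>X\<close> allows an additional Schwartz
  summand.\<close>

lemma schwartz_mult_coordinate:
  fixes \<phi> :: "'a::euclidean_space \<Rightarrow> complex"
  assumes "\<phi> \<in> schwartz"
  shows "(\<lambda>x. of_real (x \<bullet> c) * \<phi> x) \<in> schwartz"
proof (rule schwartz_coinduct[where X = "{(\<lambda>x. \<psi> x + of_real (x \<bullet> c) * \<phi> x) |\<phi> \<psi>. \<phi> \<in> schwartz \<and> \<psi> \<in> schwartz}"])
  show "(\<lambda>x. of_real (x \<bullet> c) * \<phi> x) \<in> {(\<lambda>x. \<psi> x + of_real (x \<bullet> c) * \<phi> x) |\<phi> \<psi>. \<phi> \<in> schwartz \<and> \<psi> \<in> schwartz}"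
    using assms schwartz_cmult[OF assms, of 0] by (intro CollectI exI[of _ \<phi>] exI[of _ "\<lambda>_. 0"], auto)
next
  fix f x assume "f \<in> {(\<lambda>x. \<psi> x + of_real (x \<bullet> c) * \<phi> x) |\<phi> \<psi>. \<phi> \<in> schwartz \<and> \<psi> \<in> schwartz}"
  then obtain \<phi> \<psi> where *: "f = (\<lambda>x. \<psi> x + of_real (x \<bullet> c) * \<phi> x)" "\<phi> \<in> schwartz" "\<psi> \<in> schwartz" by blast
  show "f differentiable at x"
    unfolding differentiable_def *
    by (rule exI) (auto intro!: derivative_eq_intros schwartz_has_derivative *)
next
  fix f :: "'a \<Rightarrow> complex" and k
  assume "f \<in> {(\<lambda>x. \<psi> x + of_real (x \<bullet> c) * \<phi> x) |\<phi> \<psi>. \<phi> \<in> schwartz \<and> \<psi> \<in> schwartz}"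
  then obtain \<phi> \<psi> where *: "f = (\<lambda>x. \<psi> x + of_real (x \<bullet> c) * \<phi> x)" "\<phi> \<in> schwartz" "\<psi> \<in> schwartz" by blast
  show "bounded (range (\<lambda>x. norm x ^ k *\<^sub>R f x))"
    unfolding * scaleR_add_right
    by (intro bounded_plus_comp schwartz_bounded bounded_times_coordinate *)
next
  fix f :: "'a \<Rightarrow> complex" and b :: 'a
  assume "f \<in> {(\<lambda>x. \<psi> x + of_real (x \<bullet> c) * \<phi> x) |\<phi> \<psi>. \<phi> \<in> schwartz \<and> \<psi> \<in> schwartz}" and b: "b \<in> Basis"
  then obtain \<phi> \<psi> where *: "f = (\<lambda>x. \<psi> x + of_real (x \<bullet> c) * \<phi> x)" "\<phi> \<in> schwartz" "\<psi> \<in> schwartz" by blast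
  have "partial_deriv b f = (\<lambda>x. (\<Sum>d\<in>Basis. (b \<bullet> d) *\<^sub>R partial_deriv d \<psi> x) +
      (of_real (x \<bullet> c) * (\<Sum>d\<in>Basis. (b \<bullet> d) *\<^sub>R partial_deriv d \<phi> x) + of_real (b \<bullet> c) * \<phi> x))"
    unfolding * by (rule partial_deriv_eqI) (auto intro!: derivative_eq_intros schwartz_has_derivative *)
  also have "\<dots> = (\<lambda>x. (1 * partial_deriv b \<psi> x + of_real (b \<bullet> c) * \<phi> x) + of_real (x \<bullet> c) * partial_deriv b \<phi> x)"
    unfolding partial_deriv_sum_Basis[OF b] by (simp add: algebra_simps)
  finally show "partial_deriv b f \<in> {(\<lambda>x. \<psi> x + of_real (x \<bullet> c) * \<phi> x) |\<phi> \<psi>. \<phi> \<in> schwartz \<and> \<psi> \<in> schwartz}"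
    by (intro CollectI exI[of _ "partial_deriv b \<phi>"]
        exI[of _ "\<lambda>x. 1 * partial_deriv b \<psi> x + of_real (b \<bullet> c) * \<phi> x"] conjI
        schwartz_lincomb schwartz_partial_deriv *(2,3) b)
qed

text \<open>Prepares integration by parts against the Fourier kernel: the integral of a derivative
  of the modulated function combines the transform of the derivative with a multiple of the
  transform. The factor 1 gives the bracket the shape of \<open>schwartz_lincomb\<close>.\<close>

lemma schwartz_modulation:
  fixes \<phi> :: "'a::euclidean_space \<Rightarrow> complex"
  assumes "\<phi> \<in> schwartz"
  shows "(\<lambda>x. cis (x \<bullet> v) * \<phi> x) \<in> schwartz"
    and "b \<in> Basis \<Longrightarrow> partial_deriv b (\<lambda>x. cis (x \<bullet> v) * \<phi> x) =
      (\<lambda>x. cis (x \<bullet> v) * (1 * partial_deriv b \<phi> x + \<i> * of_real (b \<bullet> v) * \<phi> x))"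
proof -
  have der: "((\<lambda>x. cis (x \<bullet> v) * \<phi> x) has_derivative
      (\<lambda>h. cis (x \<bullet> v) * (\<Sum>d\<in>Basis. (h \<bullet> d) *\<^sub>R partial_deriv d \<phi> x) +
        (h \<bullet> v) *\<^sub>R (\<i> * cis (x \<bullet> v)) * \<phi> x)) (at x)" if "\<phi> \<in> schwartz" for \<phi> x
    by (auto intro!: derivative_eq_intros schwartz_has_derivative that simp: scaleR_conv_of_real)
  have pd: "partial_deriv b (\<lambda>x. cis (x \<bullet> v) * \<phi> x) =
      (\<lambda>x. cis (x \<bullet> v) * (1 * partial_deriv b \<phi> x + \<i> * of_real (b \<bullet> v) * \<phi> x))"
    if "\<phi> \<in> schwartz" "b \<in> Basis" for b \<phi>
    using partial_deriv_eqI[OF der[OF that(1)], of b]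
    unfolding partial_deriv_sum_Basis[OF that(2)]
    by (simp add: algebra_simps scaleR_conv_of_real)
  then show "b \<in> Basis \<Longrightarrow> partial_deriv b (\<lambda>x. cis (x \<bullet> v) * \<phi> x) =
      (\<lambda>x. cis (x \<bullet> v) * (1 * partial_deriv b \<phi> x + \<i> * of_real (b \<bullet> v) * \<phi> x))"
    using assms by blast
  show "(\<lambda>x. cis (x \<bullet> v) * \<phi> x) \<in> schwartz"
  proof (rule schwartz_coinduct[where X = "{(\<lambda>x. cis (x \<bullet> v) * \<phi> x) |\<phi>. \<phi> \<in> schwartz}"])
    fix f x assume "f \<in> {(\<lambda>x. cis (x \<bullet> v) * \<phi> x) |\<phi>. \<phi> \<in> schwartz}"
    then show "f differentiable at x"
      using der differentiable_def by blast
  next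
    fix f :: "'a \<Rightarrow> complex" and k assume "f \<in> {(\<lambda>x. cis (x \<bullet> v) * \<phi> x) |\<phi>. \<phi> \<in> schwartz}"
    then obtain \<phi> where *: "f = (\<lambda>x. cis (x \<bullet> v) * \<phi> x)" "\<phi> \<in> schwartz" by blast
    show "bounded (range (\<lambda>x. norm x ^ k *\<^sub>R f x))"
      using schwartz_bounded[OF *(2), of k] by (simp add: * bounded_iff norm_mult)
  next
    fix f and b :: 'a assume "f \<in> {(\<lambda>x. cis (x \<bullet> v) * \<phi> x) |\<phi>. \<phi> \<in> schwartz}" and b: "b \<in> Basis"
    then obtain \<phi> where *: "f = (\<lambda>x. cis (x \<bullet> v) * \<phi> x)" "\<phi> \<in> schwartz" by blast
    show "partial_deriv b f \<in> {(\<lambda>x. cis (x \<bullet> v) * \<phi> x) |\<phi>. \<phi> \<in> schwartz}"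
      unfolding * pd[OF *(2) b]
      by (intro CollectI exI[of _ "\<lambda>x. 1 * partial_deriv b \<phi> x + \<i> * of_real (b \<bullet> v) * \<phi> x"] conjI refl
          schwartz_lincomb schwartz_partial_deriv *(2) b)
  qed (use assms in blast)
qed

lemma schwartz_reflect:
  fixes \<phi> :: "'a::euclidean_space \<Rightarrow> complex"
  assumes "\<phi> \<in> schwartz"
  shows "(\<lambda>x. \<phi> (- x)) \<in> schwartz"
proof (rule schwartz_coinduct[where X = "{(\<lambda>x. \<phi> (- x)) |\<phi> :: 'a \<Rightarrow> complex. \<phi> \<in> schwartz}"])
  have der: "((\<lambda>x. \<phi> (- x)) has_derivative
      (\<lambda>h. \<Sum>d\<in>Basis. (- h \<bullet> d) *\<^sub>R partial_deriv d \<phi> (- x))) (at x)" if "\<phi> \<in> schwartz" for \<phi> :: "'a \<Rightarrow> complex" and x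
    by (rule has_derivative_compose[OF _ schwartz_has_derivative[OF that], of uminus])
      (auto intro!: derivative_eq_intros)
  { fix f x assume "f \<in> {(\<lambda>x. \<phi> (- x)) |\<phi> :: 'a \<Rightarrow> complex. \<phi> \<in> schwartz}"
    then show "f differentiable at x"
      using der differentiable_def by blast }
  { fix f :: "'a \<Rightarrow> complex" and k assume "f \<in> {(\<lambda>x. \<phi> (- x)) |\<phi> :: 'a \<Rightarrow> complex. \<phi> \<in> schwartz}"
    then obtain \<phi> where *: "f = (\<lambda>x. \<phi> (- x))" "\<phi> \<in> schwartz" by blast
    obtain B where "\<And>x. norm x ^ k * norm (\<phi> x) \<le> B"
      using schwartz_bounded[OF *(2), of k] by (auto simp: bounded_iff)
    from this[of "- _"] show "bounded (range (\<lambda>x. norm x ^ k *\<^sub>R f x))"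
      by (auto simp: bounded_iff *) }
  { fix f and b :: 'a assume "f \<in> {(\<lambda>x. \<phi> (- x)) |\<phi> :: 'a \<Rightarrow> complex. \<phi> \<in> schwartz}" and b: "b \<in> Basis"
    then obtain \<phi> where *: "f = (\<lambda>x. \<phi> (- x))" "\<phi> \<in> schwartz" by blast
    have "partial_deriv b f = (\<lambda>x. (-1) * partial_deriv b \<phi> (- x))"
      using partial_deriv_eqI[OF der[OF *(2)], of b]
      unfolding * inner_minus_left scaleR_minus_left sum_negf partial_deriv_sum_Basis[OF b] by simp
    then show "partial_deriv b f \<in> {(\<lambda>x. \<phi> (- x)) |\<phi> :: 'a \<Rightarrow> complex. \<phi> \<in> schwartz}"
      using schwartz_cmult[OF schwartz_partial_deriv[OF *(2) b], of "-1"] by auto }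
qed (use assms in blast)

section \<open>Integrability from polynomial decay\<close>

text \<open>Fubini in all coordinates: \<open>lborel\<close> is the image of a product of
  one-dimensional Lebesgue measures. It serves for an integrable comparison function and for
  Gaussians.\<close>

lemma lborel_prod_Basis:
  fixes g :: "'a::euclidean_space \<Rightarrow> real \<Rightarrow> 'b::{real_normed_field, banach, second_countable_topology}"
  assumes int: "\<And>b. b \<in> Basis \<Longrightarrow> integrable lborel (g b)"
  shows "integrable lborel (\<lambda>x::'a. \<Prod>b\<in>Basis. g b (x \<bullet> b))"
    and "integral\<^sup>L lborel (\<lambda>x::'a. \<Prod>b\<in>Basis. g b (x \<bullet> b)) = (\<Prod>b\<in>Basis. integral\<^sup>L lborel (g b))"
proof -
  interpret product_sigma_finite "\<lambda>_::'a. lborel :: real measure" ..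
  have [measurable]: "g b \<in> borel_measurable borel" if "b \<in> Basis" for b
    using borel_measurable_integrable[OF int[OF that]] by simp
  have m: "(\<lambda>x::'a. \<Prod>b\<in>Basis. g b (x \<bullet> b)) \<in> borel_measurable borel"
    by measurable
  have eq: "(\<Prod>b\<in>Basis. g b ((\<Sum>c\<in>Basis. f c *\<^sub>R c) \<bullet> b)) = (\<Prod>b\<in>Basis. g b (f b))" for f :: "'a \<Rightarrow> real"
    by (intro prod.cong) simp_all
  have "integrable (\<Pi>\<^sub>M b\<in>(Basis :: 'a set). lborel) (\<lambda>f. \<Prod>b\<in>Basis. g b (f b))"
    by (rule product_integrable_prod) (auto intro: int)
  then show "integrable lborel (\<lambda>x::'a. \<Prod>b\<in>Basis. g b (x \<bullet> b))"
    unfolding lborel_eq[where 'a = 'a] by (subst integrable_distr_eq) (use m in \<open>auto simp: eq\<close>)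
  have "(\<integral>f. (\<Prod>b\<in>Basis. g b (f b)) \<partial>(\<Pi>\<^sub>M b\<in>(Basis :: 'a set). lborel)) =
      (\<Prod>b\<in>Basis. integral\<^sup>L lborel (g b))"
    by (rule product_integral_prod) (auto intro: int)
  then show "integral\<^sup>L lborel (\<lambda>x::'a. \<Prod>b\<in>Basis. g b (x \<bullet> b)) = (\<Prod>b\<in>Basis. integral\<^sup>L lborel (g b))"
    by (subst lborel_eq, subst integral_distr) (use m in \<open>auto simp: eq\<close>)
qed

text \<open>The comparison function is the product of the one-dimensional weights 1/(1 + t^2). Each
  coordinate is at most the norm in modulus, so the reciprocal of this product is at most (1 +
  |x|)^(2 DIM), which explains the exponent.\<close>

lemma integrable_lborel_decay:
  fixes f :: "'a::euclidean_space \<Rightarrow> 'b::{banach, second_countable_topology}"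
  assumes [measurable]: "f \<in> borel_measurable borel"
    and bound: "\<And>x. (1 + norm x) ^ (2 * DIM('a)) * norm (f x) \<le> C"
  shows "integrable lborel f"
proof -
  let ?w = "\<lambda>x::'a. \<Prod>b\<in>Basis. inverse (1 + (x \<bullet> b)\<^sup>2)"
  have "integrable lborel (\<lambda>t::real. inverse (1 + t\<^sup>2))"
    using integrable_inverse_1_plus_square by (simp add: set_integrable_def einterval_def)
  then have w: "integrable lborel ?w"
    by (intro lborel_prod_Basis)
  have "norm (f x) \<le> C * ?w x" for x
  proof -
    have "(\<Prod>b\<in>Basis. 1 + (x \<bullet> b)\<^sup>2) \<le> (\<Prod>b\<in>(Basis :: 'a set). (1 + norm x)\<^sup>2)"
    proof (rule prod_mono)
      fix b :: 'a assume "b \<in> Basis"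
      then have "\<bar>x \<bullet> b\<bar>\<^sup>2 \<le> (norm x)\<^sup>2"
        by (intro power_mono Basis_le_norm) auto
      then show "0 \<le> 1 + (x \<bullet> b)\<^sup>2 \<and> 1 + (x \<bullet> b)\<^sup>2 \<le> (1 + norm x)\<^sup>2"
        using norm_ge_zero[of x] by (simp add: power2_sum add_increasing2)
    qed
    also have "\<dots> = (1 + norm x) ^ (2 * DIM('a))"
      by (simp add: power_mult)
    finally have "(\<Prod>b\<in>Basis. 1 + (x \<bullet> b)\<^sup>2) * norm (f x) \<le> (1 + norm x) ^ (2 * DIM('a)) * norm (f x)"
      by (rule mult_right_mono) simp
    also have "\<dots> \<le> C" by (rule bound)
    finally have "norm (f x) * (\<Prod>b\<in>Basis. 1 + (x \<bullet> b)\<^sup>2) \<le> C" by (simp add: mult.commute)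
    moreover have "(\<Prod>b\<in>Basis. 1 + (x \<bullet> b)\<^sup>2) > 0"
      by (intro prod_pos) (simp add: add_pos_nonneg)
    ultimately show ?thesis
      by (simp add: prod_inversef[unfolded o_def] pos_le_divide_eq divide_inverse[symmetric])
  qed
  then have "norm (f x) \<le> norm (C * ?w x)" for x
    unfolding real_norm_def by (rule order_trans[OF _ abs_ge_self])
  then show ?thesis
    by (intro Bochner_Integration.integrable_bound[OF integrable_mult_right[OF w, of C]]) auto
qed

lemma schwartz_measurable [measurable_dest]: "\<phi> \<in> schwartz \<Longrightarrow> \<phi> \<in> borel_measurable borel"
  by (simp add: borel_measurable_continuous_onI schwartz_continuous_on)

lemma integrable_poly_growth_schwartz:
  fixes g :: "'a::euclidean_space \<Rightarrow> complex"
  assumes [measurable]: "g \<in> borel_measurable borel"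
    and g: "\<And>x. norm (g x) \<le> C * (1 + norm x) ^ k" and "\<phi> \<in> schwartz"
  shows "integrable lborel (\<lambda>x. g x * \<phi> x)"
proof -
  have [measurable]: "\<phi> \<in> borel_measurable borel" using assms schwartz_measurable by blast
  obtain B where B: "\<And>x. (1 + norm x) ^ (2 * DIM('a) + k) * norm (\<phi> x) \<le> B"
    using schwartz_decay[OF \<open>\<phi> \<in> schwartz\<close>] by metis
  have C: "C \<ge> 0" using g[of 0] by (simp add: order_trans[OF norm_ge_zero])
  show ?thesis
  proof (rule integrable_lborel_decay)
    fix x
    have "(1 + norm x) ^ (2 * DIM('a)) * norm (g x * \<phi> x) \<le> (1 + norm x) ^ (2 * DIM('a)) * ((C * (1 + norm x) ^ k) * norm (\<phi> x))"
      unfolding norm_mult by (intro mult_left_mono mult_right_mono g) auto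
    also have "\<dots> = C * ((1 + norm x) ^ (2 * DIM('a) + k) * norm (\<phi> x))"
      by (simp add: power_add)
    also have "\<dots> \<le> C * B" by (intro mult_left_mono B C)
    finally show "(1 + norm x) ^ (2 * DIM('a)) * norm (g x * \<phi> x) \<le> C * B" .
  qed measurable
qed

lemma schwartz_integrable: "\<phi> \<in> schwartz \<Longrightarrow> integrable lborel \<phi>"
  using integrable_poly_growth_schwartz[of "\<lambda>_. 1" 1 0 \<phi>] by simp

section \<open>Radial Schwartz functions\<close>

lemma schwartz_has_vector_derivative:
  fixes \<phi> :: "real \<Rightarrow> complex"
  assumes "\<phi> \<in> schwartz"
  shows "(\<phi> has_vector_derivative partial_deriv 1 \<phi> x) (at x)"
  using schwartz_has_derivative[OF assms, of x] by (simp add: has_vector_derivative_def)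

lemma partial_deriv_1_eqI:
  "(\<And>x. (f has_vector_derivative f' x) (at x)) \<Longrightarrow> partial_deriv 1 f = f'"
  using partial_deriv_eqI[of f "\<lambda>x h. h *\<^sub>R f' x" 1] by (simp add: has_vector_derivative_def)

lemma has_vector_derivative_scaled_argument:
  fixes f :: "real \<Rightarrow> 'a::real_normed_vector"
  assumes "\<And>x. (f has_vector_derivative f' x) (at x)"
  shows "((\<lambda>r. f (s * r)) has_vector_derivative s *\<^sub>R f' (s * r)) (at r within S)"
proof -
  have "((\<lambda>r. s * r) has_vector_derivative s) (at r)"
    by (auto intro!: derivative_eq_intros)
  from vector_diff_chain_at[OF this assms] show ?thesis
    by (simp add: o_def has_vector_derivative_at_within)
qed

text \<open>
  The quotient is \<open>r \<mapsto> \<integral>\<^sub>0\<^sup>1 g'(s r) ds\<close>, whose \<open>k\<close>-th derivative is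
  \<open>q\<^sub>k(r) = \<integral>\<^sub>0\<^sup>1 s\<^sup>k g\<^sup>(\<^sup>k\<^sup>+\<^sup>1\<^sup>)(s r) ds\<close>. Integration by parts gives
  \<open>r q\<^sub>k\<^sub>+\<^sub>1 = g\<^sup>(\<^sup>k\<^sup>+\<^sup>1\<^sup>) - (k + 1) q\<^sub>k\<close>, which yields the decay.
\<close>

lemma schwartz_divide_by_id:
  fixes g :: "real \<Rightarrow> complex"
  assumes "g \<in> schwartz" "g 0 = 0"
  obtains q where "q \<in> schwartz" "\<And>r. of_real r * q r = g r"
proof -
  define G where "G i = (partial_deriv 1 ^^ i) g" for i
  have G: "G i \<in> schwartz" for i
    unfolding G_def by (induction i) (auto intro: assms schwartz_partial_deriv)
  have G0: "G 0 = g" by (simp add: G_def)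
  have Gder: "(G i has_vector_derivative G (Suc i) x) (at x)" for i x
    using schwartz_has_vector_derivative[OF G] by (simp add: G_def)
  have Gcont: "continuous_on S (\<lambda>x. G i (h x))" if "continuous_on S h" for i S and h :: "'z::topological_space \<Rightarrow> real"
    using continuous_on_compose2[OF schwartz_continuous_on[OF G, of UNIV i] that] by auto
  define q where "q k r = integral {0..1} (\<lambda>s. s ^ k *\<^sub>R G (Suc k) (s * r))" for k r
  have qder: "(q k has_vector_derivative q (Suc k) r) (at r)" for k r
  proof -
    have "((\<lambda>r. integral (cbox 0 1) (\<lambda>s. s ^ k *\<^sub>R G (Suc k) (s * r))) has_vector_derivative
        integral (cbox 0 1) (\<lambda>s. s ^ k *\<^sub>R (s *\<^sub>R G (Suc (Suc k)) (s * r)))) (at r within UNIV)"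
    proof (rule leibniz_rule_vector_derivative)
      fix r s :: real
      have "((\<lambda>r. G (Suc k) (s * r)) has_vector_derivative s *\<^sub>R G (Suc (Suc k)) (s * r)) (at r)"
        by (rule has_vector_derivative_scaled_argument[OF Gder])
      then show "((\<lambda>r. s ^ k *\<^sub>R G (Suc k) (s * r)) has_vector_derivative s ^ k *\<^sub>R s *\<^sub>R G (Suc (Suc k)) (s * r)) (at r within UNIV)"
        by (auto intro!: derivative_eq_intros)
    next
      show "(\<lambda>s. s ^ k *\<^sub>R G (Suc k) (s * r)) integrable_on cbox 0 1" for r
        by (intro integrable_continuous continuous_intros Gcont)
      show "continuous_on (UNIV \<times> cbox 0 1) (\<lambda>(r, s). s ^ k *\<^sub>R s *\<^sub>R G (Suc (Suc k)) (s * r))"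
        by (auto simp: split_beta intro!: continuous_intros Gcont)
    qed auto
    then show ?thesis by (simp add: q_def[abs_def] mult.commute)
  qed
  have qint: "(\<lambda>s. s ^ k *\<^sub>R G j (s * r)) integrable_on {0..1}" for k j r
    by (intro integrable_continuous_real continuous_intros Gcont)
  have Gs: "((\<lambda>s. G j (s * r)) has_vector_derivative r *\<^sub>R G (Suc j) (s * r)) (at s within S)" for j r s S
    using has_vector_derivative_scaled_argument[OF Gder, where s = r] by (simp add: mult.commute[of _ r])
  have q0: "of_real r * q 0 r = g r" for r
  proof -
    have "((\<lambda>s. r *\<^sub>R G (Suc 0) (s * r)) has_integral (G 0 (1 * r) - G 0 (0 * r))) {0..1}"
      by (rule fundamental_theorem_of_calculus) (auto intro: Gs)
    then have "integral {0..1} (\<lambda>s. r *\<^sub>R G (Suc 0) (s * r)) = g r"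
      using assms(2) by (intro integral_unique) (simp add: G0)
    then show ?thesis by (simp add: q_def scaleR_conv_of_real)
  qed
  have qSuc: "of_real r * q (Suc k) r = G (Suc k) r - of_nat (Suc k) * q k r" for k r
  proof -
    have "((\<lambda>s. s ^ Suc k *\<^sub>R (r *\<^sub>R G (Suc (Suc k)) (s * r)) + (real (Suc k) * s ^ k) *\<^sub>R G (Suc k) (s * r))
      has_integral (1 ^ Suc k *\<^sub>R G (Suc k) (1 * r) - 0 ^ Suc k *\<^sub>R G (Suc k) (0 * r))) {0..1}"
    proof (rule fundamental_theorem_of_calculus)
      fix s :: real
      have "((\<lambda>s. s ^ Suc k) has_real_derivative real (Suc k) * s ^ k) (at s within {0..1})"
        by (rule derivative_eq_intros refl | simp)+
      then show "((\<lambda>s. s ^ Suc k *\<^sub>R G (Suc k) (s * r)) has_vector_derivative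
        s ^ Suc k *\<^sub>R (r *\<^sub>R G (Suc (Suc k)) (s * r)) + (real (Suc k) * s ^ k) *\<^sub>R G (Suc k) (s * r)) (at s within {0..1})"
        by (intro has_vector_derivative_scaleR Gs)
    qed auto
    then have "integral {0..1} (\<lambda>s. r *\<^sub>R (s ^ Suc k *\<^sub>R G (Suc (Suc k)) (s * r)) + real (Suc k) *\<^sub>R (s ^ k *\<^sub>R G (Suc k) (s * r))) = G (Suc k) r"
      by (simp add: integral_unique mult.commute)
    then have "r *\<^sub>R q (Suc k) r + real (Suc k) *\<^sub>R q k r = G (Suc k) r"
      unfolding q_def
      by (subst (asm) integral_add) (auto intro!: integrable_cmul qint simp del: power_Suc scaleR_scaleR)
    then show ?thesis by (simp add: scaleR_conv_of_real algebra_simps)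
  qed
  \<comment> \<open>One power of r is spent at a time through \<open>q0\<close> or
    \<open>qSuc\<close>: on \<open>q 0\<close> it returns g, on a later \<open>q\<close> it lowers
    the index. So the induction runs over the power, for all k simultaneously.\<close>
  have qbdd: "\<exists>B. \<forall>r. \<bar>r\<bar> ^ m * norm (q k r) \<le> B" for m k
  proof (induction m arbitrary: k)
    case 0
    obtain B where "B > 0" and B: "\<And>x. norm (G (Suc k) x) \<le> B"
      using schwartz_decay[OF G, of 0 "Suc k"] by auto
    have "norm (q k r) \<le> B * (1 - 0)" for r
      unfolding q_def
    proof (rule integral_bound)
      fix s :: real assume s: "s \<in> {0..1}"
      have "s ^ k * norm (G (Suc k) (s * r)) \<le> 1 * B"
        using s B \<open>B > 0\<close> by (intro mult_mono power_le_one) auto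
      then show "norm (s ^ k *\<^sub>R G (Suc k) (s * r)) \<le> B" using s by simp
    qed (auto intro!: continuous_intros Gcont)
    then show ?case by auto
  next
    case (Suc m)
    show ?case
    proof (cases k)
      case 0
      obtain B where "\<And>r. norm (norm r ^ m *\<^sub>R g r) \<le> B"
        using schwartz_bounded[OF assms(1), of m] by (auto simp: bounded_iff)
      moreover have "\<bar>r\<bar> ^ Suc m * norm (q 0 r) = norm (norm r ^ m *\<^sub>R g r)" for r
        by (simp add: q0[symmetric] norm_mult algebra_simps)
      ultimately show ?thesis using 0 by metis
    next
      case (Suc j)
      obtain B where B: "\<And>r. norm (norm r ^ m *\<^sub>R G (Suc j) r) \<le> B"
        using schwartz_bounded[OF G, of m "Suc j"] by (auto simp: bounded_iff)
      obtain B' where B': "\<And>r. \<bar>r\<bar> ^ m * norm (q j r) \<le> B'"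
        using Suc.IH by blast
      have "\<bar>r\<bar> ^ Suc m * norm (q (Suc j) r) \<le> B + real (Suc j) * B'" for r
      proof -
        have "\<bar>r\<bar> ^ Suc m * norm (q (Suc j) r) = \<bar>r\<bar> ^ m * norm (of_real r * q (Suc j) r)"
          by (simp add: norm_mult)
        also have "\<dots> \<le> \<bar>r\<bar> ^ m * (norm (G (Suc j) r) + norm (of_nat (Suc j) * q j r))"
          unfolding qSuc by (intro mult_left_mono norm_triangle_ineq4) auto
        also have "\<dots> = norm (norm r ^ m *\<^sub>R G (Suc j) r) + real (Suc j) * (\<bar>r\<bar> ^ m * norm (q j r))"
          by (simp add: norm_mult algebra_simps del: of_nat_Suc)
        also have "\<dots> \<le> B + real (Suc j) * B'"
          by (intro add_mono mult_left_mono B B') auto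
        finally show ?thesis .
      qed
      then show ?thesis unfolding Suc by blast
    qed
  qed
  have "q 0 \<in> schwartz"
  proof (rule schwartz_coinduct[where X = "range q"])
    fix f x assume "f \<in> range q"
    then show "f differentiable at x"
      using qder has_vector_derivative_def differentiable_def by blast
  next
    fix f :: "real \<Rightarrow> complex" and m assume "f \<in> range q"
    then show "bounded (range (\<lambda>x. norm x ^ m *\<^sub>R f x))"
      using qbdd by (auto simp: bounded_iff norm_mult)
  next
    fix f and b :: real assume "f \<in> range q" "b \<in> Basis"
    then show "partial_deriv b f \<in> range q"
      using partial_deriv_1_eqI[OF qder] by auto
  qed simp
  then show thesis using q0 that by blast
qed

text \<open>The derivative of an even function is odd, so it vanishes at 0 and is divisible by r
  within the Schwartz space. The factor r cancels the singularity of x/|x| when the function is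
  extended radially.\<close>

lemma even_schwartz_derivative:
  fixes e :: "real \<Rightarrow> complex"
  assumes e: "e \<in> schwartz" and even: "\<And>r. e (- r) = e r"
  obtains q where "q \<in> schwartz" "\<And>r. q (- r) = q r"
    "\<And>r. (e has_vector_derivative of_real r * q r) (at r)"
proof -
  have der: "(e has_vector_derivative partial_deriv 1 e r) (at r)" for r
    by (rule schwartz_has_vector_derivative[OF e])
  have odd: "partial_deriv 1 e (- r) = - partial_deriv 1 e r" for r
  proof -
    have "((\<lambda>x. e (- x)) has_vector_derivative - partial_deriv 1 e (- r)) (at r)"
      using has_vector_derivative_scaled_argument[OF der, of "- 1" r] by simp
    then have "(e has_vector_derivative - partial_deriv 1 e (- r)) (at r)"
      by (simp add: even)
    then show ?thesis
      using vector_derivative_unique_at[OF der[of r]] by (metis minus_minus)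
  qed
  then have "partial_deriv 1 e 0 = 0" using odd[of 0] by simp
  then obtain q where q: "q \<in> schwartz" "\<And>r. of_real r * q r = partial_deriv 1 e r"
    using schwartz_divide_by_id[OF schwartz_partial_deriv[OF e]] by auto
  have "q (- r) = q r" for r
    using q(2)[of r] q(2)[of "- r"] odd[of r]
    by (cases "r = 0") (auto, metis mult_cancel_left of_real_eq_0_iff)
  then show thesis using that q der by simp
qed

section \<open>Radial extension to several variables\<close>

text \<open>Away from the origin the factor r in the derivative of e cancels the |x| in
  \<open>sgn x\<close>. At the origin, where the norm is not differentiable, the claimed derivative
  is 0, and the difference quotient of e at 0 is composed with the norm.\<close>

lemma rot_has_derivative:
  fixes e q :: "real \<Rightarrow> complex"
  assumes der: "\<And>r. (e has_vector_derivative of_real r * q r) (at r)"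
  shows "(rot e has_derivative (\<lambda>h. of_real (h \<bullet> x) * rot q x)) (at (x :: 'a::euclidean_space))"
proof (cases "x = 0")
  case False
  have "((\<lambda>y. e (norm y)) has_derivative (\<lambda>h. (h \<bullet> sgn x) *\<^sub>R (of_real (norm x) * q (norm x)))) (at x)"
    using has_derivative_compose[OF has_derivative_norm[OF False] der[unfolded has_vector_derivative_def]]
    by (simp add: inner_commute)
  moreover have "(h \<bullet> sgn x) *\<^sub>R (of_real (norm x) * q (norm x)) = of_real (h \<bullet> x) * rot q x" for h
    using False by (simp add: sgn_div_norm rot_def scaleR_conv_of_real)
  ultimately show ?thesis by (simp add: rot_def[abs_def])
next
  case True
  have "((\<lambda>h. norm (e h - e 0) / \<bar>h\<bar>) \<longlongrightarrow> 0) (at 0)"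
    using der[of 0] by (simp add: has_vector_derivative_def has_derivative_at)
  then have "((\<lambda>h. norm (e (norm h) - e 0) / \<bar>norm h\<bar>) \<longlongrightarrow> 0) (at (0::'a))"
    by (rule filterlim_compose) (auto simp: filterlim_at eventually_at_filter intro!: tendsto_norm_zero tendsto_ident_at)
  then show ?thesis
    using True by (simp add: has_derivative_at rot_def tendsto_norm_zero_iff divide_inverse mult.commute)
qed

text \<open>Polynomial multiples of radial functions. A derivative of \<open>rot e\<close> is a
  coordinate times another radial function, so radial functions alone are not closed under
  differentiation, while this class is; \<open>cmult\<close> accommodates the constants from
  differentiating coordinates.\<close>

inductive_set radial_multiples :: "('a::euclidean_space \<Rightarrow> complex) set" where
  rot: "e \<in> schwartz \<Longrightarrow> (\<And>r. e (- r) = e r) \<Longrightarrow> rot e \<in> radial_multiples"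
| add: "f \<in> radial_multiples \<Longrightarrow> g \<in> radial_multiples \<Longrightarrow> (\<lambda>x. f x + g x) \<in> radial_multiples"
| mult: "f \<in> radial_multiples \<Longrightarrow> (\<lambda>x. of_real (x \<bullet> c) * f x) \<in> radial_multiples"
| cmult: "f \<in> radial_multiples \<Longrightarrow> (\<lambda>x. of_real a * f x) \<in> radial_multiples"

lemma rot_schwartz:
  assumes "e \<in> schwartz" and even: "\<And>r. e (- r) = e r"
  shows "(rot e :: 'a::euclidean_space \<Rightarrow> complex) \<in> schwartz"
proof (rule schwartz_coinduct)
  show "(rot e :: 'a \<Rightarrow> complex) \<in> radial_multiples" by (intro radial_multiples.rot assms)
  \<comment> \<open>The derivative is only asserted to exist with all its directional values in the
    class, so the induction need not describe it.\<close>
  have der: "\<exists>f'. (\<forall>x. (f has_derivative f' x) (at x)) \<and> (\<forall>h. (\<lambda>x. f' x h) \<in> radial_multiples)"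
    if "f \<in> radial_multiples" for f :: "'a \<Rightarrow> complex"
    using that
  proof induction
    case (rot e)
    then obtain q where q: "q \<in> schwartz" "\<And>r. q (- r) = q r"
      "\<And>r. (e has_vector_derivative of_real r * q r) (at r)"
      using even_schwartz_derivative by metis
    from q(1,2) have "(\<lambda>x. of_real (x \<bullet> h) * rot q x) \<in> radial_multiples" for h :: 'a
      by (intro radial_multiples.mult radial_multiples.rot)
    moreover have "(rot e has_derivative (\<lambda>h. of_real (x \<bullet> h) * rot q x)) (at x)" for x :: 'a
      using rot_has_derivative[OF q(3), of x] by (simp add: inner_commute)
    ultimately show ?case
      by (intro exI[of _ "\<lambda>x h. of_real (x \<bullet> h) * rot q x"]) blast
  next
    case (add f g)
    then obtain f' g' where "\<forall>x. (f has_derivative f' x) (at x)" "\<forall>h. (\<lambda>x. f' x h) \<in> radial_multiples"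
      "\<forall>x. (g has_derivative g' x) (at x)" "\<forall>h. (\<lambda>x. g' x h) \<in> radial_multiples" by blast
    then show ?case
      by (intro exI[of _ "\<lambda>x h. f' x h + g' x h"])
        (auto intro!: derivative_intros radial_multiples.add)
  next
    case (mult f c)
    then obtain f' where "\<forall>x. (f has_derivative f' x) (at x)" "\<forall>h. (\<lambda>x. f' x h) \<in> radial_multiples" by blast
    with mult show ?case
      by (intro exI[of _ "\<lambda>x h. of_real (x \<bullet> c) * f' x h + of_real (h \<bullet> c) * f x"])
        (auto intro!: derivative_eq_intros radial_multiples.intros)
  next
    case (cmult f a)
    then obtain f' where "\<forall>x. (f has_derivative f' x) (at x)" "\<forall>h. (\<lambda>x. f' x h) \<in> radial_multiples" by blast
    then show ?case
      by (intro exI[of _ "\<lambda>x h. of_real a * f' x h"])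
        (auto intro!: derivative_eq_intros radial_multiples.intros)
  qed
  show "f differentiable at x" if "f \<in> radial_multiples" for f :: "'a \<Rightarrow> complex" and x
    using der[OF that] differentiable_def by blast
  show "partial_deriv b f \<in> radial_multiples" if "f \<in> radial_multiples" for f :: "'a \<Rightarrow> complex" and b
    using der[OF that] partial_deriv_eqI[of f] by metis
  show "bounded (range (\<lambda>x. norm x ^ k *\<^sub>R f x))" if "f \<in> radial_multiples" for f :: "'a \<Rightarrow> complex" and k
    using that
  proof (induction arbitrary: k)
    case (rot e)
    show ?case
      using schwartz_bounded[OF rot(1), of k] by (simp add: bounded_iff rot_def) (metis abs_norm_cancel)
  next
    case (add f g)
    then show ?case unfolding scaleR_add_right by (intro bounded_plus_comp)
  next
    case (mult f c)
    then show ?case by (intro bounded_times_coordinate)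
  next
    case (cmult f a)
    have "bounded (range (\<lambda>x. of_real a * (norm x ^ k *\<^sub>R f x)))"
      by (rule bounded_linear_image[OF cmult.IH bounded_linear_mult_right, unfolded image_image])
    then show ?case by simp
  qed
qed

lemma even_part_schwartz:
  assumes "\<psi> \<in> schwartz"
  shows "even_part \<psi> \<in> schwartz"
  using schwartz_lincomb[OF assms schwartz_reflect[OF assms], of "1/2" "1/2"]
  by (simp add: even_part_def[abs_def] add_divide_distrib)

lemma rot_even_part_schwartz: "\<psi> \<in> schwartz \<Longrightarrow> rot (even_part \<psi>) \<in> schwartz"
  by (intro rot_schwartz even_part_schwartz) (auto simp: even_part_def add.commute)

section \<open>The Fourier transform on Schwartz functions\<close>

lemma (in pair_sigma_finite) integrable_pair_bound:
  fixes f :: "'a \<times> 'b \<Rightarrow> 'c::{banach, second_countable_topology}" and g h :: "_ \<Rightarrow> real"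
  assumes f[measurable]: "f \<in> borel_measurable (M1 \<Otimes>\<^sub>M M2)"
    and g: "integrable M1 g" and h: "integrable M2 h"
    and bound: "\<And>x y. norm (f (x, y)) \<le> g x * h y"
  shows "integrable (M1 \<Otimes>\<^sub>M M2) f"
proof (rule Fubini_integrable[OF f])
  have bound': "norm (f (x, y)) \<le> norm (g x * h y)" for x y
    unfolding real_norm_def by (rule order_trans[OF bound abs_ge_self])
  have int: "integrable M2 (\<lambda>y. f (x, y))" if "x \<in> space M1" for x
    by (rule Bochner_Integration.integrable_bound[OF integrable_mult_right[OF h, of "g x"]])
      (use that bound' in auto)
  then show "AE x in M1. integrable M2 (\<lambda>y. f (x, y))"
    by (intro AE_I2)
  show "integrable M1 (\<lambda>x. \<integral>y. norm (f (x, y)) \<partial>M2)"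
  proof (rule Bochner_Integration.integrable_bound[OF integrable_mult_left[OF g, of "integral\<^sup>L M2 h"]])
    show "AE x in M1. norm (\<integral>y. norm (f (x, y)) \<partial>M2) \<le> norm (g x * integral\<^sup>L M2 h)"
    proof (rule AE_I2)
      fix x assume x: "x \<in> space M1"
      have "norm (\<integral>y. norm (f (x, y)) \<partial>M2) = (\<integral>y. norm (f (x, y)) \<partial>M2)"
        by simp
      also have "\<dots> \<le> (\<integral>y. g x * h y \<partial>M2)"
        by (intro integral_mono integrable_norm int[OF x] integrable_mult_right h bound)
      also have "\<dots> \<le> norm (g x * integral\<^sup>L M2 h)" by simp
      finally show "norm (\<integral>y. norm (f (x, y)) \<partial>M2) \<le> norm (g x * integral\<^sup>L M2 h)" .
    qed
  qed measurable
qed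

lemma lborel_integral_affine:
  fixes f :: "'a::euclidean_space \<Rightarrow> 'b::{banach, second_countable_topology}"
  assumes [measurable]: "f \<in> borel_measurable borel" and "c \<noteq> 0"
  shows "integral\<^sup>L lborel f = \<bar>c\<bar> ^ DIM('a) *\<^sub>R (\<integral>x. f (t + c *\<^sub>R x) \<partial>lborel)"
  by (subst lborel_affine[OF assms(2), of t]) (simp add: integral_density integral_distr)

lemma lborel_translation:
  fixes f :: "'a::euclidean_space \<Rightarrow> 'b::{banach, second_countable_topology}"
  assumes [measurable]: "f \<in> borel_measurable borel"
  shows "integrable lborel (\<lambda>x. f (x + t)) \<longleftrightarrow> integrable lborel f"
    and "(\<integral>x. f (x + t) \<partial>lborel) = integral\<^sup>L lborel f"
proof -
  have "integrable lborel f \<longleftrightarrow> integrable (distr lborel borel ((+) t)) f"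
    by (simp add: lborel_distr_plus)
  then show "integrable lborel (\<lambda>x. f (x + t)) \<longleftrightarrow> integrable lborel f"
    by (simp add: integrable_distr_eq add.commute)
  have "integral\<^sup>L lborel f = integral\<^sup>L (distr lborel borel ((+) t)) f"
    by (simp add: lborel_distr_plus)
  then show "(\<integral>x. f (x + t) \<partial>lborel) = integral\<^sup>L lborel f"
    by (simp add: integral_distr add.commute)
qed

lemma cis_measurable [measurable]: "cis \<in> borel_measurable borel"
  by (intro borel_measurable_continuous_onI continuous_intros)

lemma fourier_eq_cis:
  assumes [measurable]: "\<phi> \<in> borel_measurable borel"
  shows "fourier \<phi> v = (\<integral>x. cis (- 2 * pi * (x \<bullet> v)) * \<phi> x \<partial>lborel)"
proof -
  have "exp (- 2 * of_real pi * \<i> * of_real (x \<bullet> v)) = cis (- 2 * pi * (x \<bullet> v))" for x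
    by (simp add: cis_conv_exp mult_ac)
  then show ?thesis
    unfolding fourier_def by (simp add: integral_completion)
qed

lemma schwartz_integrable_cis:
  assumes \<phi>: "\<phi> \<in> schwartz" and [measurable]: "g \<in> borel_measurable borel"
  shows "integrable lborel (\<lambda>x. cis (g x) * \<phi> x)"
  by (rule integrable_poly_growth_schwartz[where C = 1 and k = 0, OF _ _ \<phi>]) simp_all

lemma schwartz_norm_moment_integrable:
  assumes \<phi>: "\<phi> \<in> schwartz"
  shows "integrable lborel (\<lambda>x. norm x ^ k * norm (\<phi> x))"
proof -
  have "integrable lborel (\<lambda>x. of_real (norm x ^ k) * \<phi> x)"
    by (rule integrable_poly_growth_schwartz[where C = 1 and k = k, OF _ _ \<phi>])
      (auto intro!: power_mono simp: norm_power)
  from integrable_norm[OF this] show ?thesis by (simp add: norm_mult norm_power)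
qed

section \<open>Derivatives and decay of the Fourier transform\<close>

text \<open>Instead of differentiating under the integral sign, the kernel is expanded: |exp(i y) -
  1 - i y| \<le> y^2/2 bounds the remainder by |h|^2 times the second moment of \<phi>, up to a
  constant.\<close>

lemma fourier_has_derivative:
  fixes \<phi> :: "'a::euclidean_space \<Rightarrow> complex"
  assumes \<phi>: "\<phi> \<in> schwartz"
  shows "(fourier \<phi> has_derivative (\<lambda>h. fourier (\<lambda>x. (- 2 * pi * \<i>) * (of_real (x \<bullet> h) * \<phi> x)) v)) (at v)"
proof -
  note [measurable] = schwartz_measurable[OF \<phi>]
  let ?D = "\<lambda>h. fourier (\<lambda>x. (- 2 * pi * \<i>) * (of_real (x \<bullet> h) * \<phi> x)) v"
  have \<phi>h: "(\<lambda>x. (- 2 * pi * \<i>) * (of_real (x \<bullet> h) * \<phi> x)) \<in> schwartz" for h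
    by (intro schwartz_cmult schwartz_mult_coordinate \<phi>)
  have D: "?D h = (\<integral>x. cis (- 2 * pi * (x \<bullet> v)) * ((- 2 * pi * \<i>) * (of_real (x \<bullet> h) * \<phi> x)) \<partial>lborel)" for h
    by (rule fourier_eq_cis) simp
  have Dint: "integrable lborel (\<lambda>x. cis (- 2 * pi * (x \<bullet> v)) * ((- 2 * pi * \<i>) * (of_real (x \<bullet> h) * \<phi> x)))" for h
    by (rule schwartz_integrable_cis[OF \<phi>h]) simp
  have lin: "bounded_linear ?D"
  proof (rule bounded_linear_intro)
    show "?D (g + h) = ?D g + ?D h" for g h
      unfolding D Bochner_Integration.integral_add[OF Dint Dint, symmetric]
      by (intro Bochner_Integration.integral_cong) (auto simp: inner_add_right algebra_simps)
    show "?D (r *\<^sub>R h) = r *\<^sub>R ?D h" for r h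
      unfolding D integral_scaleR_right[symmetric]
      by (intro Bochner_Integration.integral_cong) (auto simp: scaleR_conv_of_real mult_ac)
    show "norm (?D h) \<le> norm h * (2 * pi * (\<integral>x. norm x ^ 1 * norm (\<phi> x) \<partial>lborel))" for h
    proof -
      have "norm (?D h) \<le> (\<integral>x. (2 * pi * norm h) * (norm x ^ 1 * norm (\<phi> x)) \<partial>lborel)"
        unfolding D
      proof (rule Bochner_Integration.integral_norm_bound_integral[OF Dint integrable_mult_right[OF schwartz_norm_moment_integrable[OF \<phi>]]])
        fix x
        have "\<bar>x \<bullet> h\<bar> * norm (\<phi> x) \<le> (norm x * norm h) * norm (\<phi> x)"
          by (intro mult_right_mono Cauchy_Schwarz_ineq2) auto
        then show "norm (cis (- 2 * pi * (x \<bullet> v)) * ((- 2 * pi * \<i>) * (of_real (x \<bullet> h) * \<phi> x)))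
          \<le> (2 * pi * norm h) * (norm x ^ 1 * norm (\<phi> x))"
          by (simp add: norm_mult mult_ac)
      qed
      also have "\<dots> = norm h * (2 * pi * (\<integral>x. norm x ^ 1 * norm (\<phi> x) \<partial>lborel))"
        unfolding integral_mult_right_zero by simp
      finally show ?thesis .
    qed
  qed
  \<comment> \<open>With y = -2 pi (x . h) and Cauchy-Schwarz, y^2/2 is at most 2 pi^2 |x|^2
    |h|^2.\<close>
  define K where "K = 2 * pi\<^sup>2 * (\<integral>x. norm x ^ 2 * norm (\<phi> x) \<partial>lborel)"
  have rem: "norm (fourier \<phi> (v + h) - fourier \<phi> v - ?D h) \<le> K * norm h ^ 2" for h
  proof -
    let ?f = "\<lambda>x. cis (- 2 * pi * (x \<bullet> (v + h))) * \<phi> x - cis (- 2 * pi * (x \<bullet> v)) * \<phi> x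
        - cis (- 2 * pi * (x \<bullet> v)) * ((- 2 * pi * \<i>) * (of_real (x \<bullet> h) * \<phi> x))"
    have i: "integrable lborel (\<lambda>x. cis (- 2 * pi * (x \<bullet> w)) * \<phi> x)" for w
      by (rule schwartz_integrable_cis[OF \<phi>]) simp
    have eq: "fourier \<phi> (v + h) - fourier \<phi> v - ?D h = (\<integral>x. ?f x \<partial>lborel)"
      by (simp only: fourier_eq_cis[OF schwartz_measurable[OF \<phi>]] D Bochner_Integration.integral_diff
          Bochner_Integration.integrable_diff i Dint)
    have "norm (fourier \<phi> (v + h) - fourier \<phi> v - ?D h) \<le> (\<integral>x. (2 * pi\<^sup>2 * norm h ^ 2) * (norm x ^ 2 * norm (\<phi> x)) \<partial>lborel)"
      unfolding eq
    proof (intro Bochner_Integration.integral_norm_bound_integral Bochner_Integration.integrable_diff i Dint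
        integrable_mult_right schwartz_norm_moment_integrable \<phi>)
      fix x
      let ?y = "- 2 * pi * (x \<bullet> h)"
      have "?f x = cis (- 2 * pi * (x \<bullet> v)) * (iexp ?y - (1 + \<i> * of_real ?y)) * \<phi> x"
      proof -
        have "cis (- 2 * pi * (x \<bullet> (v + h))) = cis (- 2 * pi * (x \<bullet> v)) * iexp ?y"
          unfolding cis_conv_exp[symmetric] cis_mult by (simp add: inner_add_right algebra_simps)
        then show ?thesis by (simp add: algebra_simps)
      qed
      then have "norm (?f x) = norm (iexp ?y - (1 + \<i> * of_real ?y)) * norm (\<phi> x)"
        by (simp add: norm_mult)
      also have "\<dots> \<le> (?y\<^sup>2 / 2) * norm (\<phi> x)"
        using iexp_approx1[of ?y 1] by (intro mult_right_mono) (simp_all add: numeral_2_eq_2)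
      also have "\<dots> = 2 * pi\<^sup>2 * (x \<bullet> h)\<^sup>2 * norm (\<phi> x)"
        by (simp add: power_mult_distrib)
      also have "\<dots> \<le> 2 * pi\<^sup>2 * (norm x * norm h)\<^sup>2 * norm (\<phi> x)"
        using Cauchy_Schwarz_ineq2[of x h]
        by (intro mult_right_mono mult_left_mono) (auto simp: abs_le_square_iff[symmetric])
      finally show "norm (?f x) \<le> (2 * pi\<^sup>2 * norm h ^ 2) * (norm x ^ 2 * norm (\<phi> x))"
        by (simp add: power_mult_distrib mult_ac)
    qed
    also have "\<dots> = K * norm h ^ 2"
      unfolding integral_mult_right_zero K_def by simp
    finally show ?thesis .
  qed
  have "((\<lambda>h. norm (fourier \<phi> (v + h) - fourier \<phi> v - ?D h) / norm h) \<longlongrightarrow> 0) (at 0)"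
  proof (rule real_tendsto_sandwich[where f = "\<lambda>_. 0" and h = "\<lambda>h. K * norm h"])
    show "\<forall>\<^sub>F h in at 0. norm (fourier \<phi> (v + h) - fourier \<phi> v - ?D h) / norm h \<le> K * norm h"
      using rem by (auto simp: eventually_at_filter divide_le_eq power2_eq_square mult_ac)
    show "((\<lambda>h. K * norm h) \<longlongrightarrow> 0) (at (0::'a))"
      by (intro tendsto_mult_right_zero tendsto_norm_zero tendsto_ident_at)
  qed auto
  with lin show ?thesis
    by (simp add: has_derivative_at)
qed

text \<open>The increment g(x + b) - g(x) integrates to 0 by translation invariance. It is also the
  integral of the derivative along the segment from x to x + b, and after exchanging the integrals
  every point of the segment contributes the same amount.\<close>

lemma integral_partial_deriv_eq_0:
  fixes g :: "'a::euclidean_space \<Rightarrow> complex"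
  assumes g: "g \<in> schwartz" and b: "b \<in> Basis"
  shows "(\<integral>x. partial_deriv b g x \<partial>lborel) = 0"
proof -
  let ?D = "partial_deriv b g"
  have D: "?D \<in> schwartz" by (rule schwartz_partial_deriv[OF g b])
  note [measurable] = schwartz_measurable[OF g] schwartz_measurable[OF D]
  have ftc: "(\<integral>t. indicator {0..1::real} t *\<^sub>R ?D (x + t *\<^sub>R b) \<partial>lborel) = g (x + b) - g x" for x
  proof -
    have "((\<lambda>t. g (x + t *\<^sub>R b)) has_vector_derivative ?D (x + t *\<^sub>R b)) (at t within {0..1})" for t
    proof -
      have "((\<lambda>t. g (x + t *\<^sub>R b)) has_derivative
          (\<lambda>s. \<Sum>c\<in>Basis. ((s *\<^sub>R b) \<bullet> c) *\<^sub>R partial_deriv c g (x + t *\<^sub>R b))) (at t within {0..1})"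
        by (rule has_derivative_compose[OF _ schwartz_has_derivative[OF g]])
          (auto intro!: derivative_eq_intros)
      also have "(\<lambda>s. \<Sum>c\<in>Basis. ((s *\<^sub>R b) \<bullet> c) *\<^sub>R partial_deriv c g (x + t *\<^sub>R b)) = (\<lambda>s. s *\<^sub>R ?D (x + t *\<^sub>R b))"
        unfolding inner_scaleR_left scaleR_scaleR[symmetric] scaleR_sum_right[symmetric]
          partial_deriv_sum_Basis[OF b] ..
      finally show ?thesis by (simp add: has_vector_derivative_def)
    qed
    moreover have "continuous_on {0..1} (\<lambda>t. ?D (x + t *\<^sub>R b))"
      by (rule continuous_on_compose2[OF schwartz_continuous_on[OF D, of UNIV]])
        (auto intro!: continuous_intros)
    ultimately show ?thesis
      by (subst integral_FTC_Icc[where F = "\<lambda>t. g (x + t *\<^sub>R b)"]) auto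
  qed
  have int: "integrable lborel (\<lambda>x. ?D (x + t))" for t
    by (simp add: lborel_translation schwartz_integrable[OF D])
  have "integrable (lborel \<Otimes>\<^sub>M lborel) (\<lambda>(t, x). indicator {0..1::real} t *\<^sub>R ?D (x + t *\<^sub>R b))"
  proof (rule lborel_pair.Fubini_integrable)
    have "(\<integral>x. norm (indicator {0..1::real} t *\<^sub>R ?D (x + t *\<^sub>R b)) \<partial>lborel)
        = (\<integral>x. norm (?D x) \<partial>lborel) * indicator {0..1} t" for t
      using lborel_translation(2)[of "\<lambda>x. norm (?D x)" "t *\<^sub>R b"]
      by (simp split: split_indicator)
    then show "integrable lborel (\<lambda>t. \<integral>x. norm ((\<lambda>(t, x). indicator {0..1::real} t *\<^sub>R ?D (x + t *\<^sub>R b)) (t, x)) \<partial>lborel)"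
      unfolding prod.case by (simp del: norm_scaleR)
  qed (auto intro!: integrable_scaleR_right int)
  from lborel_pair.Fubini_integral[OF this]
  have "(\<integral>x. (g (x + b) - g x) \<partial>lborel) = (\<integral>t. (\<integral>x. indicator {0..1::real} t *\<^sub>R ?D (x + t *\<^sub>R b) \<partial>lborel) \<partial>lborel)"
    by (simp add: ftc)
  also have "\<dots> = (\<integral>t. indicator {0..1::real} t *\<^sub>R (\<integral>x. ?D x \<partial>lborel) \<partial>lborel)"
    by (simp add: lborel_translation)
  also have "\<dots> = (\<integral>x. ?D x \<partial>lborel)"
    by simp
  also have "(\<integral>x. (g (x + b) - g x) \<partial>lborel) = 0"
    by (simp add: lborel_translation schwartz_integrable[OF g])
  finally show ?thesis by simp
qed

text \<open>The integral of the derivative of \<open>cis (x \<bullet> w) * \<phi> x\<close>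
  vanishes; with w equal to -2 pi v, its two terms are the two sides.\<close>

lemma fourier_partial_deriv:
  fixes \<phi> :: "'a::euclidean_space \<Rightarrow> complex"
  assumes \<phi>: "\<phi> \<in> schwartz" and b: "b \<in> Basis"
  shows "fourier (partial_deriv b \<phi>) v = 2 * pi * \<i> * of_real (v \<bullet> b) * fourier \<phi> v"
proof -
  have D: "partial_deriv b \<phi> \<in> schwartz" by (rule schwartz_partial_deriv[OF \<phi> b])
  note [measurable] = schwartz_measurable[OF \<phi>] schwartz_measurable[OF D]
  let ?w = "- (2 * pi) *\<^sub>R v"
  have i: "integrable lborel (\<lambda>x. cis (x \<bullet> ?w) * \<psi> x)" if "\<psi> \<in> schwartz" for \<psi>
    by (rule schwartz_integrable_cis[OF that]) simp
  have "0 = (\<integral>x. cis (x \<bullet> ?w) * (1 * partial_deriv b \<phi> x + \<i> * of_real (b \<bullet> ?w) * \<phi> x) \<partial>lborel)"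
    using integral_partial_deriv_eq_0[OF schwartz_modulation(1)[OF \<phi>, of ?w] b]
    unfolding schwartz_modulation(2)[OF \<phi> b] by simp
  also have "\<dots> = (\<integral>x. cis (x \<bullet> ?w) * partial_deriv b \<phi> x + (\<i> * of_real (b \<bullet> ?w)) * (cis (x \<bullet> ?w) * \<phi> x) \<partial>lborel)"
    by (simp add: algebra_simps)
  also have "\<dots> = fourier (partial_deriv b \<phi>) v + (\<i> * of_real (b \<bullet> ?w)) * fourier \<phi> v"
    by (subst Bochner_Integration.integral_add[OF i[OF D] integrable_mult_right[OF i[OF \<phi>]]])
      (simp add: fourier_eq_cis)
  finally show ?thesis by (simp add: inner_commute algebra_simps)
qed

lemma fourier_bounded:
  assumes \<phi>: "\<phi> \<in> schwartz"
  shows "norm (fourier \<phi> v) \<le> (\<integral>x. norm (\<phi> x) \<partial>lborel)"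
proof -
  note [measurable] = schwartz_measurable[OF \<phi>]
  show ?thesis
    unfolding fourier_eq_cis[OF schwartz_measurable[OF \<phi>]]
    by (rule order_trans[OF integral_norm_bound]) (simp add: norm_mult)
qed

text \<open>The image of the Schwartz space is closed under partial derivatives, so only decay is
  left. One power of |v| is at most the sum of the |v . b|, and by
  \<open>fourier_partial_deriv\<close> each of these is paid for by a derivative of \<phi>.\<close>

lemma fourier_schwartz:
  fixes \<phi> :: "'a::euclidean_space \<Rightarrow> complex"
  assumes "\<phi> \<in> schwartz"
  shows "fourier \<phi> \<in> schwartz"
proof (rule schwartz_coinduct[where X = "fourier ` schwartz"])
  fix f :: "'a \<Rightarrow> complex" and x assume "f \<in> fourier ` schwartz"
  then show "f differentiable at x"
    using fourier_has_derivative differentiable_def by blast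
next
  fix f :: "'a \<Rightarrow> complex" and b :: 'a assume "f \<in> fourier ` schwartz"
  then obtain \<phi> where \<phi>: "\<phi> \<in> schwartz" "f = fourier \<phi>" by blast
  have "partial_deriv b f = fourier (\<lambda>x. (- 2 * pi * \<i>) * (of_real (x \<bullet> b) * \<phi> x))"
    unfolding \<phi> by (rule partial_deriv_eqI[OF fourier_has_derivative[OF \<phi>(1)]])
  then show "partial_deriv b f \<in> fourier ` schwartz"
    using \<phi>(1) schwartz_cmult schwartz_mult_coordinate by blast
next
  have *: "\<exists>B. \<forall>v. norm v ^ k * norm (fourier \<phi> v) \<le> B" if "\<phi> \<in> schwartz" for k and \<phi> :: "'a \<Rightarrow> complex"
    using that
  proof (induction k arbitrary: \<phi>)
    case 0
    then show ?case using fourier_bounded by auto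
  next
    case (Suc k)
    have "\<exists>B. \<forall>v. norm v ^ k * norm (fourier (partial_deriv b \<phi>) v) \<le> B" if "b \<in> Basis" for b
      using Suc.IH schwartz_partial_deriv[OF Suc.prems that] by blast
    then obtain B where B: "\<And>b v. b \<in> Basis \<Longrightarrow> norm v ^ k * norm (fourier (partial_deriv b \<phi>) v) \<le> B b"
      by metis
    have "norm v ^ Suc k * norm (fourier \<phi> v) \<le> (\<Sum>b\<in>Basis. B b)" for v
    proof -
      have "norm v ^ Suc k * norm (fourier \<phi> v) \<le> (norm v ^ k * norm (fourier \<phi> v)) * (\<Sum>b\<in>Basis. \<bar>v \<bullet> b\<bar>)"
        using mult_left_mono[OF norm_le_l1[of v], of "norm v ^ k * norm (fourier \<phi> v)"] by (simp add: mult_ac)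
      also have "\<dots> = (\<Sum>b\<in>Basis. norm v ^ k * (\<bar>v \<bullet> b\<bar> * norm (fourier \<phi> v)))"
        by (simp add: sum_distrib_left mult_ac)
      also have "\<dots> \<le> (\<Sum>b\<in>Basis. B b)"
      proof (rule sum_mono)
        fix b :: 'a assume b: "b \<in> Basis"
        have "\<bar>v \<bullet> b\<bar> * norm (fourier \<phi> v) \<le> (2 * pi) * (\<bar>v \<bullet> b\<bar> * norm (fourier \<phi> v))"
          using mult_right_mono[of 1 "2 * pi" "\<bar>v \<bullet> b\<bar> * norm (fourier \<phi> v)"] pi_ge_two by simp
        also have "\<dots> = norm (fourier (partial_deriv b \<phi>) v)"
          unfolding fourier_partial_deriv[OF Suc.prems b] by (simp add: norm_mult)
        finally show "norm v ^ k * (\<bar>v \<bullet> b\<bar> * norm (fourier \<phi> v)) \<le> B b"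
          using B[OF b, of v] mult_left_mono[of _ _ "norm v ^ k"] by (meson norm_ge_zero order_trans zero_le_power)
      qed
      finally show ?thesis .
    qed
    then show ?case by blast
  qed
  fix f :: "'a \<Rightarrow> complex" and k assume "f \<in> fourier ` schwartz"
  then show "bounded (range (\<lambda>x. norm x ^ k *\<^sub>R f x))"
    using *[of _ k] by (auto simp: bounded_iff)
qed (use assms in blast)

section \<open>Gaussians and Fourier inversion\<close>

text \<open>The product form makes integrals factor into those of the one-dimensional normal
  density, whose characteristic function is known; \<open>gauss_eq\<close> is the radial
  form.\<close>

definition gauss :: "'a::euclidean_space \<Rightarrow> real" where
  "gauss x = (\<Prod>b\<in>Basis. std_normal_density (x \<bullet> b))"

lemma gauss_eq: "gauss (x :: 'a::euclidean_space) = (1 / sqrt (2 * pi)) ^ DIM('a) * exp (- (norm x)\<^sup>2 / 2)"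
proof -
  have "(norm x)\<^sup>2 = (\<Sum>b\<in>Basis. (x \<bullet> b)\<^sup>2)"
    unfolding power2_norm_eq_inner by (subst euclidean_inner) (simp add: power2_eq_square)
  then show ?thesis
    by (simp add: gauss_def std_normal_density_def prod.distrib exp_sum[symmetric] sum_divide_distrib sum_negf
        del: times_divide_eq_left mult_1)
qed

lemma gauss_measurable [measurable]: "gauss \<in> borel_measurable borel"
  unfolding gauss_eq[abs_def] by measurable

lemma gauss_minus: "gauss (- x) = gauss x"
  by (simp add: gauss_eq)

lemma gauss_pos: "gauss x > 0"
  by (simp add: gauss_eq)

lemma gauss_nonneg: "gauss x \<ge> 0"
  by (simp add: gauss_eq)

text \<open>Follows from 1 + t \<le> exp t and k t \<le> ((k \<epsilon>)^2 + (t/\<epsilon>)^2)/2 for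
  t = |x|: the second term is cancelled by the Gaussian exponent.\<close>

lemma gauss_decay:
  fixes \<epsilon> :: real
  assumes "\<epsilon> > 0"
  obtains C where "\<And>x::'a::euclidean_space. (1 + norm x) ^ k * gauss (x /\<^sub>R \<epsilon>) \<le> C"
proof -
  let ?c = "(1 / sqrt (2 * pi)) ^ DIM('a)"
  have "(1 + norm x) ^ k * gauss (x /\<^sub>R \<epsilon>) \<le> exp ((k * \<epsilon>)\<^sup>2 / 2) * ?c" for x :: 'a
  proof -
    let ?e = "exp ((norm x / \<epsilon>)\<^sup>2 / 2)"
    have "(1 + norm x) ^ k \<le> exp (norm x) ^ k"
      by (intro power_mono exp_ge_add_one_self) simp
    also have "\<dots> = exp (k * norm x)" by (simp add: exp_of_nat_mult)
    also have "k * norm x \<le> (k * \<epsilon>)\<^sup>2 / 2 + (norm x / \<epsilon>)\<^sup>2 / 2"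
      using assms sum_squares_bound[of "k * \<epsilon>" "norm x / \<epsilon>"] by simp
    then have "exp (k * norm x) \<le> exp ((k * \<epsilon>)\<^sup>2 / 2) * ?e"
      by (simp add: exp_add[symmetric])
    finally have "(1 + norm x) ^ k * (?c * inverse ?e) \<le> exp ((k * \<epsilon>)\<^sup>2 / 2) * ?e * (?c * inverse ?e)"
      by (rule mult_right_mono) simp
    moreover have "norm (x /\<^sub>R \<epsilon>) = norm x / \<epsilon>"
      using assms by (simp add: divide_inverse_commute)
    then have "gauss (x /\<^sub>R \<epsilon>) = ?c * inverse ?e"
      by (simp only: gauss_eq exp_minus[symmetric] minus_divide_left)
    ultimately show ?thesis by simp
  qed
  then show thesis using that by blast
qed

lemma gauss_moment_integrable: "integrable lborel (\<lambda>x::'a::euclidean_space. (1 + norm x) ^ k * gauss x)"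
proof -
  obtain C where C: "\<And>x::'a. (1 + norm x) ^ (2 * DIM('a) + k) * gauss (x /\<^sub>R 1) \<le> C"
    using gauss_decay[of 1] by (metis zero_less_one)
  show ?thesis
  proof (rule integrable_lborel_decay)
    show "(1 + norm x) ^ (2 * DIM('a)) * norm ((1 + norm x) ^ k * gauss x) \<le> C" for x :: 'a
      using C[of x] gauss_pos[of x] by (simp add: norm_mult power_add mult_ac abs_mult)
  qed measurable
qed

lemma gauss_integrable: "integrable lborel (gauss :: 'a::euclidean_space \<Rightarrow> real)"
  using gauss_moment_integrable[of 0] by simp

lemma gauss_fourier:
  "(\<integral>x. cis (x \<bullet> v) * of_real (gauss x) \<partial>lborel) =
    of_real (exp (- (norm (v :: 'a::euclidean_space))\<^sup>2 / 2))"
proof -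
  have 1: "(\<integral>t. cis (s * t) * of_real (std_normal_density t) \<partial>lborel) = of_real (exp (- s\<^sup>2 / 2))" for s
    using fun_cong[OF char_std_normal_distribution, of s]
    by (simp add: char_def integral_density cis_conv_exp scaleR_conv_of_real mult.commute mult.left_commute)
  have i: "integrable lborel (\<lambda>t. cis (s * t) * of_real (std_normal_density t))" for s
    by (rule Bochner_Integration.integrable_bound[of lborel std_normal_density])
      (auto simp: norm_mult)
  have eq: "cis (x \<bullet> v) * of_real (gauss x) =
      (\<Prod>b\<in>Basis. cis ((v \<bullet> b) * (x \<bullet> b)) * of_real (std_normal_density (x \<bullet> b)))" for x :: 'a
  proof -
    have "cis (\<Sum>b\<in>A. f b) = (\<Prod>b\<in>A. cis (f b))" for A and f :: "'a \<Rightarrow> real"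
      by (induction A rule: infinite_finite_induct) (auto simp flip: cis_mult)
    then show ?thesis
      by (simp add: gauss_def prod.distrib euclidean_inner[of x v] mult.commute)
  qed
  have "(\<integral>x. cis (x \<bullet> v) * of_real (gauss x) \<partial>lborel) = (\<Prod>b\<in>Basis. of_real (exp (- (v \<bullet> b)\<^sup>2 / 2)))"
    unfolding eq by (subst lborel_prod_Basis(2)) (auto intro: i simp: 1)
  also have "\<dots> = of_real (exp (- (norm v)\<^sup>2 / 2))"
    unfolding power2_norm_eq_inner euclidean_inner[of v v]
    by (simp add: power2_eq_square exp_sum[symmetric] sum_divide_distrib sum_negf flip: of_real_prod)
  finally show ?thesis .
qed

lemma gauss_integral: "(\<integral>x. gauss (x :: 'a::euclidean_space) \<partial>lborel) = 1"
  using gauss_fourier[of "0 :: 'a"] by (simp flip: of_real_eq_iff)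

text \<open>The Gaussian is its own characteristic function up to normalization. Read in this
  direction, it replaces a Gaussian weight by an average of characters.\<close>

lemma gauss_fourier':
  "of_real (gauss v) = of_real ((1 / sqrt (2 * pi)) ^ DIM('a)) *
    (\<integral>x. cis (x \<bullet> v) * of_real (gauss x) \<partial>lborel)" for v :: "'a::euclidean_space"
  unfolding gauss_fourier by (simp add: gauss_eq)

text \<open>The double integral behind the formula does not converge absolutely. A Gaussian cutoff
  in y makes Fubini applicable and turns the left side into an average of \<phi> against a Gaussian
  of width \<epsilon> around v; both sides converge as \<epsilon> tends to 0.\<close>

lemma fourier_inversion:
  fixes \<phi> :: "'a::euclidean_space \<Rightarrow> complex"
  assumes \<phi>: "\<phi> \<in> schwartz"
  shows "(\<integral>y. cis (2 * pi * (y \<bullet> v)) * fourier \<phi> y \<partial>lborel) = \<phi> v"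
proof -
  have F: "fourier \<phi> \<in> schwartz" by (rule fourier_schwartz[OF \<phi>])
  note [measurable] = schwartz_measurable[OF \<phi>] schwartz_measurable[OF F]
  define E where "E x = exp (- (norm x)\<^sup>2 / 2)" for x :: 'a
  have [measurable]: "E \<in> borel_measurable borel" unfolding E_def[abs_def] by measurable
  define c where "c = (1 / sqrt (2 * pi)) ^ DIM('a)"
  have "c ^ 2 = ((1 / sqrt (2 * pi)) ^ 2) ^ DIM('a)"
    unfolding c_def by (simp only: power_mult[symmetric] mult.commute)
  moreover have "(1 / sqrt (2 * pi)) ^ 2 = inverse (2 * pi)"
    by (simp add: power_divide inverse_eq_divide)
  ultimately have c: "c ^ 2 = inverse ((2 * pi) ^ DIM('a))" "c > 0"
    by (simp_all only: power_inverse) (simp add: c_def)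
  have gauss: "gauss x = c * E x" for x :: 'a by (simp add: gauss_eq c_def E_def)
  have E: "E x = gauss x / c" for x using c by (simp add: gauss)
  \<comment> \<open>As \<open>E\<close> is the Gaussian divided by c, its transform is E/c, which is
    the Gaussian divided by c^2, and 1/c^2 = (2 pi)^d.\<close>
  have Efourier: "(\<integral>z. cis (z \<bullet> u) * of_real (E z) \<partial>lborel) = of_real ((2 * pi) ^ DIM('a) * gauss u)" for u
  proof -
    have "(\<integral>z. cis (z \<bullet> u) * of_real (E z) \<partial>lborel) = (\<integral>z. cis (z \<bullet> u) * of_real (gauss z) / of_real c \<partial>lborel)"
      by (simp add: E)
    also have "\<dots> = of_real (E u / c)"
      unfolding integral_divide_zero gauss_fourier by (simp add: E_def)
    also have "E u / c = gauss u / c ^ 2" using c(2) by (simp add: gauss power2_eq_square)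
    finally show ?thesis by (simp add: c(1) divide_inverse)
  qed
  \<comment> \<open>The scale 2 pi \<epsilon> of the cutoff is chosen so that its transform is the
    Gaussian of width \<epsilon>.\<close>
  have main: "(\<integral>y. cis (2 * pi * (y \<bullet> v)) * fourier \<phi> y * of_real (E ((2 * pi * \<epsilon>) *\<^sub>R y)) \<partial>lborel) =
    (\<integral>w. \<phi> (v + \<epsilon> *\<^sub>R w) * of_real (gauss w) \<partial>lborel)" if \<epsilon>: "\<epsilon> > 0" for \<epsilon>
  proof -
    let ?E = "\<lambda>y. E ((2 * pi * \<epsilon>) *\<^sub>R y)"
    have Eint: "integrable lborel ?E"
    proof -
      have "integrable lborel E" unfolding E by (intro integrable_divide gauss_integrable)
      then have "integrable (density (distr lborel borel (\<lambda>x. 0 + (2 * pi * \<epsilon>) *\<^sub>R x)) (\<lambda>_. \<bar>2 * pi * \<epsilon>\<bar> ^ DIM('a))) E"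
        using lborel_affine[of "2 * pi * \<epsilon>" "0 :: 'a"] \<epsilon> by simp
      then show ?thesis
        using \<epsilon> by (simp add: integrable_density integrable_distr_eq)
    qed
    have inner: "(\<integral>y. cis (2 * pi * (y \<bullet> (v - x))) * of_real (?E y) \<partial>lborel) =
        of_real (inverse (\<epsilon> ^ DIM('a)) * gauss ((v - x) /\<^sub>R \<epsilon>))" for x
    proof -
      have "of_real ((2 * pi) ^ DIM('a) * gauss ((v - x) /\<^sub>R \<epsilon>)) =
          (\<integral>z. cis (z \<bullet> ((v - x) /\<^sub>R \<epsilon>)) * of_real (E z) \<partial>lborel)"
        by (rule Efourier[symmetric])
      also have "\<dots> = \<bar>2 * pi * \<epsilon>\<bar> ^ DIM('a) *\<^sub>R
          (\<integral>y. cis ((0 + (2 * pi * \<epsilon>) *\<^sub>R y) \<bullet> ((v - x) /\<^sub>R \<epsilon>)) * of_real (E (0 + (2 * pi * \<epsilon>) *\<^sub>R y)) \<partial>lborel)"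
        by (rule lborel_integral_affine) (use \<epsilon> in auto)
      also have "\<dots> = of_real ((2 * pi) ^ DIM('a) * \<epsilon> ^ DIM('a)) * (\<integral>y. cis (2 * pi * (y \<bullet> (v - x))) * of_real (?E y) \<partial>lborel)"
      proof -
        have arg: "((2 * pi * \<epsilon>) *\<^sub>R y) \<bullet> ((v - x) /\<^sub>R \<epsilon>) = 2 * pi * (y \<bullet> (v - x))" for y
          using \<epsilon> by (simp add: mult.left_commute[of "inverse \<epsilon>"])
        show ?thesis
          unfolding arg add_0 using \<epsilon> by (simp add: scaleR_conv_of_real power_mult_distrib)
      qed
      finally show ?thesis
        using \<epsilon> by (simp add: field_simps)
    qed
    have "(\<integral>y. cis (2 * pi * (y \<bullet> v)) * fourier \<phi> y * of_real (?E y) \<partial>lborel) =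
      (\<integral>y. (\<integral>x. \<phi> x * (cis (2 * pi * (y \<bullet> (v - x))) * of_real (?E y)) \<partial>lborel) \<partial>lborel)"
    proof (rule Bochner_Integration.integral_cong[OF refl])
      fix y
      have "cis (2 * pi * (y \<bullet> v)) * fourier \<phi> y * of_real (?E y) =
          (\<integral>x. (cis (2 * pi * (y \<bullet> v)) * of_real (?E y)) * (cis (- 2 * pi * (x \<bullet> y)) * \<phi> x) \<partial>lborel)"
        unfolding integral_mult_right_zero by (simp add: fourier_eq_cis mult_ac)
      also have "\<dots> = (\<integral>x. \<phi> x * (cis (2 * pi * (y \<bullet> (v - x))) * of_real (?E y)) \<partial>lborel)"
      proof (rule Bochner_Integration.integral_cong[OF refl])
        fix x
        have "cis (2 * pi * (y \<bullet> (v - x))) = cis (2 * pi * (y \<bullet> v)) * cis (- 2 * pi * (x \<bullet> y))"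
          by (simp add: cis_mult inner_diff_right inner_commute[of y x] algebra_simps)
        then show "(cis (2 * pi * (y \<bullet> v)) * of_real (?E y)) * (cis (- 2 * pi * (x \<bullet> y)) * \<phi> x) =
            \<phi> x * (cis (2 * pi * (y \<bullet> (v - x))) * of_real (?E y))"
          by (simp add: mult_ac)
      qed
      finally show "cis (2 * pi * (y \<bullet> v)) * fourier \<phi> y * of_real (?E y) = \<dots>" .
    qed
    also have "\<dots> = (\<integral>x. (\<integral>y. \<phi> x * (cis (2 * pi * (y \<bullet> (v - x))) * of_real (?E y)) \<partial>lborel) \<partial>lborel)"
      by (rule lborel_pair.Fubini_integral,
          rule lborel_pair.integrable_pair_bound[where g = "\<lambda>x. norm (\<phi> x)" and h = ?E])
        (use Eint schwartz_integrable[OF \<phi>] in \<open>auto simp: norm_mult E_def\<close>)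
    also have "\<dots> = (\<integral>x. \<phi> x * of_real (inverse (\<epsilon> ^ DIM('a)) * gauss ((v - x) /\<^sub>R \<epsilon>)) \<partial>lborel)"
      by (simp add: inner)
    also have "\<dots> = \<bar>\<epsilon>\<bar> ^ DIM('a) *\<^sub>R (\<integral>w. \<phi> (v + \<epsilon> *\<^sub>R w) * of_real (inverse (\<epsilon> ^ DIM('a)) * gauss ((v - (v + \<epsilon> *\<^sub>R w)) /\<^sub>R \<epsilon>)) \<partial>lborel)"
      by (rule lborel_integral_affine) (use \<epsilon> in auto)
    also have "\<dots> = (\<integral>w. \<phi> (v + \<epsilon> *\<^sub>R w) * of_real (gauss w) \<partial>lborel)"
      unfolding integral_scaleR_right[symmetric]
      using \<epsilon> by (intro Bochner_Integration.integral_cong) (auto simp: gauss_minus scaleR_conv_of_real field_simps)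
    finally show ?thesis .
  qed
  define \<epsilon> where "\<epsilon> n = inverse (real (Suc n))" for n
  have \<epsilon>: "\<epsilon> n > 0" for n by (simp add: \<epsilon>_def)
  have \<epsilon>0: "\<epsilon> \<longlonglongrightarrow> 0" unfolding \<epsilon>_def[abs_def] by (rule LIMSEQ_inverse_real_of_nat)
  have "(\<lambda>n. \<integral>y. cis (2 * pi * (y \<bullet> v)) * fourier \<phi> y * of_real (E ((2 * pi * \<epsilon> n) *\<^sub>R y)) \<partial>lborel)
      \<longlonglongrightarrow> (\<integral>y. cis (2 * pi * (y \<bullet> v)) * fourier \<phi> y \<partial>lborel)"
  proof (rule integral_dominated_convergence[where w = "\<lambda>y. norm (fourier \<phi> y)"])
    show "AE y in lborel. (\<lambda>n. cis (2 * pi * (y \<bullet> v)) * fourier \<phi> y * of_real (E ((2 * pi * \<epsilon> n) *\<^sub>R y)))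
        \<longlonglongrightarrow> cis (2 * pi * (y \<bullet> v)) * fourier \<phi> y"
    proof (rule AE_I2)
      fix y :: 'a
      have "(\<lambda>n. cis (2 * pi * (y \<bullet> v)) * fourier \<phi> y * of_real (E ((2 * pi * \<epsilon> n) *\<^sub>R y)))
        \<longlonglongrightarrow> cis (2 * pi * (y \<bullet> v)) * fourier \<phi> y * of_real (exp (- (norm ((2 * pi * 0) *\<^sub>R y))\<^sup>2 / 2))"
        unfolding E_def by (intro tendsto_intros \<epsilon>0) simp_all
      then show "(\<lambda>n. cis (2 * pi * (y \<bullet> v)) * fourier \<phi> y * of_real (E ((2 * pi * \<epsilon> n) *\<^sub>R y)))
        \<longlonglongrightarrow> cis (2 * pi * (y \<bullet> v)) * fourier \<phi> y" by simp
    qed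
    show "integrable lborel (\<lambda>y. norm (fourier \<phi> y))"
      by (intro integrable_norm schwartz_integrable F)
  qed (auto simp: norm_mult E_def intro!: mult_left_le)
  moreover have "(\<lambda>n. \<integral>w. \<phi> (v + \<epsilon> n *\<^sub>R w) * of_real (gauss w) \<partial>lborel) \<longlonglongrightarrow> (\<integral>w. \<phi> v * of_real (gauss (w :: 'a)) \<partial>lborel)"
  proof -
    obtain B where B: "\<And>x. norm (\<phi> x) \<le> B"
      using schwartz_decay[OF \<phi>, of 0] by auto
    show ?thesis
    proof (rule integral_dominated_convergence[where w = "\<lambda>w::'a. B * gauss w"])
      show "AE w in lborel. (\<lambda>n. \<phi> (v + \<epsilon> n *\<^sub>R w) * of_real (gauss w)) \<longlonglongrightarrow> \<phi> v * of_real (gauss w)"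
      proof (rule AE_I2)
        fix w :: 'a
        have "(\<lambda>n. v + \<epsilon> n *\<^sub>R w) \<longlonglongrightarrow> v + 0 *\<^sub>R w" by (intro tendsto_intros \<epsilon>0)
        then have "(\<lambda>n. \<phi> (v + \<epsilon> n *\<^sub>R w)) \<longlonglongrightarrow> \<phi> v"
          using schwartz_continuous_on[OF \<phi>, of UNIV]
          by (intro isCont_tendsto_compose[of v \<phi>]) (auto simp: continuous_on_eq_continuous_at)
        then show "(\<lambda>n. \<phi> (v + \<epsilon> n *\<^sub>R w) * of_real (gauss w)) \<longlonglongrightarrow> \<phi> v * of_real (gauss w)"
          by (intro tendsto_intros)
      qed
      show "integrable lborel (\<lambda>w::'a. B * gauss w)" by (intro integrable_mult_right gauss_integrable)
    qed (use B in \<open>auto simp: norm_mult gauss_nonneg intro!: mult_right_mono\<close>)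
  qed
  then have "(\<lambda>n. \<integral>y. cis (2 * pi * (y \<bullet> v)) * fourier \<phi> y * of_real (E ((2 * pi * \<epsilon> n) *\<^sub>R y)) \<partial>lborel) \<longlonglongrightarrow> \<phi> v"
    by (simp add: main[OF \<epsilon>] gauss_integral)
  ultimately show ?thesis by (rule LIMSEQ_unique)
qed

section \<open>Surjectivity on test functions, injectivity on distributions\<close>

text \<open>The preimage is the transform of the reflected \<psi>: transforming once more evaluates
  the inversion formula at -v, which undoes the reflection.\<close>

lemma fourier_surj_schwartz:
  fixes \<psi> :: "'a::euclidean_space \<Rightarrow> complex"
  assumes \<psi>: "\<psi> \<in> schwartz"
  obtains g where "g \<in> schwartz" "fourier g = \<psi>"
proof
  let ?\<rho> = "\<lambda>x. \<psi> (- x)"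
  have \<rho>: "?\<rho> \<in> schwartz" by (rule schwartz_reflect[OF \<psi>])
  show F: "fourier ?\<rho> \<in> schwartz" by (rule fourier_schwartz[OF \<rho>])
  show "fourier (fourier ?\<rho>) = \<psi>"
  proof
    fix v
    show "fourier (fourier ?\<rho>) v = \<psi> v"
      using fourier_inversion[OF \<rho>, of "- v"]
      by (simp add: fourier_eq_cis schwartz_measurable[OF F])
  qed
qed

text \<open>Dual to surjectivity on test functions; outside \<open>schwartz\<close> the functionals
  agree by extensionality.\<close>

lemma inj_on_fourier_dist: "inj_on fourier_dist (tempered :: (('a::euclidean_space \<Rightarrow> complex) \<Rightarrow> complex) set)"
proof (rule inj_onI)
  fix S T :: "('a \<Rightarrow> complex) \<Rightarrow> complex"
  assume S: "S \<in> tempered" and T: "T \<in> tempered" and eq: "fourier_dist S = fourier_dist T"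
  show "S = T"
  proof (rule extensionalityI[of _ schwartz])
    fix \<psi> :: "'a \<Rightarrow> complex" assume "\<psi> \<in> schwartz"
    then obtain g where "g \<in> schwartz" "fourier g = \<psi>"
      using fourier_surj_schwartz by metis
    then show "S \<psi> = T \<psi>"
      using fun_cong[OF eq, of g] by (simp add: fourier_dist_def)
  qed (use S T in \<open>auto simp: tempered_def\<close>)
qed

section \<open>Integrating functions of one coordinate\<close>

text \<open>
  The limit depends on \<open>\<theta>\<close> only through the Fourier transform of its marginal in direction \<open>b\<close>.
\<close>

lemma ridge_integral_limit:
  fixes f :: "real \<Rightarrow> complex" and \<theta> :: "'a::euclidean_space \<Rightarrow> complex"
  assumes cont: "continuous_on UNIV f" and f: "\<And>t. norm (f t) \<le> C * (1 + \<bar>t\<bar>) ^ k"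
    and \<theta>: "\<theta> \<in> schwartz" and b: "norm b = 1"
    and c: "\<And>s. (\<integral>x. cis (2 * pi * (s * (x \<bullet> b))) * \<theta> x \<partial>lborel) = c s"
  shows "(\<lambda>n. \<integral>u. f u * (\<integral>s. of_real (gauss s) * (cis (s * u * real (Suc n)) *
      c (- s * real (Suc n) / (2 * pi))) \<partial>lborel) * of_real (real (Suc n) / sqrt (2 * pi)) \<partial>lborel)
    \<longlonglongrightarrow> (\<integral>x. f (x \<bullet> b) * \<theta> x \<partial>lborel)"
proof -
  note [measurable] = schwartz_measurable[OF \<theta>]
  have [measurable]: "f \<in> borel_measurable borel"
    using cont by (rule borel_measurable_continuous_onI)
  have C: "C \<ge> 0" using f[of 0] by (simp add: order_trans[OF norm_ge_zero])
  have xb: "1 + \<bar>x \<bullet> b\<bar> \<le> 1 + norm x" for x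
    using Cauchy_Schwarz_ineq2[of x b] by (simp add: b)
  define \<epsilon> where "\<epsilon> n = inverse (real (Suc n))" for n
  have \<epsilon>: "\<epsilon> n > 0" "\<epsilon> n \<le> 1" for n by (simp_all add: \<epsilon>_def field_simps)
  have \<epsilon>0: "\<epsilon> \<longlonglongrightarrow> 0" unfolding \<epsilon>_def[abs_def] by (rule LIMSEQ_inverse_real_of_nat)
  have \<theta>int: "integrable lborel (\<lambda>x. C * (1 + norm x) ^ k * norm (\<theta> x))" for k
  proof -
    have "integrable lborel (\<lambda>x. of_real (C * (1 + norm x) ^ k) * \<theta> x)"
      by (rule integrable_poly_growth_schwartz[where C = C and k = k, OF _ _ \<theta>])
        (use C in \<open>auto simp: norm_mult norm_power abs_mult simp del: of_real_mult of_real_power\<close>)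
    from integrable_norm[OF this] show ?thesis
      using C by (simp add: norm_mult norm_power abs_mult del: of_real_mult of_real_power)
  qed
  \<comment> \<open>The bound 1 + |a + b| \<le> (1 + |a|) (1 + |b|) separates x from w, uniformly in
    n because \<open>\<epsilon> n \<le> 1\<close>.\<close>
  have dom: "norm (f (x \<bullet> b + \<epsilon> n * w) * of_real (gauss w) * \<theta> x) \<le>
      (C * (1 + norm x) ^ k * norm (\<theta> x)) * ((1 + norm w) ^ k * gauss w)" for n w x
  proof -
    have "\<bar>x \<bullet> b + \<epsilon> n * w\<bar> \<le> norm x + \<bar>w\<bar>"
      using xb[of x] \<epsilon>[of n] mult_right_mono[of "\<epsilon> n" 1 "\<bar>w\<bar>"] abs_triangle_ineq[of "x \<bullet> b" "\<epsilon> n * w"]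
      by (simp add: abs_mult)
    also have "\<dots> \<le> norm x + \<bar>w\<bar> + norm x * \<bar>w\<bar>" by simp
    finally have "1 + \<bar>x \<bullet> b + \<epsilon> n * w\<bar> \<le> (1 + norm x) * (1 + \<bar>w\<bar>)"
      by (simp add: algebra_simps)
    then have "(1 + \<bar>x \<bullet> b + \<epsilon> n * w\<bar>) ^ k \<le> ((1 + norm x) * (1 + \<bar>w\<bar>)) ^ k"
      by (intro power_mono) auto
    with f[of "x \<bullet> b + \<epsilon> n * w"] C have "norm (f (x \<bullet> b + \<epsilon> n * w)) \<le> C * ((1 + norm x) * (1 + \<bar>w\<bar>)) ^ k"
      by (meson mult_left_mono order_trans)
    then have "norm (f (x \<bullet> b + \<epsilon> n * w)) * (gauss w * norm (\<theta> x)) \<le> C * ((1 + norm x) * (1 + \<bar>w\<bar>)) ^ k * (gauss w * norm (\<theta> x))"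
      using gauss_pos[of w] by (intro mult_right_mono) auto
    then show ?thesis
      using gauss_pos[of w] by (simp add: norm_mult power_mult_distrib mult_ac)
  qed
  have int: "integrable (lborel \<Otimes>\<^sub>M lborel) (\<lambda>(x, w). f (x \<bullet> b + \<epsilon> n * w) * of_real (gauss w) * \<theta> x)" for n
    by (rule lborel_pair.integrable_pair_bound[OF _ \<theta>int[of k] gauss_moment_integrable[of k]])
      (use dom[of _ n] in auto)
  have int0: "integrable (lborel \<Otimes>\<^sub>M lborel) (\<lambda>(x, w::real). f (x \<bullet> b) * of_real (gauss w) * \<theta> x)"
  proof (rule lborel_pair.integrable_pair_bound[OF _ \<theta>int[of k] gauss_integrable])
    show "norm ((\<lambda>(x, w::real). f (x \<bullet> b) * of_real (gauss w) * \<theta> x) (x, w)) \<le> C * (1 + norm x) ^ k * norm (\<theta> x) * gauss w" for x w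
    proof -
      have "norm (f (x \<bullet> b)) \<le> C * (1 + norm x) ^ k"
        using f[of "x \<bullet> b"] C power_mono[OF xb[of x], of k] by (meson add_nonneg_nonneg abs_ge_zero mult_left_mono order_trans zero_le_one)
      from mult_right_mono[OF this, of "norm (\<theta> x) * gauss w"] show ?thesis
        using gauss_pos[of w] by (simp add: norm_mult mult_ac)
    qed
  qed simp
  \<comment> \<open>Substituting u = x . b + \<epsilon> w moves the smoothing onto a kernel in u - x
    . b. Once the kernel is written as an average of characters, the x-integral is a value of
    c.\<close>
  have step: "(\<integral>x. (\<integral>w. f (x \<bullet> b + \<epsilon> n * w) * of_real (gauss w) * \<theta> x \<partial>lborel) \<partial>lborel) =
      (\<integral>u. f u * (\<integral>s. of_real (gauss s) * (cis (s * u * real (Suc n)) *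
        c (- s * real (Suc n) / (2 * pi))) \<partial>lborel) * of_real (real (Suc n) / sqrt (2 * pi)) \<partial>lborel)" for n
  proof -
    let ?N = "real (Suc n)"
    have N: "\<epsilon> n * ?N = 1" "?N * \<epsilon> n = 1" by (simp_all add: \<epsilon>_def)
    have "(\<integral>x. (\<integral>w. f (x \<bullet> b + \<epsilon> n * w) * of_real (gauss w) * \<theta> x \<partial>lborel) \<partial>lborel) =
      (\<integral>x. (\<integral>u. f u * of_real (gauss (?N * (u - x \<bullet> b))) * \<theta> x * of_real ?N \<partial>lborel) \<partial>lborel)"
    proof (rule Bochner_Integration.integral_cong[OF refl])
      fix x :: 'a
      have "(\<integral>u. f u * of_real (gauss (?N * (u - x \<bullet> b))) * \<theta> x * of_real ?N \<partial>lborel) =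
        \<bar>\<epsilon> n\<bar> *\<^sub>R (\<integral>w. f (x \<bullet> b + \<epsilon> n * w) * of_real (gauss (?N * ((x \<bullet> b + \<epsilon> n * w) - x \<bullet> b))) * \<theta> x * of_real ?N \<partial>lborel)"
        by (rule lborel_integral_real_affine) (use \<epsilon>[of n] in auto)
      also have "\<dots> = (\<integral>w. f (x \<bullet> b + \<epsilon> n * w) * of_real (gauss w) * \<theta> x \<partial>lborel)"
        unfolding integral_scaleR_right[symmetric]
      proof (rule Bochner_Integration.integral_cong[OF refl])
        fix w
        have e1: "?N * ((x \<bullet> b + \<epsilon> n * w) - x \<bullet> b) = w"
          using N by (simp add: mult.assoc[symmetric] del: of_nat_Suc)
        have e2: "complex_of_real (\<epsilon> n) * of_real ?N = 1"
          using N unfolding of_real_mult[symmetric] by simp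
        have e3: "\<bar>\<epsilon> n\<bar> *\<^sub>R (A * of_real ?N) = A" for A :: complex
          using \<epsilon>[of n] e2 by (simp add: scaleR_conv_of_real mult.left_commute[of "of_real (\<epsilon> n)"] del: of_nat_Suc of_real_of_nat_eq)
        show "\<bar>\<epsilon> n\<bar> *\<^sub>R (f (x \<bullet> b + \<epsilon> n * w) * of_real (gauss (?N * ((x \<bullet> b + \<epsilon> n * w) - x \<bullet> b))) * \<theta> x * of_real ?N)
          = f (x \<bullet> b + \<epsilon> n * w) * of_real (gauss w) * \<theta> x"
          unfolding e1 e3 ..
      qed
      finally show "(\<integral>w. f (x \<bullet> b + \<epsilon> n * w) * of_real (gauss w) * \<theta> x \<partial>lborel) =
        (\<integral>u. f u * of_real (gauss (?N * (u - x \<bullet> b))) * \<theta> x * of_real ?N \<partial>lborel)" ..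
    qed
    also have "\<dots> = (\<integral>u. (\<integral>x. f u * of_real (gauss (?N * (u - x \<bullet> b))) * \<theta> x * of_real ?N \<partial>lborel) \<partial>lborel)"
    proof (rule lborel_pair.Fubini_integral[symmetric])
      \<comment> \<open>After the growth of f is absorbed, the two additional powers leave the
        weight (1 + |u|)^(-2), which is integrable over the line.\<close>
      obtain B where B: "\<And>t::real. (1 + norm t) ^ (k + 2) * gauss (t /\<^sub>R \<epsilon> n) \<le> B"
        using gauss_decay[OF \<epsilon>(1)[of n], of "k + 2"] by metis
      have B0: "B \<ge> 0" using B[of 0] gauss_pos[of "0::real"] by simp
      have "integrable lborel (\<lambda>u::real. inverse ((1 + \<bar>u\<bar>) ^ 2))"
        by (rule integrable_lborel_decay[where C = 1]) (auto simp: norm_inverse power_mult_distrib)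
      then have h: "integrable lborel (\<lambda>u::real. B * ?N * inverse ((1 + \<bar>u\<bar>) ^ 2))"
        by (rule integrable_mult_right)
      show "integrable (lborel \<Otimes>\<^sub>M lborel) (\<lambda>(x, u). f u * of_real (gauss (?N * (u - x \<bullet> b))) * \<theta> x * of_real ?N)"
      proof (rule lborel_pair.integrable_pair_bound[OF _ \<theta>int[of "k + 2"] h])
        fix x :: 'a and u :: real
        let ?t = "u - x \<bullet> b"
        have "\<bar>u\<bar> \<le> norm x + \<bar>?t\<bar>" using xb[of x] by linarith
        also have "\<dots> \<le> norm x + \<bar>?t\<bar> + norm x * \<bar>?t\<bar>" by simp
        finally have "1 + \<bar>u\<bar> \<le> (1 + norm x) * (1 + \<bar>?t\<bar>)" by (simp add: algebra_simps)
        then have "(1 + \<bar>u\<bar>) ^ (k + 2) \<le> ((1 + norm x) * (1 + \<bar>?t\<bar>)) ^ (k + 2)"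
          by (intro power_mono) auto
        then have "(1 + \<bar>u\<bar>) ^ (k + 2) * gauss (?t /\<^sub>R \<epsilon> n) \<le> ((1 + norm x) * (1 + \<bar>?t\<bar>)) ^ (k + 2) * gauss (?t /\<^sub>R \<epsilon> n)"
          by (intro mult_right_mono gauss_nonneg)
        also have "\<dots> = (1 + norm x) ^ (k + 2) * ((1 + norm ?t) ^ (k + 2) * gauss (?t /\<^sub>R \<epsilon> n))"
          unfolding power_mult_distrib by simp
        also have "\<dots> \<le> (1 + norm x) ^ (k + 2) * B" by (intro mult_left_mono B) simp
        finally have 1: "(1 + \<bar>u\<bar>) ^ k * gauss (?t /\<^sub>R \<epsilon> n) \<le> (1 + norm x) ^ (k + 2) * B * inverse ((1 + \<bar>u\<bar>) ^ 2)"
          unfolding power_add by (simp add: field_simps add_pos_nonneg)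
        have "norm (f u) * gauss (?t /\<^sub>R \<epsilon> n) \<le> C * (1 + \<bar>u\<bar>) ^ k * gauss (?t /\<^sub>R \<epsilon> n)"
          by (intro mult_right_mono f gauss_nonneg)
        also have "\<dots> \<le> C * ((1 + norm x) ^ (k + 2) * B * inverse ((1 + \<bar>u\<bar>) ^ 2))"
          using mult_left_mono[OF 1 C] by (simp add: mult_ac)
        finally have "norm (f u) * gauss (?t /\<^sub>R \<epsilon> n) * (norm (\<theta> x) * ?N) \<le>
            C * ((1 + norm x) ^ (k + 2) * B * inverse ((1 + \<bar>u\<bar>) ^ 2)) * (norm (\<theta> x) * ?N)"
          by (rule mult_right_mono) simp
        moreover have t: "?t /\<^sub>R \<epsilon> n = ?N * ?t" by (simp add: \<epsilon>_def)
        ultimately show "norm ((\<lambda>(x, u). f u * of_real (gauss (?N * (u - x \<bullet> b))) * \<theta> x * of_real ?N) (x, u))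
          \<le> C * (1 + norm x) ^ (k + 2) * norm (\<theta> x) * (B * ?N * inverse ((1 + \<bar>u\<bar>) ^ 2))"
          unfolding t using gauss_pos[of "?N * ?t"]
          by (simp add: norm_mult mult_ac del: of_nat_Suc of_real_of_nat_eq power_Suc)
      qed simp
    qed
    also have "\<dots> = (\<integral>u. f u * (\<integral>s. of_real (gauss s) * (cis (s * u * ?N) *
        c (- s * ?N / (2 * pi))) \<partial>lborel) * of_real (?N / sqrt (2 * pi)) \<partial>lborel)"
    proof (rule Bochner_Integration.integral_cong[OF refl])
      fix u :: real
      have "(\<integral>x. of_real (gauss (?N * (u - x \<bullet> b))) * \<theta> x \<partial>lborel) =
        (\<integral>x. (\<integral>s. of_real (1 / sqrt (2 * pi)) * (cis (s * (?N * (u - x \<bullet> b))) * of_real (gauss s)) * \<theta> x \<partial>lborel) \<partial>lborel)"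
      proof (rule Bochner_Integration.integral_cong[OF refl])
        fix x
        show "of_real (gauss (?N * (u - x \<bullet> b))) * \<theta> x =
          (\<integral>s. of_real (1 / sqrt (2 * pi)) * (cis (s * (?N * (u - x \<bullet> b))) * of_real (gauss s)) * \<theta> x \<partial>lborel)"
          unfolding gauss_fourier'[of "?N * (u - x \<bullet> b)"] integral_mult_left_zero integral_mult_right_zero
          by (simp only: DIM_real power_one_right inner_real_def)
      qed
      also have "\<dots> = (\<integral>s. (\<integral>x. of_real (1 / sqrt (2 * pi)) * (cis (s * (?N * (u - x \<bullet> b))) * of_real (gauss s)) * \<theta> x \<partial>lborel) \<partial>lborel)"
      proof (rule lborel_pair.Fubini_integral[symmetric])
        have h: "integrable lborel (\<lambda>s::real. 1 / sqrt (2 * pi) * gauss s)"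
          by (intro integrable_mult_right gauss_integrable)
        show "integrable (lborel \<Otimes>\<^sub>M lborel) (\<lambda>(x, s). of_real (1 / sqrt (2 * pi)) * (cis (s * (?N * (u - x \<bullet> b))) * of_real (gauss s)) * \<theta> x)"
          by (rule lborel_pair.integrable_pair_bound[OF _ integrable_norm[OF schwartz_integrable[OF \<theta>]] h])
            (auto simp: norm_mult norm_divide gauss_nonneg mult.commute)
      qed
      also have "\<dots> = (\<integral>s. of_real (1 / sqrt (2 * pi)) * (of_real (gauss s) * (cis (s * u * ?N) * c (- s * ?N / (2 * pi)))) \<partial>lborel)"
      proof (rule Bochner_Integration.integral_cong[OF refl])
        fix s :: real
        have "cis (s * (?N * (u - x \<bullet> b))) = cis (s * u * ?N) * cis (2 * pi * ((- s * ?N / (2 * pi)) * (x \<bullet> b)))" for x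
        proof -
          have "2 * pi * ((- s * ?N / (2 * pi)) * (x \<bullet> b)) = - s * ?N * (x \<bullet> b)" by simp
          then show ?thesis by (simp add: cis_mult right_diff_distrib mult_ac del: of_nat_Suc)
        qed
        then have "(\<integral>x. of_real (1 / sqrt (2 * pi)) * (cis (s * (?N * (u - x \<bullet> b))) * of_real (gauss s)) * \<theta> x \<partial>lborel) =
          (\<integral>x. (of_real (1 / sqrt (2 * pi)) * (of_real (gauss s) * cis (s * u * ?N))) * (cis (2 * pi * ((- s * ?N / (2 * pi)) * (x \<bullet> b))) * \<theta> x) \<partial>lborel)"
          by (simp only: mult_ac)
        then show "(\<integral>x. of_real (1 / sqrt (2 * pi)) * (cis (s * (?N * (u - x \<bullet> b))) * of_real (gauss s)) * \<theta> x \<partial>lborel) =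
          of_real (1 / sqrt (2 * pi)) * (of_real (gauss s) * (cis (s * u * ?N) * c (- s * ?N / (2 * pi))))"
          unfolding integral_mult_right_zero c by (simp only: mult_ac)
      qed
      finally have *: "(\<integral>x. of_real (gauss (?N * (u - x \<bullet> b))) * \<theta> x \<partial>lborel) =
        of_real (1 / sqrt (2 * pi)) * (\<integral>s. of_real (gauss s) * (cis (s * u * ?N) * c (- s * ?N / (2 * pi))) \<partial>lborel)"
        unfolding integral_mult_right_zero .
      have "(\<integral>x. f u * of_real (gauss (?N * (u - x \<bullet> b))) * \<theta> x * of_real ?N \<partial>lborel) =
        (\<integral>x. (f u * of_real ?N) * (of_real (gauss (?N * (u - x \<bullet> b))) * \<theta> x) \<partial>lborel)"
        by (simp only: mult_ac)
      then show "(\<integral>x. f u * of_real (gauss (?N * (u - x \<bullet> b))) * \<theta> x * of_real ?N \<partial>lborel) =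
        f u * (\<integral>s. of_real (gauss s) * (cis (s * u * ?N) * c (- s * ?N / (2 * pi))) \<partial>lborel) * of_real (?N / sqrt (2 * pi))"
        unfolding integral_mult_right_zero * by (simp add: mult_ac del: of_nat_Suc of_real_of_nat_eq)
    qed
    finally show ?thesis .
  qed
  \<comment> \<open>The smoothed integrand tends pointwise to the original one by continuity of f;
    in the limit w integrates to 1.\<close>
  have "(\<lambda>n. \<integral>(x, w). f (x \<bullet> b + \<epsilon> n * w) * of_real (gauss w) * \<theta> x \<partial>(lborel \<Otimes>\<^sub>M lborel))
    \<longlonglongrightarrow> (\<integral>(x, w). f (x \<bullet> b) * of_real (gauss w) * \<theta> x \<partial>(lborel \<Otimes>\<^sub>M (lborel :: real measure)))"
  proof (rule integral_dominated_convergence[where w = "\<lambda>(x, w). (C * (1 + norm x) ^ k * norm (\<theta> x)) * ((1 + norm w) ^ k * gauss w)"])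
    show "integrable (lborel \<Otimes>\<^sub>M lborel) (\<lambda>(x, w::real). (C * (1 + norm x) ^ k * norm (\<theta> x)) * ((1 + norm w) ^ k * gauss w))"
      by (rule lborel_pair.integrable_pair_bound[OF _ \<theta>int[of k] gauss_moment_integrable[of k]])
        (use C in \<open>auto simp: abs_mult gauss_nonneg\<close>)
    show "AE z in lborel \<Otimes>\<^sub>M lborel. norm (case z of (x, w) \<Rightarrow> f (x \<bullet> b + \<epsilon> n * w) * of_real (gauss w) * \<theta> x)
      \<le> (case z of (x, w) \<Rightarrow> (C * (1 + norm x) ^ k * norm (\<theta> x)) * ((1 + norm w) ^ k * gauss w))" for n
      using dom[of _ n] by (intro AE_I2) (auto split: prod.splits)
    show "AE z in lborel \<Otimes>\<^sub>M lborel. (\<lambda>n. case z of (x, w) \<Rightarrow> f (x \<bullet> b + \<epsilon> n * w) * of_real (gauss w) * \<theta> x)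
      \<longlonglongrightarrow> (case z of (x, w) \<Rightarrow> f (x \<bullet> b) * of_real (gauss w) * \<theta> x)"
    proof (intro AE_I2, clarify)
      fix x :: 'a and w :: real
      have "(\<lambda>n. x \<bullet> b + \<epsilon> n * w) \<longlonglongrightarrow> x \<bullet> b + 0 * w" by (intro tendsto_intros \<epsilon>0)
      then have "(\<lambda>n. f (x \<bullet> b + \<epsilon> n * w)) \<longlonglongrightarrow> f (x \<bullet> b)"
        using cont by (intro isCont_tendsto_compose[of "x \<bullet> b" f]) (auto simp: continuous_on_eq_continuous_at)
      then show "(\<lambda>n. f (x \<bullet> b + \<epsilon> n * w) * of_real (gauss w) * \<theta> x) \<longlonglongrightarrow> f (x \<bullet> b) * of_real (gauss w) * \<theta> x"
        by (intro tendsto_intros)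
    qed
  qed simp_all
  also have "(\<integral>(x, w). f (x \<bullet> b) * of_real (gauss w) * \<theta> x \<partial>(lborel \<Otimes>\<^sub>M (lborel :: real measure))) =
      (\<integral>x. (\<integral>w. (f (x \<bullet> b) * \<theta> x) * of_real (gauss (w :: real)) \<partial>lborel) \<partial>lborel)"
    by (subst lborel_pair.integral_fst[OF int0, symmetric]) (simp add: mult_ac)
  also have "\<dots> = (\<integral>x. f (x \<bullet> b) * \<theta> x \<partial>lborel)"
    by (simp add: gauss_integral)
  finally show ?thesis
    unfolding step[symmetric] lborel_pair.integral_fst[OF int, symmetric] .
qed

text \<open>
  A form of the Fourier slice theorem: the marginal of \<open>\<F>\<^sub>d (rot e)\<close> in any direction is \<open>\<F>\<^sub>1 e\<close>.
\<close>

lemma fourier_slice: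
  fixes f e :: "real \<Rightarrow> complex" and b :: "'a::euclidean_space"
  assumes cont: "continuous_on UNIV f" and f: "\<And>t. norm (f t) \<le> C * (1 + \<bar>t\<bar>) ^ k"
    and e: "e \<in> schwartz" and even: "\<And>r. e (- r) = e r" and b: "norm b = 1"
  shows "(\<integral>x. f (x \<bullet> b) * fourier (rot e) x \<partial>lborel) = (\<integral>t. f t * fourier e t \<partial>lborel)"
proof -
  have re: "(rot e :: 'a \<Rightarrow> complex) \<in> schwartz" by (rule rot_schwartz[OF e even])
  have eabs: "e \<bar>s\<bar> = e s" for s by (cases "s \<ge> 0") (auto simp: even)
  have 1: "(\<integral>x. cis (2 * pi * (s * (x \<bullet> b))) * fourier (rot e) x \<partial>lborel) = e s" for s
    using fourier_inversion[OF re, of "s *\<^sub>R b"] b by (simp add: rot_def eabs)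
  have 2: "(\<integral>t. cis (2 * pi * (s * (t \<bullet> 1))) * fourier e t \<partial>lborel) = e s" for s
    using fourier_inversion[OF e, of s] by (simp add: mult.commute[of _ s])
  \<comment> \<open>Both integrals are limits of one and the same sequence, because the facts 1 and
    2 give the same function c, namely e.\<close>
  show ?thesis
    using LIMSEQ_unique[OF ridge_integral_limit[OF cont f fourier_schwartz[OF re] b 1]
      ridge_integral_limit[OF cont f fourier_schwartz[OF e] _ 2]] by simp
qed

section \<open>The uniform distribution on the sphere\<close>

lemma nn_integral_lborel_translation:
  fixes g :: "'a::euclidean_space \<Rightarrow> ennreal"
  assumes [measurable]: "g \<in> borel_measurable borel"
  shows "(\<integral>\<^sup>+y. g (y + c) \<partial>lborel) = (\<integral>\<^sup>+y. g y \<partial>lborel)"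
proof -
  have "(\<integral>\<^sup>+y. g y \<partial>lborel) = (\<integral>\<^sup>+y. g y \<partial>distr lborel borel ((+) c))"
    by (simp add: lborel_distr_plus)
  then show ?thesis by (simp add: nn_integral_distr add.commute)
qed

text \<open>
  By Tonelli, two translation-invariant measures are proportional; the unit ball, which \<open>Q\<close>
  preserves, fixes the factor.
\<close>

lemma lborel_distr_linear_isometry:
  fixes Q :: "'a::euclidean_space \<Rightarrow> 'a"
  assumes Q: "linear Q" and norm: "\<And>x. norm (Q x) = norm x" and R: "\<And>x. Q (R x) = x"
  shows "distr lborel borel Q = lborel"
proof (rule measure_eqI)
  have [measurable]: "Q \<in> borel_measurable borel"
    using linear_continuous_on[of Q] Q by (simp add: borel_measurable_continuous_onI linear_conv_bounded_linear)
  fix A assume "A \<in> sets (distr lborel borel Q)"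
  then have [measurable]: "A \<in> sets borel" by simp
  let ?f = "indicator A :: 'a \<Rightarrow> ennreal" and ?b = "indicator (ball 0 1) :: 'a \<Rightarrow> ennreal"
  have [measurable]: "ball (0::'a) 1 \<in> sets borel" by simp
  define V where "V = emeasure lborel (ball (0::'a) 1)"
  have V: "(\<integral>\<^sup>+x. ?b x \<partial>lborel) = V" by (simp add: V_def)
  have V0: "V \<noteq> 0" "V \<noteq> \<infinity>"
    using emeasure_lborel_ball_finite[of "0::'a" 1] unfolding V_def
    by (auto simp: emeasure_ball less_imp_neq[OF unit_ball_vol_pos, symmetric])
  have "(\<integral>\<^sup>+y. ?f (Q y) \<partial>lborel) * V = (\<integral>\<^sup>+x. (\<integral>\<^sup>+y. ?f (Q y) \<partial>lborel) * ?b x \<partial>lborel)"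
    by (subst nn_integral_cmult[OF borel_measurable_indicator]) (simp_all add: V)
  also have "\<dots> = (\<integral>\<^sup>+x. (\<integral>\<^sup>+y. ?f (Q y + x) * ?b x \<partial>lborel) \<partial>lborel)"
  proof (rule nn_integral_cong)
    fix x
    \<comment> \<open>Shifting y by R x shifts Q y by x.\<close>
    have "(\<integral>\<^sup>+y. ?f (Q y) \<partial>lborel) = (\<integral>\<^sup>+y. ?f (Q (y + R x)) \<partial>lborel)"
      by (rule nn_integral_lborel_translation[symmetric]) simp
    then show "(\<integral>\<^sup>+y. ?f (Q y) \<partial>lborel) * ?b x = (\<integral>\<^sup>+y. ?f (Q y + x) * ?b x \<partial>lborel)"
      by (simp add: linear_add[OF Q] R nn_integral_multc)
  qed
  also have "\<dots> = (\<integral>\<^sup>+y. (\<integral>\<^sup>+x. ?f (Q y + x) * ?b x \<partial>lborel) \<partial>lborel)"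
    by (rule lborel_pair.Fubini') measurable
  \<comment> \<open>Shifting x by Q y takes Q out of the indicator of A. It now occurs only in the
    ball, where preservation of norms removes it.\<close>
  also have "\<dots> = (\<integral>\<^sup>+y. (\<integral>\<^sup>+x. ?f x * ?b (x - Q y) \<partial>lborel) \<partial>lborel)"
  proof (rule nn_integral_cong)
    fix y
    show "(\<integral>\<^sup>+x. ?f (Q y + x) * ?b x \<partial>lborel) = (\<integral>\<^sup>+x. ?f x * ?b (x - Q y) \<partial>lborel)"
    proof -
      have "(\<lambda>x. ?f x * ?b (x - Q y)) \<in> borel_measurable borel" by measurable
      from nn_integral_lborel_translation[OF this, of "Q y"] show ?thesis
        by (simp add: add.commute)
    qed
  qed
  also have "\<dots> = (\<integral>\<^sup>+x. (\<integral>\<^sup>+y. ?f x * ?b (x - Q y) \<partial>lborel) \<partial>lborel)"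
    by (rule lborel_pair.Fubini') measurable
  also have "\<dots> = (\<integral>\<^sup>+x. ?f x * V \<partial>lborel)"
  proof (rule nn_integral_cong)
    fix x
    have "norm (x - Q y) = norm (y + (- R x))" for y
    proof -
      have "x - Q y = Q (R x - y)" by (simp add: R linear_diff[OF Q])
      then show ?thesis by (simp add: norm norm_minus_commute)
    qed
    then have "(\<integral>\<^sup>+y. ?b (x - Q y) \<partial>lborel) = (\<integral>\<^sup>+y. ?b (y + (- R x)) \<partial>lborel)"
      by (intro nn_integral_cong) (simp split: split_indicator)
    also have "\<dots> = V" by (subst nn_integral_lborel_translation) (simp_all add: V)
    finally show "(\<integral>\<^sup>+y. ?f x * ?b (x - Q y) \<partial>lborel) = ?f x * V"
      by (simp add: nn_integral_cmult)
  qed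
  also have "\<dots> = emeasure lborel A * V"
    by (simp add: nn_integral_multc)
  finally have "(\<integral>\<^sup>+y. ?f (Q y) \<partial>lborel) = emeasure lborel A"
    using V0 by (simp add: mult.commute[of _ V] ennreal_mult_cancel_left)
  moreover have "(\<integral>\<^sup>+y. ?f (Q y) \<partial>lborel) = emeasure (distr lborel borel Q) A"
    using nn_integral_distr[of Q lborel borel ?f] by simp
  ultimately show "emeasure (distr lborel borel Q) A = emeasure lborel A" by simp
qed simp

lemma sets_sphere_uniform [measurable_cong, simp]: "sets sphere_uniform = sets borel"
  by (simp add: sphere_uniform_def)

lemma space_sphere_uniform [simp]: "space sphere_uniform = UNIV"
  by (simp add: sphere_uniform_def)

interpretation sphere_uniform: prob_space "sphere_uniform :: 'a::euclidean_space measure"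
  by (rule prob_space_sphere_uniform)

text \<open>The isometry preserves Lebesgue measure and the unit ball and commutes with
  \<open>sgn\<close>, hence it preserves the image measure that defines the uniform
  distribution.\<close>

lemma sphere_uniform_distr_linear_isometry:
  fixes Q :: "'a::euclidean_space \<Rightarrow> 'a"
  assumes Q: "linear Q" and norm: "\<And>x. norm (Q x) = norm x" and R: "\<And>x. Q (R x) = x"
  shows "distr sphere_uniform borel Q = (sphere_uniform :: 'a measure)"
proof -
  let ?U = "uniform_measure lborel (ball (0::'a) 1)"
  have [measurable]: "Q \<in> borel_measurable borel"
    using linear_continuous_on[of Q] Q by (simp add: borel_measurable_continuous_onI linear_conv_bounded_linear)
  have U: "distr ?U borel Q = ?U"
  proof (rule measure_eqI)
    fix A assume "A \<in> sets (distr ?U borel Q)"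
    then have [measurable]: "A \<in> sets borel" by simp
    have "Q -` (ball 0 1 \<inter> A) = ball 0 1 \<inter> Q -` A" by (auto simp: norm)
    then have "emeasure lborel (ball 0 1 \<inter> Q -` A) = emeasure (distr lborel borel Q) (ball 0 1 \<inter> A)"
      by (simp add: emeasure_distr)
    then have "emeasure lborel (ball 0 1 \<inter> Q -` A) = emeasure lborel (ball 0 1 \<inter> A)"
      by (simp add: lborel_distr_linear_isometry[OF Q norm R])
    moreover have "Q -` A \<in> sets borel"
      using measurable_sets_borel[of Q borel A] by simp
    ultimately show "emeasure (distr ?U borel Q) A = emeasure ?U A"
      by (simp add: emeasure_distr emeasure_uniform_measure)
  qed simp
  have "Q \<circ> sgn = sgn \<circ> Q"
    by (auto simp: sgn_div_norm norm linear_scale[OF Q])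
  then have "distr sphere_uniform borel Q = distr (distr ?U borel Q) borel sgn"
    unfolding sphere_uniform_def by (simp add: distr_distr)
  then show ?thesis by (simp add: U sphere_uniform_def)
qed

text \<open>A reflection takes z to w when their norms agree. Being self-adjoint, it can be moved
  from \<xi> to z, and the sphere measure is invariant under it.\<close>

lemma sphere_uniform_ridge_cong:
  fixes z w :: "'a::euclidean_space" and g :: "real \<Rightarrow> 'b::{banach, second_countable_topology}"
  assumes "norm z = norm w" and [measurable]: "g \<in> borel_measurable borel"
  shows "(\<integral>\<xi>. g (z \<bullet> \<xi>) \<partial>sphere_uniform) = (\<integral>\<xi>. g (w \<bullet> \<xi>) \<partial>sphere_uniform)"
proof -
  define u where "u = z - w"
  \<comment> \<open>The reflection exchanging \<open>z\<close> and \<open>w\<close>; for \<open>z = w\<close> it is the identity since \<open>x / 0 = 0\<close>.\<close>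
  define Q where "Q x = x - (2 * (x \<bullet> u) / (u \<bullet> u)) *\<^sub>R u" for x
  have lin: "linear Q"
    by (rule linearI) (simp_all add: Q_def inner_add_left algebra_simps add_divide_distrib)
  have QQ: "Q (Q x) = x" for x
  proof (cases "u = 0")
    case False
    then have "Q x \<bullet> u = - (x \<bullet> u)" by (simp add: Q_def inner_diff_left)
    then show ?thesis by (simp add: Q_def[of "Q x"]) (simp add: Q_def)
  qed (simp add: Q_def)
  have sym: "Q x \<bullet> y = x \<bullet> Q y" for x y
    by (simp add: Q_def inner_diff_left inner_diff_right inner_commute[of u y])
  have norm: "norm (Q x) = norm x" for x
    by (simp add: norm_eq_sqrt_inner sym QQ)
  have Qz: "Q z = w"
  proof (cases "u = 0")
    case False
    have "z \<bullet> z = w \<bullet> w" using assms(1) by (simp add: norm_eq)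
    then have "2 * (z \<bullet> u) = u \<bullet> u"
      by (simp add: u_def inner_diff_left inner_diff_right inner_commute[of w z])
    then show ?thesis using False by (simp add: Q_def u_def)
  qed (simp add: Q_def u_def)
  have [measurable]: "Q \<in> borel_measurable borel"
    using linear_continuous_on[of Q] lin by (simp add: borel_measurable_continuous_onI linear_conv_bounded_linear)
  have "(\<integral>\<xi>. g (z \<bullet> \<xi>) \<partial>sphere_uniform) = (\<integral>\<xi>. g (z \<bullet> \<xi>) \<partial>distr sphere_uniform borel Q)"
    by (simp add: sphere_uniform_distr_linear_isometry[OF lin norm QQ])
  also have "\<dots> = (\<integral>\<xi>. g (z \<bullet> Q \<xi>) \<partial>sphere_uniform)"
    by (subst integral_distr) simp_all
  finally show ?thesis by (simp add: sym[symmetric] Qz)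
qed

lemma sphere_uniform_integrable:
  fixes h :: "'a::euclidean_space \<Rightarrow> 'b::{banach, second_countable_topology}"
  assumes "continuous_on UNIV h"
  shows "integrable sphere_uniform h"
proof -
  have "compact (h ` sphere 0 1)"
    by (intro compact_continuous_image continuous_on_subset[OF assms]) auto
  then obtain B where "\<And>x. x \<in> sphere 0 1 \<Longrightarrow> norm (h x) \<le> B"
    using compact_imp_bounded[of "h ` sphere 0 1"] unfolding bounded_iff by (metis imageI)
  then show ?thesis
    using AE_sphere_uniform borel_measurable_continuous_onI[OF assms]
    by (intro sphere_uniform.integrable_const_bound[of _ B]) auto
qed

section \<open>Even moments of one coordinate\<close>

definition sphere_moment :: "'a::euclidean_space \<Rightarrow> nat \<Rightarrow> real" where
  "sphere_moment e m = (\<integral>\<xi>. (e \<bullet> \<xi>) ^ (2 * m) \<partial>sphere_uniform)"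

lemma coeff_one_plus_square_power:
  "coeff ([:1, 0, 1::real:] ^ m) 0 = 1 \<and> coeff ([:1, 0, 1::real:] ^ m) (Suc 0) = 0 \<and>
   coeff ([:1, 0, 1::real:] ^ m) (Suc (Suc 0)) = real m"
  by (induction m) (simp_all add: mult_pCons_left)

text \<open>
  Rotation invariance gives \<open>\<E> (\<xi>\<^sub>e + t \<xi>\<^sub>b)\<^sup>2\<^sup>m = (1 + t\<^sup>2)\<^sup>m \<E> \<xi>\<^sub>e\<^sup>2\<^sup>m\<close>; the lemma compares the
  coefficients of \<open>t\<^sup>2\<close>.
\<close>

lemma sphere_mixed_moment:
  fixes e b :: "'a::euclidean_space"
  assumes e: "e \<in> Basis" and b: "b \<in> Basis" and "e \<noteq> b"
  shows "real (Suc (2 * m)) * (\<integral>\<xi>. (e \<bullet> \<xi>) ^ (2 * m) * (b \<bullet> \<xi>)\<^sup>2 \<partial>sphere_uniform) = sphere_moment e (Suc m)"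
proof -
  let ?n = "2 * Suc m"
  define a where "a k = real (?n choose k) * (\<integral>\<xi>. (e \<bullet> \<xi>) ^ (?n - k) * (b \<bullet> \<xi>) ^ k \<partial>sphere_uniform)" for k
  define p where "p = (\<Sum>k\<le>?n. monom (a k) k)"
  define q where "q = smult (sphere_moment e (Suc m)) ([:1, 0, 1:] ^ Suc m)"
  have "poly p t = poly q t" for t
  proof -
    have "norm (e + t *\<^sub>R b) = norm (sqrt (1 + t\<^sup>2) *\<^sub>R e)"
      using assms by (simp add: norm_eq_sqrt_inner inner_add_left inner_add_right inner_Basis power2_eq_square add_nonneg_nonneg)
    then have "(\<integral>\<xi>. ((e + t *\<^sub>R b) \<bullet> \<xi>) ^ ?n \<partial>sphere_uniform) =
        (\<integral>\<xi>. ((sqrt (1 + t\<^sup>2) *\<^sub>R e) \<bullet> \<xi>) ^ ?n \<partial>sphere_uniform)"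
      by (rule sphere_uniform_ridge_cong) simp
    also have "\<dots> = (\<integral>\<xi>. (1 + t\<^sup>2) ^ Suc m * (e \<bullet> \<xi>) ^ ?n \<partial>sphere_uniform)"
      by (intro Bochner_Integration.integral_cong refl)
        (simp add: power_mult_distrib power_mult del: power_Suc mult_Suc_right)
    also have "\<dots> = poly q t"
      unfolding integral_mult_right_zero q_def sphere_moment_def
      by (simp add: power2_eq_square mult.commute del: power_Suc mult_Suc_right)
    finally have 1: "(\<integral>\<xi>. ((e + t *\<^sub>R b) \<bullet> \<xi>) ^ ?n \<partial>sphere_uniform) = poly q t" .
    have "(\<integral>\<xi>. ((e + t *\<^sub>R b) \<bullet> \<xi>) ^ ?n \<partial>sphere_uniform) =
      (\<integral>\<xi>. (\<Sum>k\<le>?n. (real (?n choose k) * t ^ k) * ((e \<bullet> \<xi>) ^ (?n - k) * (b \<bullet> \<xi>) ^ k)) \<partial>sphere_uniform)"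
      unfolding inner_add_left inner_scaleR_left add.commute[of "e \<bullet> _"] binomial_ring power_mult_distrib
      by (simp only: mult_ac)
    also have "\<dots> = (\<Sum>k\<le>?n. (real (?n choose k) * t ^ k) * (\<integral>\<xi>. (e \<bullet> \<xi>) ^ (?n - k) * (b \<bullet> \<xi>) ^ k \<partial>sphere_uniform))"
      by (subst Bochner_Integration.integral_sum)
        (auto intro!: sphere_uniform_integrable continuous_intros simp del: mult_Suc_right)
    also have "\<dots> = poly p t"
      unfolding p_def poly_sum poly_monom a_def by (intro sum.cong refl) simp
    finally show ?thesis using 1 by simp
  qed
  then have "p = q" by (simp add: poly_eq_poly_eq_iff[symmetric] fun_eq_iff)
  then have "coeff p 2 = coeff q 2" by simp
  moreover have "coeff p 2 = a 2"
    unfolding p_def coeff_sum coeff_monom by (simp add: sum.delta' numeral_2_eq_2)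
  moreover have "coeff q 2 = sphere_moment e (Suc m) * real (Suc m)"
    using coeff_one_plus_square_power[of "Suc m"] by (simp add: q_def numeral_2_eq_2 del: power_Suc)
  \<comment> \<open>The factor m + 1 of this binomial coefficient cancels against the coefficient of
    t^2 in (1 + t^2)^(m + 1).\<close>
  moreover have "real (?n choose 2) = real (Suc m) * real (Suc (2 * m))"
    by (simp add: choose_two algebra_simps)
  ultimately have "real (Suc m) * real (Suc (2 * m)) * (\<integral>\<xi>. (e \<bullet> \<xi>) ^ (2 * m) * (b \<bullet> \<xi>)\<^sup>2 \<partial>sphere_uniform) =
      sphere_moment e (Suc m) * real (Suc m)"
    by (simp add: a_def)
  then have "real (Suc m) * (real (Suc (2 * m)) * (\<integral>\<xi>. (e \<bullet> \<xi>) ^ (2 * m) * (b \<bullet> \<xi>)\<^sup>2 \<partial>sphere_uniform)) =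
      real (Suc m) * sphere_moment e (Suc m)"
    by (simp only: mult_ac)
  then show ?thesis by simp
qed

text \<open>The squared coordinates of \<xi> sum to 1, so the mixed moments over the d - 1 basis
  vectors other than e add up to the difference of two consecutive moments.\<close>

lemma sphere_moment_Suc:
  fixes e :: "'a::euclidean_space"
  assumes e: "e \<in> Basis"
  shows "real (DIM('a) + 2 * m) * sphere_moment e (Suc m) = real (Suc (2 * m)) * sphere_moment e m"
proof -
  let ?c = "real (Suc (2 * m))"
  have int: "integrable sphere_uniform (\<lambda>\<xi>. (e \<bullet> \<xi>) ^ k * (b \<bullet> \<xi>) ^ l)" for b :: 'a and k l
    by (intro sphere_uniform_integrable continuous_intros)
  have "real (DIM('a) - 1) * sphere_moment e (Suc m) = (\<Sum>b\<in>Basis - {e}. sphere_moment e (Suc m))"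
    using e by (simp add: card_Diff_singleton)
  also have "\<dots> = (\<Sum>b\<in>Basis - {e}. ?c * (\<integral>\<xi>. (e \<bullet> \<xi>) ^ (2 * m) * (b \<bullet> \<xi>)\<^sup>2 \<partial>sphere_uniform))"
    using e by (intro sum.cong refl sphere_mixed_moment[symmetric]) auto
  also have "\<dots> = ?c * (\<integral>\<xi>. (\<Sum>b\<in>Basis - {e}. (e \<bullet> \<xi>) ^ (2 * m) * (b \<bullet> \<xi>)\<^sup>2) \<partial>sphere_uniform)"
    by (subst Bochner_Integration.integral_sum) (auto simp: sum_distrib_left intro: int)
  also have "(\<integral>\<xi>. (\<Sum>b\<in>Basis - {e}. (e \<bullet> \<xi>) ^ (2 * m) * (b \<bullet> \<xi>)\<^sup>2) \<partial>sphere_uniform) =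
      (\<integral>\<xi>. (e \<bullet> \<xi>) ^ (2 * m) - (e \<bullet> \<xi>) ^ (2 * Suc m) \<partial>sphere_uniform)"
  proof (rule integral_cong_AE)
    show "AE \<xi> in sphere_uniform. (\<Sum>b\<in>Basis - {e}. (e \<bullet> \<xi>) ^ (2 * m) * (b \<bullet> \<xi>)\<^sup>2) =
        (e \<bullet> \<xi>) ^ (2 * m) - (e \<bullet> \<xi>) ^ (2 * Suc m)"
      using AE_sphere_uniform
    proof eventually_elim
      case (elim \<xi>)
      then have "1 = \<xi> \<bullet> \<xi>" by (simp add: power2_norm_eq_inner[symmetric])
      also have "\<dots> = (\<Sum>b\<in>Basis. (b \<bullet> \<xi>)\<^sup>2)"
        by (subst euclidean_inner) (simp add: power2_eq_square inner_commute)
      also have "\<dots> = (e \<bullet> \<xi>)\<^sup>2 + (\<Sum>b\<in>Basis - {e}. (b \<bullet> \<xi>)\<^sup>2)"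
        using e by (subst sum.remove[of _ e]) auto
      finally have *: "(\<Sum>b\<in>Basis - {e}. (b \<bullet> \<xi>)\<^sup>2) = 1 - (e \<bullet> \<xi>)\<^sup>2" by simp
      show ?case
        unfolding sum_distrib_left[symmetric] * by (simp add: right_diff_distrib power2_eq_square mult.assoc mult.commute[of "_ ^ _"])
    qed
  qed simp_all
  also have "\<dots> = sphere_moment e m - sphere_moment e (Suc m)"
    unfolding sphere_moment_def
    using int[of "2 * m" e 0] int[of "2 * Suc m" e 0] by (subst Bochner_Integration.integral_diff) simp_all
  finally have "real (DIM('a) - 1) * sphere_moment e (Suc m) = ?c * (sphere_moment e m - sphere_moment e (Suc m))" .
  moreover have "real (DIM('a) - 1) = real DIM('a) - 1"
    using DIM_positive[where 'a = 'a] by (simp add: of_nat_diff Suc_leI)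
  ultimately show ?thesis by (simp add: algebra_simps)
qed

lemma sphere_moment_eq:
  fixes e :: "'a::euclidean_space"
  assumes "e \<in> Basis"
  shows "sphere_moment e m = (\<Prod>j<m. real (2 * j + 1) / real (DIM('a) + 2 * j))"
proof (induction m)
  case 0
  show ?case by (simp add: sphere_moment_def sphere_uniform.prob_space[unfolded space_sphere_uniform])
next
  case (Suc m)
  have "real (DIM('a) + 2 * m) > 0" unfolding of_nat_0_less_iff by simp
  then have "sphere_moment e (Suc m) = real (Suc (2 * m)) / real (DIM('a) + 2 * m) * sphere_moment e m"
    using sphere_moment_Suc[OF assms, of m] by (simp add: field_simps)
  then show ?case by (simp add: Suc.IH)
qed

section \<open>The marginal of the sphere as an iterated integral\<close>

text \<open>A continuous linear functional on C([0,1]), but applied to functions on the whole line,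
  which keeps rescalings g(s u) inside the domain. By the bound only the values on [0,1] matter, see
  \<open>bounded_functional_cong\<close>.\<close>

definition bounded_functional :: "((real \<Rightarrow> real) \<Rightarrow> real) \<Rightarrow> bool" where
  "bounded_functional \<Lambda> \<longleftrightarrow>
     (\<forall>g h a b. continuous_on UNIV g \<longrightarrow> continuous_on UNIV h \<longrightarrow>
        \<Lambda> (\<lambda>u. a * g u + b * h u) = a * \<Lambda> g + b * \<Lambda> h) \<and>
     (\<exists>K \<ge> 0. \<forall>g c. continuous_on UNIV g \<longrightarrow> (\<forall>u\<in>{0..1}. \<bar>g u\<bar> \<le> c) \<longrightarrow> \<bar>\<Lambda> g\<bar> \<le> K * c)"

lemma bounded_functionalI:
  assumes "\<And>g h a b. continuous_on UNIV g \<Longrightarrow> continuous_on UNIV h \<Longrightarrow>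
      \<Lambda> (\<lambda>u. a * g u + b * h u) = a * \<Lambda> g + b * \<Lambda> h"
    and "K \<ge> 0"
    and "\<And>g c. continuous_on UNIV g \<Longrightarrow> \<forall>u\<in>{0..1}. \<bar>g u\<bar> \<le> c \<Longrightarrow> \<bar>\<Lambda> g\<bar> \<le> K * c"
  shows "bounded_functional \<Lambda>"
  unfolding bounded_functional_def using assms(2) by (intro conjI allI impI exI[of _ K] assms)

lemma bounded_functional_lincomb:
  assumes "bounded_functional \<Lambda>" "continuous_on UNIV g" "continuous_on UNIV h"
  shows "\<Lambda> (\<lambda>u. a * g u + b * h u) = a * \<Lambda> g + b * \<Lambda> h"
  using assms unfolding bounded_functional_def by blast

lemma bounded_functional_cmult:
  assumes "bounded_functional \<Lambda>" "continuous_on UNIV g"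
  shows "\<Lambda> (\<lambda>u. a * g u) = a * \<Lambda> g"
  using bounded_functional_lincomb[OF assms assms(2), of a 0] by simp

lemma bounded_functional_bound:
  assumes "bounded_functional \<Lambda>"
  obtains K where "K \<ge> 0"
    "\<And>g c. continuous_on UNIV g \<Longrightarrow> (\<And>u. u \<in> {0..1} \<Longrightarrow> \<bar>g u\<bar> \<le> c) \<Longrightarrow> \<bar>\<Lambda> g\<bar> \<le> K * c"
proof -
  from assms obtain K where "K \<ge> 0"
    "\<forall>g c. continuous_on UNIV g \<longrightarrow> (\<forall>u\<in>{0..1}. \<bar>g u\<bar> \<le> c) \<longrightarrow> \<bar>\<Lambda> g\<bar> \<le> K * c"
    unfolding bounded_functional_def by blast
  then show thesis by (intro that[of K]) simp_all
qed

lemma bounded_functional_diff_le: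
  assumes \<Lambda>: "bounded_functional \<Lambda>"
  obtains K where "K \<ge> 0"
    "\<And>g h c. continuous_on UNIV g \<Longrightarrow> continuous_on UNIV h \<Longrightarrow>
      (\<And>u. u \<in> {0..1} \<Longrightarrow> \<bar>g u - h u\<bar> \<le> c) \<Longrightarrow> \<bar>\<Lambda> g - \<Lambda> h\<bar> \<le> K * c"
proof -
  obtain K where K: "K \<ge> 0"
    "\<And>g c. continuous_on UNIV g \<Longrightarrow> (\<And>u. u \<in> {0..1} \<Longrightarrow> \<bar>g u\<bar> \<le> c) \<Longrightarrow> \<bar>\<Lambda> g\<bar> \<le> K * c"
    using bounded_functional_bound[OF \<Lambda>] by blast
  have "\<bar>\<Lambda> g - \<Lambda> h\<bar> \<le> K * c"
    if "continuous_on UNIV g" "continuous_on UNIV h" "\<And>u. u \<in> {0..1} \<Longrightarrow> \<bar>g u - h u\<bar> \<le> c" for g h c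
    using K(2)[of "\<lambda>u. 1 * g u + (-1) * h u" c] bounded_functional_lincomb[OF \<Lambda> that(1,2), of 1 "-1"] that
    by (auto intro!: continuous_intros)
  then show thesis using that K(1) by blast
qed

lemma bounded_functional_cong:
  assumes \<Lambda>: "bounded_functional \<Lambda>" and "continuous_on UNIV g" "continuous_on UNIV h"
    and "\<And>u. u \<in> {0..1} \<Longrightarrow> g u = h u"
  shows "\<Lambda> g = \<Lambda> h"
proof -
  obtain K where "\<bar>\<Lambda> g - \<Lambda> h\<bar> \<le> K * 0"
    using bounded_functional_diff_le[OF \<Lambda>] assms by (metis abs_0 cancel_comm_monoid_add_class.diff_cancel order_refl)
  then show ?thesis by simp
qed

lemma bounded_functional_sum:
  assumes "bounded_functional \<Lambda>"
  shows "finite I \<Longrightarrow> (\<And>i. i \<in> I \<Longrightarrow> continuous_on UNIV (g i)) \<Longrightarrow>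
    \<Lambda> (\<lambda>u. \<Sum>i\<in>I. a i * g i u) = (\<Sum>i\<in>I. a i * \<Lambda> (g i))"
proof (induction I rule: finite_induct)
  case empty
  show ?case using bounded_functional_cmult[OF assms, of "\<lambda>_. 0" 0] by simp
next
  case (insert i I)
  have "\<Lambda> (\<lambda>u. a i * g i u + 1 * (\<Sum>i\<in>I. a i * g i u)) = a i * \<Lambda> (g i) + 1 * \<Lambda> (\<lambda>u. \<Sum>i\<in>I. a i * g i u)"
    using insert.prems by (intro bounded_functional_lincomb assms) (auto intro!: continuous_intros)
  then show ?case using insert by simp
qed

lemma bounded_functional_eqI:
  assumes \<Lambda>: "bounded_functional \<Lambda>" and M: "bounded_functional M"
    and mono: "\<And>m. \<Lambda> (\<lambda>u. u ^ m) = M (\<lambda>u. u ^ m)"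
    and g: "continuous_on UNIV g"
  shows "\<Lambda> g = M g"
proof -
  obtain K where K: "K \<ge> 0" "\<And>g h c. continuous_on UNIV g \<Longrightarrow> continuous_on UNIV h \<Longrightarrow>
      (\<And>u. u \<in> {0..1} \<Longrightarrow> \<bar>g u - h u\<bar> \<le> c) \<Longrightarrow> \<bar>\<Lambda> g - \<Lambda> h\<bar> \<le> K * c"
    using bounded_functional_diff_le[OF \<Lambda>] by blast
  obtain L where L: "L \<ge> 0" "\<And>g h c. continuous_on UNIV g \<Longrightarrow> continuous_on UNIV h \<Longrightarrow>
      (\<And>u. u \<in> {0..1} \<Longrightarrow> \<bar>g u - h u\<bar> \<le> c) \<Longrightarrow> \<bar>M g - M h\<bar> \<le> L * c"
    using bounded_functional_diff_le[OF M] by blast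
  have bound: "\<bar>\<Lambda> g - M g\<bar> \<le> (K + L) * c" if "c > 0" for c
  proof -
    obtain p where p: "real_polynomial_function p" "\<And>u. u \<in> {0..1} \<Longrightarrow> \<bar>g u - p u\<bar> < c"
      using Stone_Weierstrass_real_polynomial_function[of "{0..1::real}" g c] \<open>c > 0\<close>
        continuous_on_subset[OF g] by auto
    then obtain a n where pn: "p = (\<lambda>u. \<Sum>i\<le>n. a i * u ^ i)"
      using real_polynomial_function_iff_sum by blast
    have pc: "continuous_on UNIV p" unfolding pn by (intro continuous_intros)
    have "\<Lambda> p = M p"
      unfolding pn
      using bounded_functional_sum[OF \<Lambda>, of "{..n}" "\<lambda>i u. u ^ i" a]
        bounded_functional_sum[OF M, of "{..n}" "\<lambda>i u. u ^ i" a]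
      by (simp add: mono continuous_on_power)
    moreover have "\<bar>\<Lambda> g - \<Lambda> p\<bar> \<le> K * c" "\<bar>M g - M p\<bar> \<le> L * c"
      by (rule K(2)[OF g pc less_imp_le[OF p(2)]], assumption)
        (rule L(2)[OF g pc less_imp_le[OF p(2)]], assumption)
    ultimately show ?thesis by (simp add: algebra_simps)
  qed
  have "\<bar>\<Lambda> g - M g\<bar> \<le> 0 + e" if "e > 0" for e
  proof -
    \<comment> \<open>The added 1 keeps the denominator positive when K + L = 0.\<close>
    have "\<bar>\<Lambda> g - M g\<bar> \<le> (K + L) * (e / (K + L + 1))"
      using K(1) L(1) that by (intro bound) simp
    also have "\<dots> \<le> (K + L + 1) * (e / (K + L + 1))"
      using K(1) L(1) that by (intro mult_right_mono) auto
    also have "\<dots> = 0 + e" using K(1) L(1) by simp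
    finally show ?thesis .
  qed
  then have "\<bar>\<Lambda> g - M g\<bar> \<le> 0" by (rule field_le_epsilon)
  then show ?thesis by simp
qed

text \<open>On [0,1] every g is the function g(sqrt(u^2)) of u^2, and precomposition with the square
  turns all powers into even ones. This suits the modulus of a coordinate, of which only the even
  powers are polynomials in \<xi>.\<close>

lemma bounded_functional_eqI_even:
  assumes \<Lambda>: "bounded_functional \<Lambda>" and M: "bounded_functional M"
    and mono: "\<And>m. \<Lambda> (\<lambda>u. u ^ (2 * m)) = M (\<lambda>u. u ^ (2 * m))"
    and g: "continuous_on UNIV g"
  shows "\<Lambda> g = M g"
proof -
  have sq: "bounded_functional (\<lambda>g. T (\<lambda>u. g (u\<^sup>2)))" if T: "bounded_functional T" for T
  proof -
    have c: "continuous_on UNIV (\<lambda>u::real. g (u\<^sup>2))" if "continuous_on UNIV g" for g :: "real \<Rightarrow> real"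
      by (rule continuous_on_compose2[OF that]) (auto intro!: continuous_intros)
    obtain K where K: "K \<ge> 0"
      "\<And>g c. continuous_on UNIV g \<Longrightarrow> (\<And>u. u \<in> {0..1} \<Longrightarrow> \<bar>g u\<bar> \<le> c) \<Longrightarrow> \<bar>T g\<bar> \<le> K * c"
      using bounded_functional_bound[OF T] by blast
    have "\<bar>T (\<lambda>u. g (u\<^sup>2))\<bar> \<le> K * b" if "continuous_on UNIV g" "\<forall>u\<in>{0..1}. \<bar>g u\<bar> \<le> b" for g b
      using that by (intro K c) (auto simp: power_le_one)
    then show ?thesis
      unfolding bounded_functional_def using K(1)
      by (auto intro!: bounded_functional_lincomb[OF T] c)
  qed
  have s: "continuous_on UNIV (\<lambda>u. g (sqrt u))"
    by (rule continuous_on_compose2[OF g]) (auto intro!: continuous_intros)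
  have eq: "\<Lambda> (\<lambda>u. g (sqrt (u\<^sup>2))) = M (\<lambda>u. g (sqrt (u\<^sup>2)))"
    by (rule bounded_functional_eqI[OF sq[OF \<Lambda>] sq[OF M] _ s]) (simp add: mono flip: power_mult)
  have abs: "T (\<lambda>u. g (sqrt (u\<^sup>2))) = T g" if T: "bounded_functional T" for T
    by (rule bounded_functional_cong[OF T _ g])
      (auto intro!: continuous_intros continuous_on_compose2[OF g])
  show ?thesis using eq unfolding abs[OF \<Lambda>] abs[OF M] .
qed

lemma continuous_on_scaled:
  fixes g :: "real \<Rightarrow> real"
  shows "continuous_on UNIV g \<Longrightarrow> continuous_on UNIV (\<lambda>u. g (s * u))"
  by (rule continuous_on_compose2[of UNIV g]) (auto intro!: continuous_intros)

lemma bounded_functional_scaled_continuous: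
  fixes g :: "real \<Rightarrow> real"
  assumes \<Lambda>: "bounded_functional \<Lambda>" and g: "continuous_on UNIV g"
  shows "continuous_on UNIV (\<lambda>s. \<Lambda> (\<lambda>u. g (s * u)))"
proof (rule continuous_on_eq_continuous_at[THEN iffD2, OF open_UNIV, rule_format])
  fix s
  obtain K where K: "K \<ge> 0" "\<And>g h c. continuous_on UNIV g \<Longrightarrow> continuous_on UNIV h \<Longrightarrow>
      (\<And>u. u \<in> {0..1} \<Longrightarrow> \<bar>g u - h u\<bar> \<le> c) \<Longrightarrow> \<bar>\<Lambda> g - \<Lambda> h\<bar> \<le> K * c"
    using bounded_functional_diff_le[OF \<Lambda>] by blast
  show "isCont (\<lambda>s. \<Lambda> (\<lambda>u. g (s * u))) s"
    unfolding isCont_def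
  proof (rule LIM_I)
    fix e :: real assume "e > 0"
    define c where "c = e / (K + 1)"
    have "c > 0" using \<open>e > 0\<close> K(1) by (simp add: c_def)
    \<comment> \<open>With |t - s| < 1 and u in [0,1], both s u and t u lie in this
      interval.\<close>
    let ?I = "{- \<bar>s\<bar> - 1..\<bar>s\<bar> + 1}"
    have "uniformly_continuous_on ?I g"
      by (intro compact_uniformly_continuous continuous_on_subset[OF g]) auto
    then obtain d where d: "d > 0" "\<And>x y. x \<in> ?I \<Longrightarrow> y \<in> ?I \<Longrightarrow> \<bar>y - x\<bar> < d \<Longrightarrow> \<bar>g y - g x\<bar> < c"
      using \<open>c > 0\<close> unfolding uniformly_continuous_on_def dist_real_def by metis
    have "\<bar>\<Lambda> (\<lambda>u. g (t * u)) - \<Lambda> (\<lambda>u. g (s * u))\<bar> < e" if t: "\<bar>t - s\<bar> < min d 1" for t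
    proof -
      have "\<bar>\<Lambda> (\<lambda>u. g (t * u)) - \<Lambda> (\<lambda>u. g (s * u))\<bar> \<le> K * c"
      proof (intro K continuous_on_scaled g)
        fix u :: real assume u: "u \<in> {0..1}"
        have ab: "\<bar>x * u\<bar> \<le> \<bar>x\<bar>" for x
          using u by (simp add: abs_mult mult_left_le)
        have "\<bar>t * u - s * u\<bar> < d"
          using ab[of "t - s"] t by (simp add: left_diff_distrib)
        moreover have "s * u \<in> ?I" "t * u \<in> ?I" using ab[of s] ab[of t] t by auto
        ultimately show "\<bar>g (t * u) - g (s * u)\<bar> \<le> c" using d(2) by (simp add: less_imp_le)
      qed
      also have "\<dots> < e" using \<open>e > 0\<close> K(1) by (simp add: c_def field_simps)
      finally show ?thesis .
    qed
    then show "\<exists>d>0. \<forall>t. t \<noteq> s \<and> norm (t - s) < d \<longrightarrow> norm (\<Lambda> (\<lambda>u. g (t * u)) - \<Lambda> (\<lambda>u. g (s * u))) < e"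
      using d(1) by (intro exI[of _ "min d 1"]) (simp del: min_less_iff_conj)
  qed
qed

text \<open>
  \<open>ridge_mean d g\<close> is the mean of \<open>g\<close> over the modulus of one coordinate of a random point of the
  unit sphere of \<open>\<real>\<^sup>d\<close>. The recursion from \<open>d\<close> to \<open>d + 2\<close> expresses Archimedes' theorem: the
  projection of the uniform distribution on the sphere of \<open>\<real>\<^sup>d\<^sup>+\<^sup>2\<close> to \<open>\<real>\<^sup>d\<close> is uniform on the ball.
\<close>

fun ridge_mean :: "nat \<Rightarrow> (real \<Rightarrow> real) \<Rightarrow> real" where
  "ridge_mean 0 g = g 0"
| "ridge_mean (Suc 0) g = g 1"
| "ridge_mean (Suc (Suc 0)) g = 2 / pi * integral {0..pi/2} (\<lambda>\<theta>. g (sin \<theta>))"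
| "ridge_mean (Suc (Suc (Suc d))) g =
     real (Suc d) * integral {0..1} (\<lambda>s. s ^ d * ridge_mean (Suc d) (\<lambda>u. g (s * u)))"

lemma integral_abs_le:
  fixes f :: "real \<Rightarrow> real"
  assumes "continuous_on {a..b} f" "a \<le> b" "\<And>x. x \<in> {a..b} \<Longrightarrow> \<bar>f x\<bar> \<le> B"
  shows "\<bar>integral {a..b} f\<bar> \<le> B * (b - a)"
  using integral_bound[OF assms(2,1), of B] assms(3) by simp

text \<open>Induction along the recursion of \<open>ridge_mean\<close>. The claim concerns the
  functional as a whole, so the function argument of the induction rule is set to the constant 0,
  which rescaling leaves fixed.\<close>

lemma bounded_functional_ridge_mean: "bounded_functional (ridge_mean d)"
proof (induction d "\<lambda>_::real. 0::real" rule: ridge_mean.induct)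
  case 1
  show ?case unfolding bounded_functional_def by (auto intro!: exI[of _ 1])
next
  case 2
  show ?case unfolding bounded_functional_def by (auto intro!: exI[of _ 1])
next
  case 3
  have c: "continuous_on {0..pi/2} (\<lambda>\<theta>. g (sin \<theta>))" if "continuous_on UNIV g" for g :: "real \<Rightarrow> real"
    by (rule continuous_on_compose2[OF that]) (auto intro!: continuous_intros)
  have i: "(\<lambda>\<theta>. g (sin \<theta>)) integrable_on {0..pi/2}" if "continuous_on UNIV g" for g :: "real \<Rightarrow> real"
    by (rule integrable_continuous_real[OF c[OF that]])
  have "\<bar>ridge_mean (Suc (Suc 0)) g\<bar> \<le> 1 * b" if "continuous_on UNIV g" "\<forall>u\<in>{0..1}. \<bar>g u\<bar> \<le> b" for g b
  proof -
    have "\<bar>integral {0..pi/2} (\<lambda>\<theta>. g (sin \<theta>))\<bar> \<le> b * (pi/2 - 0)"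
    proof (intro integral_abs_le c that(1))
      fix \<theta> :: real assume "\<theta> \<in> {0..pi/2}"
      then have "sin \<theta> \<in> {0..1}" by (auto intro!: sin_ge_zero)
      then show "\<bar>g (sin \<theta>)\<bar> \<le> b" using that(2) by blast
    qed simp
    then show ?thesis by (simp add: abs_mult field_simps)
  qed
  moreover have "ridge_mean (Suc (Suc 0)) (\<lambda>u. a * g u + b * h u) =
      a * ridge_mean (Suc (Suc 0)) g + b * ridge_mean (Suc (Suc 0)) h"
    if "continuous_on UNIV g" "continuous_on UNIV h" for g h a b
  proof -
    have "integral {0..pi/2} (\<lambda>\<theta>. a * g (sin \<theta>) + b * h (sin \<theta>)) =
        a * integral {0..pi/2} (\<lambda>\<theta>. g (sin \<theta>)) + b * integral {0..pi/2} (\<lambda>\<theta>. h (sin \<theta>))"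
      by (subst integral_add[OF integrable_on_mult_right[OF i[OF that(1)]] integrable_on_mult_right[OF i[OF that(2)]]]) simp
    then show ?thesis unfolding ridge_mean.simps by (simp only: distrib_left mult.left_commute)
  qed
  ultimately show ?case
    using zero_le_one by (rule bounded_functionalI[where K = 1, rotated 2])
next
  case (4 d)
  let ?\<Lambda> = "ridge_mean (Suc d)"
  have \<Lambda>: "bounded_functional ?\<Lambda>" using 4 by blast
  have c: "continuous_on {0..1} (\<lambda>s. s ^ d * ?\<Lambda> (\<lambda>u. g (s * u)))" if "continuous_on UNIV g" for g
    using continuous_on_subset[OF bounded_functional_scaled_continuous[OF \<Lambda> that]]
    by (intro continuous_intros) auto
  obtain K where K: "K \<ge> 0"
    "\<And>g c. continuous_on UNIV g \<Longrightarrow> (\<And>u. u \<in> {0..1} \<Longrightarrow> \<bar>g u\<bar> \<le> c) \<Longrightarrow> \<bar>?\<Lambda> g\<bar> \<le> K * c"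
    using bounded_functional_bound[OF \<Lambda>] by blast
  have "\<bar>ridge_mean (Suc (Suc (Suc d))) g\<bar> \<le> (real (Suc d) * K) * b"
    if g: "continuous_on UNIV g" and b: "\<forall>u\<in>{0..1}. \<bar>g u\<bar> \<le> b" for g b
  proof -
    have "\<bar>integral {0..1} (\<lambda>s. s ^ d * ?\<Lambda> (\<lambda>u. g (s * u)))\<bar> \<le> (K * b) * (1 - 0)"
    proof (rule integral_abs_le[OF c[OF g]])
      fix s :: real assume s: "s \<in> {0..1}"
      have "\<bar>?\<Lambda> (\<lambda>u. g (s * u))\<bar> \<le> K * b"
        using b s by (intro K continuous_on_scaled g) (auto simp: mult_le_one)
      then have "s ^ d * \<bar>?\<Lambda> (\<lambda>u. g (s * u))\<bar> \<le> 1 * (K * b)"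
        using s by (intro mult_mono) (auto simp: power_le_one)
      then show "\<bar>s ^ d * ?\<Lambda> (\<lambda>u. g (s * u))\<bar> \<le> K * b" using s by (simp add: abs_mult)
    qed simp
    then have "real (Suc d) * \<bar>integral {0..1} (\<lambda>s. s ^ d * ?\<Lambda> (\<lambda>u. g (s * u)))\<bar> \<le> real (Suc d) * (K * b)"
      by (intro mult_left_mono) auto
    then show ?thesis by (simp add: abs_mult mult.assoc del: of_nat_Suc)
  qed
  moreover have "ridge_mean (Suc (Suc (Suc d))) (\<lambda>u. a * g u + b * h u) =
      a * ridge_mean (Suc (Suc (Suc d))) g + b * ridge_mean (Suc (Suc (Suc d))) h"
    if gh: "continuous_on UNIV g" "continuous_on UNIV h" for g h a b
  proof -
    have "(\<lambda>s. s ^ d * ?\<Lambda> (\<lambda>u. a * g (s * u) + b * h (s * u))) =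
      (\<lambda>s. a * (s ^ d * ?\<Lambda> (\<lambda>u. g (s * u))) + b * (s ^ d * ?\<Lambda> (\<lambda>u. h (s * u))))"
      by (simp add: bounded_functional_lincomb[OF \<Lambda> continuous_on_scaled continuous_on_scaled] gh algebra_simps)
    then have "integral {0..1} (\<lambda>s. s ^ d * ?\<Lambda> (\<lambda>u. a * g (s * u) + b * h (s * u))) =
      a * integral {0..1} (\<lambda>s. s ^ d * ?\<Lambda> (\<lambda>u. g (s * u))) + b * integral {0..1} (\<lambda>s. s ^ d * ?\<Lambda> (\<lambda>u. h (s * u)))"
      by (simp add: integral_add integrable_on_mult_right integrable_continuous_real c gh)
    then show ?thesis by (simp add: algebra_simps)
  qed
  ultimately show ?case
    using mult_nonneg_nonneg[OF of_nat_0_le_iff K(1)]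
    by (rule bounded_functionalI[where K = "real (Suc d) * K", rotated 2])
qed

section \<open>Wallis integrals and the moments of \<open>ridge_mean\<close>\<close>

definition wallis :: "nat \<Rightarrow> real" where
  "wallis m = integral {0..pi/2} (\<lambda>\<theta>. sin \<theta> ^ m)"

text \<open>Comes from integrating the derivative of
  \<open>- cos \<theta> * sin \<theta> ^ Suc m\<close>, which vanishes at both ends of the
  interval.\<close>

lemma wallis_Suc_Suc: "real (Suc (Suc m)) * wallis (Suc (Suc m)) = real (Suc m) * wallis m"
proof -
  have i: "(\<lambda>\<theta>. sin \<theta> ^ k) integrable_on {0..pi/2}" for k
    by (intro integrable_continuous_real continuous_intros)
  have "((\<lambda>\<theta>. real (Suc (Suc m)) * sin \<theta> ^ Suc (Suc m) - real (Suc m) * sin \<theta> ^ m) has_integral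
      (- cos (pi/2) * sin (pi/2) ^ Suc m - (- cos 0 * sin 0 ^ Suc m))) {0..pi/2}"
  proof (rule fundamental_theorem_of_calculus)
    fix x :: real
    have "((\<lambda>x. - cos x * sin x ^ Suc m) has_real_derivative
        sin x * sin x ^ Suc m - cos x * (real (Suc m) * (cos x * sin x ^ m))) (at x)"
      by (rule DERIV_cong[OF DERIV_mult[OF DERIV_minus[OF DERIV_cos] DERIV_power_Suc[OF DERIV_sin]]])
        (simp add: algebra_simps)
    also have "sin x * sin x ^ Suc m - cos x * (real (Suc m) * (cos x * sin x ^ m)) =
        sin x ^ Suc (Suc m) - real (Suc m) * ((cos x)\<^sup>2 * sin x ^ m)"
      by (simp add: power2_eq_square)
    also have "\<dots> = real (Suc (Suc m)) * sin x ^ Suc (Suc m) - real (Suc m) * sin x ^ m"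
      unfolding cos_squared_eq by (simp add: algebra_simps power2_eq_square)
    finally show "((\<lambda>x. - cos x * sin x ^ Suc m) has_vector_derivative
        real (Suc (Suc m)) * sin x ^ Suc (Suc m) - real (Suc m) * sin x ^ m) (at x within {0..pi/2})"
      by (simp add: has_real_derivative_iff_has_vector_derivative has_vector_derivative_at_within)
  qed auto
  then have "integral {0..pi/2} (\<lambda>\<theta>. real (Suc (Suc m)) * sin \<theta> ^ Suc (Suc m) - real (Suc m) * sin \<theta> ^ m) = 0"
    by (intro integral_unique) simp
  then show ?thesis
    unfolding wallis_def
    by (subst (asm) integral_diff) (auto simp: integrable_on_mult_right i simp del: power_Suc of_nat_Suc)
qed

lemma wallis_0: "wallis 0 = pi / 2"
  by (simp add: wallis_def)

lemma wallis_1: "wallis (Suc 0) = 1"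
proof -
  have "((\<lambda>\<theta>. sin \<theta>) has_integral (- cos (pi/2) - (- cos 0))) {0..pi/2}"
  proof (rule fundamental_theorem_of_calculus)
    fix x :: real
    have "((\<lambda>x. - cos x) has_real_derivative sin x) (at x)"
      by (auto intro!: derivative_eq_intros)
    then show "((\<lambda>x. - cos x) has_vector_derivative sin x) (at x within {0..pi/2})"
      by (simp add: has_real_derivative_iff_has_vector_derivative has_vector_derivative_at_within)
  qed auto
  then show ?thesis by (simp add: wallis_def integral_unique)
qed

text \<open>By the recurrence the left side does not depend on m. The product of consecutive Wallis
  integrals arises in \<open>ridge_mean_2_iterated\<close>, where the moments of all orders are
  compared.\<close>

lemma wallis_mult_Suc: "real (Suc m) * (wallis (Suc m) * wallis m) = pi / 2"
proof (induction m)
  case 0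
  show ?case by (simp add: wallis_0 wallis_1)
next
  case (Suc m)
  have "real (Suc (Suc m)) * (wallis (Suc (Suc m)) * wallis (Suc m)) =
      (real (Suc (Suc m)) * wallis (Suc (Suc m))) * wallis (Suc m)" by simp
  also have "\<dots> = real (Suc m) * (wallis (Suc m) * wallis m)"
    unfolding wallis_Suc_Suc by simp
  also have "\<dots> = pi / 2" by (rule Suc.IH)
  finally show ?case .
qed

lemma integral_unit_power: "integral {0..1} (\<lambda>s::real. s ^ k) = 1 / real (Suc k)"
proof -
  have "((\<lambda>s::real. s ^ k) has_integral (1 ^ Suc k / real (Suc k) - 0 ^ Suc k / real (Suc k))) {0..1}"
  proof (rule fundamental_theorem_of_calculus)
    fix x :: real
    have "((\<lambda>s. s ^ Suc k / real (Suc k)) has_real_derivative (1 + real k) * (1 * x ^ k) / real (Suc k)) (at x)"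
      by (rule DERIV_cdivide[OF DERIV_power_Suc[OF DERIV_ident]])
    moreover have "(1 + real k) * (1 * x ^ k) / real (Suc k) = x ^ k" by simp
    ultimately show "((\<lambda>s. s ^ Suc k / real (Suc k)) has_vector_derivative x ^ k) (at x within {0..1})"
      by (simp only: has_real_derivative_iff_has_vector_derivative has_vector_derivative_at_within)
  qed simp
  then show ?thesis by (simp add: integral_unique)
qed

lemma ridge_mean_2_power: "ridge_mean 2 (\<lambda>u. u ^ m) = 2 / pi * wallis m"
  by (simp add: numeral_2_eq_2 wallis_def)

text \<open>The values are those of \<open>sphere_moment_eq\<close>; this identifies
  \<open>ridge_mean\<close> with the law of the modulus of a coordinate.\<close>

lemma ridge_mean_even_power:
  "d \<ge> 1 \<Longrightarrow> ridge_mean d (\<lambda>u. u ^ (2 * m)) = (\<Prod>j<m. real (2 * j + 1) / real (d + 2 * j))"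
proof (induction d "\<lambda>_::real. 0::real" rule: ridge_mean.induct)
  case 2
  have "(\<Prod>j<m. real (2 * j + 1) / real (Suc 0 + 2 * j)) = (\<Prod>j<m. 1)"
    by (intro prod.cong) auto
  then show ?case by simp
next
  case 3
  have "2 / pi * wallis (2 * m) = (\<Prod>j<m. real (2 * j + 1) / real (2 + 2 * j))"
  proof (induction m)
    case (Suc m)
    have "wallis (2 * Suc m) = real (2 * m + 1) / real (2 + 2 * m) * wallis (2 * m)"
      using wallis_Suc_Suc[of "2 * m"] by (simp add: field_simps)
    then show ?case unfolding prod.lessThan_Suc Suc.IH[symmetric] by simp
  qed (simp add: wallis_0)
  then show ?case using ridge_mean_2_power[of "2 * m"] by (simp add: numeral_2_eq_2)
next
  case (4 d)
  let ?P = "\<lambda>n. \<Prod>j<m. real (2 * j + 1) / real (n + 2 * j)"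
  have "(\<lambda>s. s ^ d * ridge_mean (Suc d) (\<lambda>u. (s * u) ^ (2 * m))) = (\<lambda>s::real. ?P (Suc d) * s ^ (d + 2 * m))"
    using 4 by (simp add: power_mult_distrib bounded_functional_cmult[OF bounded_functional_ridge_mean]
        continuous_on_power power_add mult_ac)
  then have 1: "ridge_mean (Suc (Suc (Suc d))) (\<lambda>u. u ^ (2 * m)) = real (Suc d) / real (Suc d + 2 * m) * ?P (Suc d)"
    by (simp add: integral_unit_power)
  \<comment> \<open>The two products have the same numerators, and their denominators are shifted by
    one position, so the quotient telescopes.\<close>
  have "?P (Suc (Suc (Suc d))) = real (Suc d) / real (Suc d + 2 * m) * ?P (Suc d)"
  proof (induction m)
    case (Suc m)
    have e: "real (Suc (Suc (Suc d)) + 2 * m) = real (Suc d + 2 * Suc m)" by simp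
    show ?case
      unfolding prod.lessThan_Suc Suc.IH e
      by (simp only: times_divide_eq_left times_divide_eq_right divide_divide_eq_left mult_ac)
  qed simp
  then show ?case using 1 by simp
qed simp

text \<open>Two bounded functionals with equal even moments agree; rotation invariance reduces z to
  a multiple of a basis vector.\<close>

lemma sphere_uniform_ridge_mean:
  fixes z :: "'a::euclidean_space"
  assumes f: "continuous_on UNIV f"
  shows "(\<integral>\<xi>. f \<bar>z \<bullet> \<xi>\<bar> \<partial>sphere_uniform) = ridge_mean DIM('a) (\<lambda>u. f (norm z * u))"
proof -
  obtain e :: 'a where e: "e \<in> Basis" using nonempty_Basis by blast
  have fm: "(\<lambda>t. f \<bar>t\<bar>) \<in> borel_measurable borel"
    by (intro borel_measurable_continuous_onI continuous_on_compose2[OF f] continuous_intros) auto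
  define S where "S g = (\<integral>\<xi>. g \<bar>e \<bullet> \<xi>\<bar> \<partial>sphere_uniform)" for g :: "real \<Rightarrow> real"
  have int: "integrable sphere_uniform (\<lambda>\<xi>. g \<bar>e \<bullet> \<xi>\<bar>)" if "continuous_on UNIV g" for g :: "real \<Rightarrow> real"
    by (intro sphere_uniform_integrable continuous_on_compose2[OF that] continuous_intros) auto
  have S: "bounded_functional S"
  proof -
    have "\<bar>S g\<bar> \<le> 1 * c" if "continuous_on UNIV g" "\<forall>u\<in>{0..1}. \<bar>g u\<bar> \<le> c" for g c
    proof -
      have "\<bar>S g\<bar> \<le> (\<integral>\<xi>. \<bar>g \<bar>e \<bullet> \<xi>\<bar>\<bar> \<partial>(sphere_uniform :: 'a measure))"
        unfolding S_def by (rule integral_abs_bound)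
      also have "\<dots> \<le> (\<integral>\<xi>. c \<partial>(sphere_uniform :: 'a measure))"
      proof (rule integral_mono_AE)
        show "AE \<xi> in sphere_uniform. \<bar>g \<bar>e \<bullet> \<xi>\<bar>\<bar> \<le> c"
          using AE_sphere_uniform
        proof eventually_elim
          case (elim \<xi>)
          then have "\<bar>e \<bullet> \<xi>\<bar> \<le> 1" using Cauchy_Schwarz_ineq2[of e \<xi>] e by simp
          then show ?case using that(2) by simp
        qed
      qed (use int[OF that(1)] in auto)
      also have "\<dots> = 1 * c" using sphere_uniform.prob_space[where 'a = 'a] by simp
      finally show ?thesis .
    qed
    then show ?thesis
      unfolding bounded_functional_def S_def
      by (auto simp: int intro!: exI[of _ "1::real"])
  qed
  have "S g = ridge_mean DIM('a) g" if "continuous_on UNIV g" for g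
  proof (rule bounded_functional_eqI_even[OF S bounded_functional_ridge_mean _ that])
    fix m
    have "S (\<lambda>u. u ^ (2 * m)) = sphere_moment e m"
      by (simp add: S_def sphere_moment_def power_mult)
    also have "\<dots> = ridge_mean DIM('a) (\<lambda>u. u ^ (2 * m))"
      by (simp add: sphere_moment_eq[OF e] ridge_mean_even_power DIM_positive Suc_leI)
    finally show "S (\<lambda>u. u ^ (2 * m)) = ridge_mean DIM('a) (\<lambda>u. u ^ (2 * m))" .
  qed
  then have "S (\<lambda>u. f (norm z * u)) = ridge_mean DIM('a) (\<lambda>u. f (norm z * u))"
    using continuous_on_scaled[OF f] by blast
  moreover have "(\<integral>\<xi>. f \<bar>z \<bullet> \<xi>\<bar> \<partial>sphere_uniform) = (\<integral>\<xi>. f \<bar>(norm z *\<^sub>R e) \<bullet> \<xi>\<bar> \<partial>sphere_uniform)"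
    using e by (intro sphere_uniform_ridge_cong[OF _ fm]) simp
  ultimately show ?thesis by (simp add: S_def abs_mult)
qed

section \<open>Inverting the slicing operator\<close>

definition poly_growth :: "(real \<Rightarrow> real) \<Rightarrow> bool" where
  "poly_growth g \<longleftrightarrow> (\<exists>C k. \<forall>r\<ge>0. \<bar>g r\<bar> \<le> C * (1 + r) ^ k)"

lemma poly_growthE:
  assumes "poly_growth g"
  obtains C k where "C \<ge> 0" "\<And>r. r \<ge> 0 \<Longrightarrow> \<bar>g r\<bar> \<le> C * (1 + r) ^ k"
proof -
  obtain C k where *: "\<And>r. r \<ge> 0 \<Longrightarrow> \<bar>g r\<bar> \<le> C * (1 + r) ^ k"
    using assms by (auto simp: poly_growth_def)
  moreover have "C \<ge> 0" using *[of 0] by (simp add: order_trans[OF abs_ge_zero])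
  ultimately show thesis using that by blast
qed

lemma poly_growth_lincomb:
  assumes "poly_growth g" "poly_growth h"
  shows "poly_growth (\<lambda>r. a * g r + b * h r)"
proof -
  obtain C k where g: "C \<ge> 0" "\<And>r. r \<ge> 0 \<Longrightarrow> \<bar>g r\<bar> \<le> C * (1 + r) ^ k"
    using poly_growthE[OF assms(1)] by blast
  obtain D l where h: "D \<ge> 0" "\<And>r. r \<ge> 0 \<Longrightarrow> \<bar>h r\<bar> \<le> D * (1 + r) ^ l"
    using poly_growthE[OF assms(2)] by blast
  have "\<bar>a * g r + b * h r\<bar> \<le> (\<bar>a\<bar> * C + \<bar>b\<bar> * D) * (1 + r) ^ (k + l)" if r: "r \<ge> 0" for r
  proof -
    have "C * (1 + r) ^ k \<le> C * (1 + r) ^ (k + l)" "D * (1 + r) ^ l \<le> D * (1 + r) ^ (k + l)"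
      using r g(1) h(1) by (auto intro!: mult_left_mono power_increasing)
    then have "\<bar>g r\<bar> \<le> C * (1 + r) ^ (k + l)" "\<bar>h r\<bar> \<le> D * (1 + r) ^ (k + l)"
      using g(2)[OF r] h(2)[OF r] by linarith+
    then have "\<bar>a\<bar> * \<bar>g r\<bar> + \<bar>b\<bar> * \<bar>h r\<bar> \<le> \<bar>a\<bar> * (C * (1 + r) ^ (k + l)) + \<bar>b\<bar> * (D * (1 + r) ^ (k + l))"
      by (intro add_mono mult_left_mono) auto
    then show ?thesis
      using abs_triangle_ineq[of "a * g r" "b * h r"] by (simp add: abs_mult algebra_simps)
  qed
  then show ?thesis unfolding poly_growth_def by blast
qed

lemma poly_growth_times_id:
  assumes "poly_growth g"
  shows "poly_growth (\<lambda>r. r * g r)"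
proof -
  obtain C k where g: "C \<ge> 0" "\<And>r. r \<ge> 0 \<Longrightarrow> \<bar>g r\<bar> \<le> C * (1 + r) ^ k"
    using poly_growthE[OF assms] by blast
  have "\<bar>r * g r\<bar> \<le> C * (1 + r) ^ Suc k" if r: "r \<ge> 0" for r
  proof -
    have "r * \<bar>g r\<bar> \<le> (1 + r) * (C * (1 + r) ^ k)"
      using r g by (intro mult_mono) auto
    then show ?thesis using r by (simp add: abs_mult mult_ac)
  qed
  then show ?thesis unfolding poly_growth_def by blast
qed

lemma poly_growth_const: "poly_growth (\<lambda>_. c)"
  unfolding poly_growth_def by (intro exI[of _ "\<bar>c\<bar>"] exI[of _ 0]) simp

text \<open>The mean value inequality on [0,r] costs one power of 1 + r. It carries the growth of
  the top derivative down to F itself.\<close>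

lemma poly_growth_antiderivative:
  assumes der: "\<And>r. r \<ge> 0 \<Longrightarrow> (g has_real_derivative g' r) (at r within {0..})"
    and "poly_growth g'"
  shows "poly_growth g"
proof -
  obtain C k where g': "C \<ge> 0" "\<And>r. r \<ge> 0 \<Longrightarrow> \<bar>g' r\<bar> \<le> C * (1 + r) ^ k"
    using poly_growthE[OF assms(2)] by blast
  have "\<bar>g r\<bar> \<le> (\<bar>g 0\<bar> + C) * (1 + r) ^ Suc k" if r: "r \<ge> 0" for r
  proof -
    have "norm (g r - g 0) \<le> (C * (1 + r) ^ k) * norm (r - 0)"
    proof (rule field_differentiable_bound[where S = "{0..r}" and f' = g'])
      fix z assume z: "z \<in> {0..r}"
      show "(g has_field_derivative g' z) (at z within {0..r})"
        using z by (intro has_field_derivative_subset[OF der]) auto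
      have "C * (1 + z) ^ k \<le> C * (1 + r) ^ k"
        using z g'(1) by (intro mult_left_mono power_mono) auto
      then show "norm (g' z) \<le> C * (1 + r) ^ k"
        using g'(2)[of z] z by simp
    qed (use r in auto)
    also have "\<dots> \<le> (C * (1 + r) ^ k) * (1 + r)"
      using r g'(1) by (intro mult_left_mono) auto
    finally have "\<bar>g r\<bar> \<le> \<bar>g 0\<bar> + C * (1 + r) ^ Suc k" by (simp add: mult_ac)
    moreover have "\<bar>g 0\<bar> * 1 \<le> \<bar>g 0\<bar> * (1 + r) ^ Suc k"
      using r by (intro mult_left_mono one_le_power) auto
    ultimately show ?thesis by (simp add: algebra_simps)
  qed
  then show ?thesis unfolding poly_growth_def by blast
qed

section \<open>Chains of derivatives and the descent in dimension\<close>

text \<open>The derivatives are an explicit sequence of functions, one-sided at 0, so that the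
  induction over the dimension can pass to a new function by writing down its whole
  sequence.\<close>

definition derivative_chain :: "nat \<Rightarrow> (nat \<Rightarrow> real \<Rightarrow> real) \<Rightarrow> bool" where
  "derivative_chain N G \<longleftrightarrow>
     (\<forall>i<N. \<forall>r\<ge>0. (G i has_real_derivative G (Suc i) r) (at r within {0..})) \<and>
     (\<forall>i\<le>N. continuous_on {0..} (G i) \<and> poly_growth (G i))"

lemma has_real_derivative_scaled:
  assumes "\<And>r. r \<ge> 0 \<Longrightarrow> (g has_real_derivative g' r) (at r within {0..})" "r \<ge> 0" "s \<in> {0..1}"
  shows "((\<lambda>s. g (r * s)) has_real_derivative r * g' (r * s)) (at s within {0..1})"
proof -
  have "(g has_real_derivative g' (r * s)) (at (r * s) within (\<lambda>s. r * s) ` {0..1})"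
    using assms(2,3) by (intro has_field_derivative_subset[OF assms(1)]) auto
  moreover have "((\<lambda>s. r * s) has_real_derivative r) (at s within {0..1})"
    by (auto intro!: derivative_eq_intros)
  ultimately show ?thesis
    using DERIV_image_chain[of g "g' (r * s)" "\<lambda>s. r * s" s "{0..1}" r]
    by (simp add: o_def mult.commute)
qed

lemma continuous_on_abs_compose:
  "continuous_on {0..} g \<Longrightarrow> continuous_on UNIV (\<lambda>x::real. g \<bar>x\<bar>)"
  by (rule continuous_on_compose2[of "{0..}" g]) (auto intro!: continuous_intros)

lemma bounded_functional_integral: "bounded_functional (\<lambda>g. integral {0..1} g)"
proof (rule bounded_functionalI[where K = 1])
  fix g h :: "real \<Rightarrow> real" and a b
  assume gh: "continuous_on UNIV g" "continuous_on UNIV h"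
  have "g integrable_on {0..1}" "h integrable_on {0..1}"
    using gh by (auto intro: integrable_continuous_real continuous_on_subset)
  then show "integral {0..1} (\<lambda>u. a * g u + b * h u) = a * integral {0..1} g + b * integral {0..1} h"
    by (subst integral_add) (auto intro: integrable_on_mult_right)
next
  fix g :: "real \<Rightarrow> real" and c
  assume g: "continuous_on UNIV g" "\<forall>u\<in>{0..1}. \<bar>g u\<bar> \<le> c"
  show "\<bar>integral {0..1} g\<bar> \<le> 1 * c"
    using integral_abs_le[OF continuous_on_subset[OF g(1)], of 0 1 c] g(2) by simp
qed simp

text \<open>
  In spherical coordinates: a coordinate \<open>sin \<alpha> sin \<theta>\<close> of a random point of the sphere of \<open>\<real>\<^sup>3\<close> is
  uniformly distributed.
\<close>

lemma ridge_mean_2_iterated: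
  assumes g: "continuous_on UNIV g"
  shows "pi / 2 * ridge_mean 2 (\<lambda>u. \<bar>u\<bar> * ridge_mean 2 (\<lambda>v. g (u * v))) = integral {0..1} g"
proof -
  let ?\<Lambda> = "ridge_mean 2"
  have \<Lambda>: "bounded_functional ?\<Lambda>" by (rule bounded_functional_ridge_mean)
  have c: "continuous_on UNIV (\<lambda>u. \<bar>u\<bar> * ?\<Lambda> (\<lambda>v. g (u * v)))" if "continuous_on UNIV g" for g
    by (intro continuous_intros bounded_functional_scaled_continuous[OF \<Lambda>] that)
  obtain K where K: "K \<ge> 0"
    "\<And>g c. continuous_on UNIV g \<Longrightarrow> (\<And>u. u \<in> {0..1} \<Longrightarrow> \<bar>g u\<bar> \<le> c) \<Longrightarrow> \<bar>?\<Lambda> g\<bar> \<le> K * c"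
    using bounded_functional_bound[OF \<Lambda>] by blast
  have "bounded_functional (\<lambda>g. pi / 2 * ?\<Lambda> (\<lambda>u. \<bar>u\<bar> * ?\<Lambda> (\<lambda>v. g (u * v))))"
  proof (rule bounded_functionalI[where K = "pi / 2 * (K * K)"])
    fix g h :: "real \<Rightarrow> real" and a b
    assume gh: "continuous_on UNIV g" "continuous_on UNIV h"
    have "(\<lambda>u. \<bar>u\<bar> * ?\<Lambda> (\<lambda>v. a * g (u * v) + b * h (u * v))) =
      (\<lambda>u. a * (\<bar>u\<bar> * ?\<Lambda> (\<lambda>v. g (u * v))) + b * (\<bar>u\<bar> * ?\<Lambda> (\<lambda>v. h (u * v))))"
      by (simp add: bounded_functional_lincomb[OF \<Lambda> continuous_on_scaled continuous_on_scaled] gh algebra_simps)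
    then show "pi / 2 * ?\<Lambda> (\<lambda>u. \<bar>u\<bar> * ?\<Lambda> (\<lambda>v. a * g (u * v) + b * h (u * v))) =
      a * (pi / 2 * ?\<Lambda> (\<lambda>u. \<bar>u\<bar> * ?\<Lambda> (\<lambda>v. g (u * v)))) + b * (pi / 2 * ?\<Lambda> (\<lambda>u. \<bar>u\<bar> * ?\<Lambda> (\<lambda>v. h (u * v))))"
      by (simp add: bounded_functional_lincomb[OF \<Lambda> c c] gh algebra_simps)
  next
    fix g :: "real \<Rightarrow> real" and b
    assume g: "continuous_on UNIV g" and b: "\<forall>u\<in>{0..1}. \<bar>g u\<bar> \<le> b"
    have "\<bar>?\<Lambda> (\<lambda>u. \<bar>u\<bar> * ?\<Lambda> (\<lambda>v. g (u * v)))\<bar> \<le> K * (K * b)"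
    proof (intro K c g)
      fix u :: real assume u: "u \<in> {0..1}"
      have "\<bar>?\<Lambda> (\<lambda>v. g (u * v))\<bar> \<le> K * b"
        using b u by (intro K continuous_on_scaled g) (auto simp: mult_le_one)
      then have "u * \<bar>?\<Lambda> (\<lambda>v. g (u * v))\<bar> \<le> 1 * (K * b)"
        using u by (intro mult_mono) auto
      then show "\<bar>\<bar>u\<bar> * ?\<Lambda> (\<lambda>v. g (u * v))\<bar> \<le> K * b" using u by (simp add: abs_mult)
    qed
    then have "pi / 2 * \<bar>?\<Lambda> (\<lambda>u. \<bar>u\<bar> * ?\<Lambda> (\<lambda>v. g (u * v)))\<bar> \<le> pi / 2 * (K * (K * b))"
      by (intro mult_left_mono) auto
    then show "\<bar>pi / 2 * ?\<Lambda> (\<lambda>u. \<bar>u\<bar> * ?\<Lambda> (\<lambda>v. g (u * v)))\<bar> \<le> pi / 2 * (K * K) * b"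
      by (simp add: abs_mult mult.assoc)
  qed (use K(1) in simp)
  then show ?thesis
  proof (rule bounded_functional_eqI[OF _ bounded_functional_integral _ g])
    fix m
    \<comment> \<open>On [0,1] the factor |u| raises the outer power by one, so that
      \<open>wallis m\<close> meets \<open>wallis (Suc m)\<close>.\<close>
    have "?\<Lambda> (\<lambda>u. \<bar>u\<bar> * ?\<Lambda> (\<lambda>v. (u * v) ^ m)) = ?\<Lambda> (\<lambda>u. (2 / pi * wallis m) * u ^ Suc m)"
    proof (rule bounded_functional_cong[OF \<Lambda>])
      show "continuous_on UNIV (\<lambda>u. \<bar>u\<bar> * ?\<Lambda> (\<lambda>v. (u * v) ^ m))"
        by (rule c[of "\<lambda>x. x ^ m"]) (intro continuous_intros)
      show "continuous_on UNIV (\<lambda>u. (2 / pi * wallis m) * u ^ Suc m)"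
        by (intro continuous_intros)
      fix u :: real assume "u \<in> {0..1}"
      then show "\<bar>u\<bar> * ?\<Lambda> (\<lambda>v. (u * v) ^ m) = (2 / pi * wallis m) * u ^ Suc m"
        by (simp add: power_mult_distrib bounded_functional_cmult[OF \<Lambda>] continuous_on_power ridge_mean_2_power)
    qed
    also have "\<dots> = (2 / pi * wallis m) * (2 / pi * wallis (Suc m))"
      unfolding ridge_mean_2_power[symmetric] by (intro bounded_functional_cmult \<Lambda> continuous_intros)
    finally have "pi / 2 * ?\<Lambda> (\<lambda>u. \<bar>u\<bar> * ?\<Lambda> (\<lambda>v. (u * v) ^ m)) = 2 / pi * (wallis (Suc m) * wallis m)"
      by simp
    also have "wallis (Suc m) * wallis m = pi / 2 / real (Suc m)"
      using wallis_mult_Suc[of m] by (simp add: field_simps)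
    also have "2 / pi * (pi / 2 / real (Suc m)) = 1 / real (Suc m)"
      by (simp add: field_simps del: of_nat_Suc)
    also have "\<dots> = integral {0..1} (\<lambda>s::real. s ^ m)"
      by (rule integral_unit_power[symmetric])
    finally show "pi / 2 * ?\<Lambda> (\<lambda>u. \<bar>u\<bar> * ?\<Lambda> (\<lambda>v. (u * v) ^ m)) = integral {0..1} (\<lambda>s. s ^ m)" .
  qed
qed

text \<open>
  In dimension 2 the inverse is \<open>t \<mapsto> F 0 + t \<integral>\<^sub>0\<^sup>\<pi>\<^sup>/\<^sup>2 F' (t sin \<theta>) d\<theta>\<close>.
\<close>

lemma ridge_mean_inversion:
  assumes "d \<ge> 1" "derivative_chain (d div 2) G"
  shows "\<exists>f. continuous_on UNIV f \<and> poly_growth f \<and> (\<forall>t. f (- t) = f t) \<and>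
    (\<forall>r\<ge>0. G 0 r = ridge_mean d (\<lambda>u. f (r * u)))"
  using assms
proof (induction d "\<lambda>_::real. 0::real" arbitrary: G rule: ridge_mean.induct)
  case 2
  then have G: "continuous_on {0..} (G 0)" "poly_growth (G 0)"
    by (auto simp: derivative_chain_def)
  have "poly_growth (\<lambda>x. G 0 \<bar>x\<bar>)"
    using G(2) by (simp add: poly_growth_def)
  then show ?case
    using continuous_on_abs_compose[OF G(1)] by (intro exI[of _ "\<lambda>x. G 0 \<bar>x\<bar>"]) simp
next
  case 3
  let ?\<Lambda> = "ridge_mean 2"
  have \<Lambda>: "bounded_functional ?\<Lambda>" by (rule bounded_functional_ridge_mean)
  have der: "\<And>r. r \<ge> 0 \<Longrightarrow> (G 0 has_real_derivative G 1 r) (at r within {0..})"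
    and G: "continuous_on {0..} (G 1)" "poly_growth (G 1)"
    using 3 by (auto simp: derivative_chain_def)
  define h where "h x = G 1 \<bar>x\<bar>" for x
  have h: "continuous_on UNIV h"
    unfolding h_def[abs_def] by (rule continuous_on_abs_compose[OF G(1)])
  \<comment> \<open>The factor pi/2 undoes the normalization 2/pi in \<open>ridge_mean 2\<close>;
    |t| and the even extension h make f even.\<close>
  define f where "f t = G 0 0 + pi / 2 * (\<bar>t\<bar> * ?\<Lambda> (\<lambda>v. h (t * v)))" for t
  have "continuous_on UNIV f"
    unfolding f_def[abs_def] by (intro continuous_intros bounded_functional_scaled_continuous[OF \<Lambda> h])
  moreover have "poly_growth f"
  proof -
    obtain C k where C: "C \<ge> 0" "\<And>r. r \<ge> 0 \<Longrightarrow> \<bar>G 1 r\<bar> \<le> C * (1 + r) ^ k"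
      using poly_growthE[OF G(2)] by blast
    obtain K where K: "K \<ge> 0"
      "\<And>g c. continuous_on UNIV g \<Longrightarrow> (\<And>u. u \<in> {0..1} \<Longrightarrow> \<bar>g u\<bar> \<le> c) \<Longrightarrow> \<bar>?\<Lambda> g\<bar> \<le> K * c"
      using bounded_functional_bound[OF \<Lambda>] by blast
    have "\<bar>?\<Lambda> (\<lambda>v. h (t * v))\<bar> \<le> (K * C) * (1 + t) ^ k" if t: "t \<ge> 0" for t
    proof -
      have "\<bar>?\<Lambda> (\<lambda>v. h (t * v))\<bar> \<le> K * (C * (1 + t) ^ k)"
      proof (intro K continuous_on_scaled h)
        fix v :: real assume v: "v \<in> {0..1}"
        have "t * v \<le> t" using t v by (intro mult_left_le) auto
        then have "(1 + t * v) ^ k \<le> (1 + t) ^ k" using t v by (intro power_mono) auto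
        then have "C * (1 + t * v) ^ k \<le> C * (1 + t) ^ k" using C(1) by (rule mult_left_mono)
        then show "\<bar>h (t * v)\<bar> \<le> C * (1 + t) ^ k"
          using C(2)[of "t * v"] t v by (simp add: h_def)
      qed
      then show ?thesis by (simp add: mult_ac)
    qed
    then have "poly_growth (\<lambda>t. ?\<Lambda> (\<lambda>v. h (t * v)))" unfolding poly_growth_def by blast
    from poly_growth_lincomb[OF poly_growth_const poly_growth_times_id[OF this], of 1 "G 0 0" "pi / 2"]
    show ?thesis by (simp add: poly_growth_def f_def)
  qed
  moreover have "f (- t) = f t" for t by (simp add: f_def h_def)
  moreover have "G 0 r = ?\<Lambda> (\<lambda>u. f (r * u))" if r: "r \<ge> 0" for r
  proof -
    have hr: "continuous_on UNIV (\<lambda>x. h (r * x))" by (rule continuous_on_scaled[OF h])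
    have c: "continuous_on UNIV (\<lambda>u. \<bar>u\<bar> * ?\<Lambda> (\<lambda>v. h (r * (u * v))))"
      by (intro continuous_intros bounded_functional_scaled_continuous[OF \<Lambda> hr])
    have "(\<lambda>u. f (r * u)) = (\<lambda>u. G 0 0 * u ^ 0 + (pi / 2 * r) * (\<bar>u\<bar> * ?\<Lambda> (\<lambda>v. h (r * (u * v)))))"
      using r by (simp add: f_def abs_mult mult.assoc)
    then have "?\<Lambda> (\<lambda>u. f (r * u)) =
        G 0 0 * ?\<Lambda> (\<lambda>u. u ^ 0) + (pi / 2 * r) * ?\<Lambda> (\<lambda>u. \<bar>u\<bar> * ?\<Lambda> (\<lambda>v. h (r * (u * v))))"
      by (simp only: bounded_functional_lincomb[OF \<Lambda> continuous_on_power[OF continuous_on_id] c])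
    \<comment> \<open>The iterated mean becomes the uniform average of \<open>G 1\<close> over
      [0,r]; r times this average is the increment of \<open>G 0\<close>.\<close>
    also have "\<dots> = G 0 0 + r * integral {0..1} (\<lambda>x. h (r * x))"
      using ridge_mean_2_iterated[OF hr] unfolding ridge_mean_2_power by (simp add: wallis_0)
    also have "r * integral {0..1} (\<lambda>x. h (r * x)) = integral {0..1} (\<lambda>x. r * G 1 (r * x))"
      unfolding integral_mult_right[symmetric] using r by (intro integral_cong) (simp add: h_def)
    also have "\<dots> = G 0 (r * 1) - G 0 (r * 0)"
    proof (intro integral_unique fundamental_theorem_of_calculus)
      fix s :: real assume "s \<in> {0..1}"
      from has_real_derivative_scaled[OF der r this]
      show "((\<lambda>s. G 0 (r * s)) has_vector_derivative r * G 1 (r * s)) (at s within {0..1})"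
        by (simp only: has_real_derivative_iff_has_vector_derivative)
    qed simp
    finally show ?thesis by simp
  qed
  ultimately show ?case unfolding numeral_2_eq_2 by blast
next
  case (4 d)
  define N where "N = Suc d div 2"
  have "Suc (Suc (Suc d)) div 2 = Suc N" by (simp add: N_def)
  with 4 have chain: "derivative_chain (Suc N) G" by simp
  \<comment> \<open>Let n = d + 1. If G(r) is n times the integral of s^(n-1) H(r s) over [0,1],
    then differentiating r^n G(r) gives H = G + r G'/n. By Leibniz the i-th derivative of r G' is r
    times the derivative of G of order i + 1 plus i times that of order i, whence
    \<open>H i\<close>. The factors 1 suit \<open>poly_growth_lincomb\<close>.\<close>
  define H where "H i r = 1 * G i r + 1 / real (Suc d) * (1 * (r * G (Suc i) r) + real i * G i r)" for i r
  have der: "(G i has_real_derivative G (Suc i) r) (at r within {0..})" if "i < Suc N" "r \<ge> 0" for i r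
    using chain that by (simp add: derivative_chain_def)
  have G: "continuous_on {0..} (G i)" "poly_growth (G i)" if "i \<le> Suc N" for i
    using chain that by (simp_all add: derivative_chain_def)
  have "derivative_chain N H"
    unfolding derivative_chain_def
  proof (intro conjI allI impI)
    fix i r assume i: "i < N" and r: "(0::real) \<le> r"
    have "(H i has_real_derivative 1 * G (Suc i) r + 1 / real (Suc d) *
        (1 * (1 * G (Suc i) r + G (Suc (Suc i)) r * r) + real i * G (Suc i) r)) (at r within {0..})"
      unfolding H_def using i r
      by (intro DERIV_add DERIV_cmult DERIV_mult DERIV_ident der) auto
    then show "(H i has_real_derivative H (Suc i) r) (at r within {0..})"
      by (simp add: H_def algebra_simps)
  next
    fix i assume i: "i \<le> N"
    then show "continuous_on {0..} (H i)"
      unfolding H_def by (intro continuous_intros G) auto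
    show "poly_growth (H i)"
      unfolding H_def using i by (intro poly_growth_lincomb poly_growth_times_id G) auto
  qed
  then obtain f where f: "continuous_on UNIV f" "poly_growth f" "\<And>t. f (- t) = f t"
    "\<And>r. r \<ge> 0 \<Longrightarrow> H 0 r = ridge_mean (Suc d) (\<lambda>u. f (r * u))"
    using "4.hyps"[of H] by (auto simp: N_def)
  have "G 0 r = ridge_mean (Suc (Suc (Suc d))) (\<lambda>u. f (r * u))" if r: "r \<ge> 0" for r
  proof -
    have "((\<lambda>s. real (Suc d) * (s ^ d * H 0 (r * s))) has_integral
        (1 ^ Suc d * G 0 (r * 1) - 0 ^ Suc d * G 0 (r * 0))) {0..1}"
    proof (rule fundamental_theorem_of_calculus)
      fix s :: real assume s: "s \<in> {0..1}"
      have "((\<lambda>s. s ^ Suc d * G 0 (r * s)) has_real_derivative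
          ((1 + real d) * (1 * s ^ d)) * G 0 (r * s) + (r * G 1 (r * s)) * s ^ Suc d) (at s within {0..1})"
        using has_real_derivative_scaled[OF der[of 0] r s]
        by (intro DERIV_mult DERIV_power_Suc DERIV_ident) simp_all
      moreover have "((1 + real d) * (1 * s ^ d)) * G 0 (r * s) + (r * G 1 (r * s)) * s ^ Suc d =
          real (Suc d) * (s ^ d * H 0 (r * s))"
        by (simp add: H_def field_simps)
      ultimately show "((\<lambda>s. s ^ Suc d * G 0 (r * s)) has_vector_derivative
          real (Suc d) * (s ^ d * H 0 (r * s))) (at s within {0..1})"
        by (simp add: has_real_derivative_iff_has_vector_derivative)
    qed simp
    then have "G 0 r = real (Suc d) * integral {0..1} (\<lambda>s. s ^ d * H 0 (r * s))"
      by (simp add: integral_unique flip: integral_mult_right)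
    also have "integral {0..1} (\<lambda>s. s ^ d * H 0 (r * s)) =
        integral {0..1} (\<lambda>s. s ^ d * ridge_mean (Suc d) (\<lambda>u. f (r * (s * u))))"
      using r by (intro integral_cong) (simp add: f(4) mult.assoc)
    finally show ?thesis by simp
  qed
  with f(1-3) show ?case by blast
qed simp

section \<open>Duality with the Fourier transform\<close>

lemma lebesgue_integral_eq_lborel:
  fixes f :: "'a::euclidean_space \<Rightarrow> 'b::{banach, second_countable_topology}"
  assumes "f \<in> borel_measurable borel"
  shows "integral\<^sup>L lebesgue f = integral\<^sup>L lborel f"
    and "integrable lebesgue f \<longleftrightarrow> integrable lborel f"
  using assms by (simp_all add: integral_completion integrable_completion)

text \<open>A real supremum is an upper bound once the set is bounded above, which Schwartz decay
  guarantees.\<close>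

lemma schwartz_seminorm_upper:
  assumes "\<phi> \<in> schwartz"
  shows "norm x ^ k * norm (\<phi> x) \<le> schwartz_seminorm k [] \<phi>"
proof -
  obtain B where "\<And>x. norm (norm x ^ k *\<^sub>R \<phi> x) \<le> B"
    using schwartz_bounded[OF assms, of k] by (auto simp: bounded_iff)
  then have "bdd_above (range (\<lambda>x. norm x ^ k * norm (\<phi> x)))"
    by (intro bdd_aboveI[of _ B]) auto
  then show ?thesis unfolding schwartz_seminorm_def by (auto intro: cSUP_upper)
qed

text \<open>Two seminorms without derivatives control the functional: k powers of 1 + |x| absorb the
  growth of g, and 2 DIM more leave an integrable weight.\<close>

lemma regular_dist_tempered:
  fixes g :: "'a::euclidean_space \<Rightarrow> complex"
  assumes [measurable]: "g \<in> borel_measurable borel"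
    and g: "\<And>x. norm (g x) \<le> C * (1 + norm x) ^ k"
  shows "regular_dist g \<in> tempered"
proof -
  have C: "C \<ge> 0" using g[of 0] by (simp add: order_trans[OF norm_ge_zero])
  have T: "regular_dist g \<phi> = (\<integral>x. g x * \<phi> x \<partial>lborel)" if "\<phi> \<in> schwartz" for \<phi>
    using schwartz_measurable[OF that] that by (simp add: regular_dist_def lebesgue_integral_eq_lborel)
  note int = integrable_poly_growth_schwartz[OF assms]
  have lin: "regular_dist g (\<lambda>x. a * \<phi> x + b * \<psi> x) = a * regular_dist g \<phi> + b * regular_dist g \<psi>"
    if "\<phi> \<in> schwartz" "\<psi> \<in> schwartz" for \<phi> \<psi> a b
  proof -
    have "(\<integral>x. g x * (a * \<phi> x + b * \<psi> x) \<partial>lborel) = (\<integral>x. a * (g x * \<phi> x) + b * (g x * \<psi> x) \<partial>lborel)"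
      by (simp add: algebra_simps)
    also have "\<dots> = a * (\<integral>x. g x * \<phi> x \<partial>lborel) + b * (\<integral>x. g x * \<psi> x \<partial>lborel)"
      by (subst Bochner_Integration.integral_add[OF integrable_mult_right[OF int[OF that(1)]] integrable_mult_right[OF int[OF that(2)]]]) simp
    finally show ?thesis by (simp add: T schwartz_lincomb that)
  qed
  define M where "M = (\<integral>x. inverse ((1 + norm (x :: 'a)) ^ (2 * DIM('a))) \<partial>lborel)"
  have Mint: "integrable lborel (\<lambda>x::'a. inverse ((1 + norm x) ^ (2 * DIM('a))))"
  proof (rule integrable_lborel_decay[where C = 1])
    show "(1 + norm x) ^ (2 * DIM('a)) * norm (inverse ((1 + norm x) ^ (2 * DIM('a)))) \<le> 1" for x :: 'a
    proof -
      have "1 + norm x > 0" by (simp add: add_pos_nonneg)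
      then show ?thesis by (simp add: norm_inverse norm_power)
    qed
  qed measurable
  let ?N = "2 * DIM('a) + k"
  have bound: "norm (regular_dist g \<phi>) \<le> C * 2 ^ ?N * M * (schwartz_seminorm 0 [] \<phi> + schwartz_seminorm ?N [] \<phi>)"
    if \<phi>: "\<phi> \<in> schwartz" for \<phi>
  proof -
    let ?s = "schwartz_seminorm 0 [] \<phi> + schwartz_seminorm ?N [] \<phi>"
    have "norm (regular_dist g \<phi>) \<le> (\<integral>x. (C * 2 ^ ?N * ?s) * inverse ((1 + norm (x :: 'a)) ^ (2 * DIM('a))) \<partial>lborel)"
      unfolding T[OF \<phi>]
    proof (rule Bochner_Integration.integral_norm_bound_integral[OF int[OF \<phi>] integrable_mult_right[OF Mint]])
      fix x :: 'a
      let ?p = "1 + norm x"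
      have p: "?p > 0" by (simp add: add_pos_nonneg)
      have "?p ^ ?N * norm (\<phi> x) \<le> 2 ^ ?N * (1 + norm x ^ ?N) * norm (\<phi> x)"
        by (intro mult_right_mono one_plus_power_le) auto
      also have "\<dots> = 2 ^ ?N * (norm x ^ 0 * norm (\<phi> x) + norm x ^ ?N * norm (\<phi> x))"
        by (simp add: algebra_simps)
      also have "\<dots> \<le> 2 ^ ?N * ?s"
        by (intro mult_left_mono add_mono schwartz_seminorm_upper \<phi>) simp
      finally have "?p ^ (2 * DIM('a)) * (?p ^ k * norm (\<phi> x)) \<le> 2 ^ ?N * ?s"
        by (simp add: power_add mult.assoc)
      then have "?p ^ k * norm (\<phi> x) \<le> 2 ^ ?N * ?s * inverse (?p ^ (2 * DIM('a)))"
        unfolding divide_inverse[symmetric] pos_le_divide_eq[OF zero_less_power[OF p]]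
        by (simp only: mult.commute)
      then have "C * (?p ^ k * norm (\<phi> x)) \<le> C * (2 ^ ?N * ?s * inverse (?p ^ (2 * DIM('a))))"
        using C by (rule mult_left_mono)
      moreover have "norm (g x * \<phi> x) \<le> C * (?p ^ k * norm (\<phi> x))"
        using mult_right_mono[OF g[of x], of "norm (\<phi> x)"] by (simp add: norm_mult mult.assoc)
      ultimately show "norm (g x * \<phi> x) \<le> (C * 2 ^ ?N * ?s) * inverse (?p ^ (2 * DIM('a)))"
        by (simp add: mult.assoc)
    qed
    then show ?thesis unfolding integral_mult_right_zero M_def[symmetric] by (simp only: mult_ac)
  qed
  have "(\<lambda>n. regular_dist g (\<theta> n)) \<longlonglongrightarrow> regular_dist g \<phi>"
    if \<theta>: "\<And>n. \<theta> n \<in> schwartz" and \<phi>: "\<phi> \<in> schwartz" and lim: "schwartz_tendsto \<theta> \<phi>" for \<theta> \<phi>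
  proof (rule LIM_zero_cancel, rule Lim_null_comparison)
    let ?s = "\<lambda>k n. schwartz_seminorm k [] (\<lambda>x. \<theta> n x - \<phi> x)"
    have "norm (regular_dist g (\<theta> n) - regular_dist g \<phi>) \<le> C * 2 ^ ?N * M * (?s 0 n + ?s ?N n)" for n
      using lin[OF \<theta> \<phi>, of 1 n "-1"] bound[OF schwartz_diff[OF \<theta> \<phi>], of n] by simp
    then show "\<forall>\<^sub>F n in sequentially. norm (regular_dist g (\<theta> n) - regular_dist g \<phi>) \<le> C * 2 ^ ?N * M * (?s 0 n + ?s ?N n)"
      by simp
    have "?s k \<longlonglongrightarrow> 0" for k
      using lim unfolding schwartz_tendsto_def by (auto dest!: spec[of _ k])
    then have "(\<lambda>n. C * 2 ^ ?N * M * (?s 0 n + ?s ?N n)) \<longlonglongrightarrow> C * 2 ^ ?N * M * (0 + 0)"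
      by (intro tendsto_intros)
    then show "(\<lambda>n. C * 2 ^ ?N * M * (?s 0 n + ?s ?N n)) \<longlonglongrightarrow> 0" by simp
  qed
  with lin show ?thesis
    unfolding tempered_def by (auto simp: regular_dist_def)
qed

lemma regular_tempered_generated_by_continuous:
  fixes g :: "'a::euclidean_space \<Rightarrow> complex"
  assumes cont: "continuous_on UNIV g" and g: "\<And>x. norm (g x) \<le> C * (1 + norm x) ^ k"
  shows "regular_tempered_generated_by (regular_dist g) g"
proof -
  have [measurable]: "g \<in> borel_measurable borel"
    using cont by (rule borel_measurable_continuous_onI)
  have "g absolutely_integrable_on K" if K: "compact K" for K
  proof -
    have [measurable]: "K \<in> sets borel" using K by (simp add: borel_compact)
    have "integrable lborel (\<lambda>x. indicator K x *\<^sub>R g x)"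
      by (rule borel_integrable_compact[OF K continuous_on_subset[OF cont]]) simp
    then show ?thesis
      unfolding set_integrable_def by (subst lebesgue_integral_eq_lborel) auto
  qed
  moreover have "integrable lebesgue (\<lambda>x. g x * \<phi> x)" if \<phi>: "\<phi> \<in> schwartz" for \<phi>
    using schwartz_measurable[OF \<phi>] integrable_poly_growth_schwartz[OF _ g \<phi>]
    by (subst lebesgue_integral_eq_lborel) auto
  ultimately show ?thesis
    using regular_dist_tempered[OF _ g]
    by (simp add: regular_tempered_generated_by_def locally_integrable_on_def)
qed

section \<open>Even functions and the duality of slicing\<close>

lemma integral_lborel_reflect:
  fixes g :: "'a::euclidean_space \<Rightarrow> complex"
  assumes "g \<in> borel_measurable borel"
  shows "(\<integral>x. g (- x) \<partial>lborel) = integral\<^sup>L lborel g"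
  using lborel_integral_affine[OF assms, of "-1" 0] by simp

lemma fourier_reflect:
  fixes \<psi> :: "'a::euclidean_space \<Rightarrow> complex"
  assumes [measurable]: "\<psi> \<in> borel_measurable borel"
  shows "fourier (\<lambda>x. \<psi> (- x)) v = fourier \<psi> (- v)"
  using integral_lborel_reflect[of "\<lambda>x. cis (2 * pi * (x \<bullet> v)) * \<psi> x"]
  by (simp add: fourier_eq_cis)

text \<open>The adjoint of the rotation operator sees only the even part of \<psi>. Reflection
  commutes with the Fourier transform, so pairing with an even g loses nothing.\<close>

lemma integral_even_fourier_even_part:
  fixes g \<psi> :: "real \<Rightarrow> complex"
  assumes [measurable]: "g \<in> borel_measurable borel" and g: "\<And>t. norm (g t) \<le> C * (1 + norm t) ^ k"
    and even: "\<And>t. g (- t) = g t" and \<psi>: "\<psi> \<in> schwartz"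
  shows "(\<integral>t. g t * fourier (even_part \<psi>) t \<partial>lborel) = (\<integral>t. g t * fourier \<psi> t \<partial>lborel)"
proof -
  have F: "fourier \<psi> \<in> schwartz" by (rule fourier_schwartz[OF \<psi>])
  note [measurable] = schwartz_measurable[OF \<psi>] schwartz_measurable[OF F]
  have "fourier (even_part \<psi>) t = 1/2 * fourier \<psi> t + 1/2 * fourier \<psi> (- t)" for t
  proof -
    have "fourier (even_part \<psi>) t = (\<integral>x. 1/2 * (cis (- 2 * pi * (x \<bullet> t)) * \<psi> x) + 1/2 * (cis (- 2 * pi * (x \<bullet> t)) * \<psi> (- x)) \<partial>lborel)"
      by (subst fourier_eq_cis) (simp_all add: even_part_def[abs_def] algebra_simps add_divide_distrib)
    also have "\<dots> = 1/2 * fourier \<psi> t + 1/2 * fourier (\<lambda>x. \<psi> (- x)) t"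
      by (subst Bochner_Integration.integral_add)
        (auto intro!: integrable_mult_right schwartz_integrable_cis \<psi> schwartz_reflect simp: fourier_eq_cis)
    finally show ?thesis by (simp add: fourier_reflect)
  qed
  then have "(\<integral>t. g t * fourier (even_part \<psi>) t \<partial>lborel) =
      (\<integral>t. 1/2 * (g t * fourier \<psi> t) + 1/2 * (g t * fourier \<psi> (- t)) \<partial>lborel)"
    by (simp add: algebra_simps)
  also have "\<dots> = 1/2 * (\<integral>t. g t * fourier \<psi> t \<partial>lborel) + 1/2 * (\<integral>t. g t * fourier \<psi> (- t) \<partial>lborel)"
    by (subst Bochner_Integration.integral_add)
      (auto intro!: integrable_mult_right integrable_poly_growth_schwartz[OF _ g] F schwartz_reflect)
  also have "(\<integral>t. g t * fourier \<psi> (- t) \<partial>lborel) = (\<integral>t. g t * fourier \<psi> t \<partial>lborel)"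
    using integral_lborel_reflect[of "\<lambda>t. g t * fourier \<psi> t"] by (simp add: even)
  finally show ?thesis by simp
qed

lemma slice_fourier_duality:
  fixes F f :: "real \<Rightarrow> real" and \<psi> :: "real \<Rightarrow> complex"
  assumes slice: "\<And>x :: 'a::euclidean_space. F (norm x) = (\<integral>\<xi>. f \<bar>x \<bullet> \<xi>\<bar> \<partial>sphere_uniform)"
    and cont: "continuous_on UNIV f" and bound: "\<And>t. \<bar>f t\<bar> \<le> C * (1 + \<bar>t\<bar>) ^ k"
    and even: "\<And>t. f (- t) = f t" and \<psi>: "\<psi> \<in> schwartz"
  shows "(\<integral>x. of_real (F (norm x)) * fourier (rot (even_part \<psi>)) (x :: 'a) \<partial>lborel) =
    (\<integral>t. of_real (f t) * fourier \<psi> t \<partial>lborel)"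
proof -
  let ?e = "even_part \<psi>"
  let ?\<theta> = "fourier (rot ?e) :: 'a \<Rightarrow> complex"
  define g where "g t = complex_of_real (f t)" for t
  have gc: "continuous_on UNIV g" unfolding g_def[abs_def] by (intro continuous_intros cont)
  have gb: "norm (g t) \<le> C * (1 + norm t) ^ k" for t using bound[of t] by (simp add: g_def)
  have C: "C \<ge> 0" using bound[of 0] by (simp add: order_trans[OF abs_ge_zero])
  have \<theta>: "?\<theta> \<in> schwartz" by (intro fourier_schwartz rot_even_part_schwartz \<psi>)
  have [measurable]: "f \<in> borel_measurable borel" "g \<in> borel_measurable borel" "?\<theta> \<in> borel_measurable borel"
    using cont gc \<theta> by (auto intro: borel_measurable_continuous_onI schwartz_measurable)
  have fabs: "f \<bar>t\<bar> = f t" for t by (cases "t \<ge> 0") (auto simp: even)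
  interpret P: pair_sigma_finite lborel "sphere_uniform :: 'a measure"
    by (intro pair_sigma_finite.intro sigma_finite_lborel sphere_uniform.sigma_finite_measure_axioms)
  have "integrable lborel (\<lambda>x::'a. of_real (C * (1 + norm x) ^ k) * ?\<theta> x)"
    by (rule integrable_poly_growth_schwartz[where C = C and k = k, OF _ _ \<theta>])
      (use C in \<open>auto simp: norm_mult norm_power abs_mult simp del: of_real_mult of_real_power\<close>)
  from integrable_norm[OF this] have i1: "integrable lborel (\<lambda>x::'a. C * (1 + norm x) ^ k * norm (?\<theta> x))"
    using C by (simp add: norm_mult norm_power abs_mult del: of_real_mult of_real_power)
  have i2: "integrable sphere_uniform (\<lambda>\<xi>::'a. (1 + norm \<xi>) ^ k)"
    by (intro sphere_uniform_integrable continuous_intros)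
  have int: "integrable (lborel \<Otimes>\<^sub>M sphere_uniform) (\<lambda>(x :: 'a, \<xi>). g (x \<bullet> \<xi>) * ?\<theta> x)"
  proof (rule P.integrable_pair_bound[OF _ i1 i2])
    \<comment> \<open>The product bound is required for every \<xi>, not just for unit vectors,
      since the sphere measure lives on the whole space; hence |\<xi>| is kept.\<close>
    fix x \<xi> :: 'a
    have "\<bar>x \<bullet> \<xi>\<bar> \<le> norm x * norm \<xi>" by (rule Cauchy_Schwarz_ineq2)
    then have "1 + \<bar>x \<bullet> \<xi>\<bar> \<le> (1 + norm x) * (1 + norm \<xi>)"
      by (simp add: algebra_simps add_increasing)
    then have "(1 + \<bar>x \<bullet> \<xi>\<bar>) ^ k \<le> ((1 + norm x) * (1 + norm \<xi>)) ^ k"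
      by (intro power_mono) auto
    then have "C * (1 + \<bar>x \<bullet> \<xi>\<bar>) ^ k \<le> C * ((1 + norm x) * (1 + norm \<xi>)) ^ k"
      using C by (rule mult_left_mono)
    with gb[of "x \<bullet> \<xi>"] have "norm (g (x \<bullet> \<xi>)) \<le> C * ((1 + norm x) * (1 + norm \<xi>)) ^ k" by simp
    from mult_right_mono[OF this, of "norm (?\<theta> x)"]
    show "norm ((\<lambda>(x, \<xi>). g (x \<bullet> \<xi>) * ?\<theta> x) (x, \<xi>)) \<le> C * (1 + norm x) ^ k * norm (?\<theta> x) * (1 + norm \<xi>) ^ k"
      by (simp add: norm_mult power_mult_distrib mult_ac)
  qed measurable
  have "(\<integral>x. of_real (F (norm x)) * ?\<theta> x \<partial>lborel) = (\<integral>x. (\<integral>\<xi>. g (x \<bullet> \<xi>) * ?\<theta> x \<partial>sphere_uniform) \<partial>lborel)"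
    by (simp add: slice fabs g_def)
  also have "\<dots> = (\<integral>\<xi>. (\<integral>x. g (x \<bullet> \<xi>) * ?\<theta> x \<partial>lborel) \<partial>sphere_uniform)"
    by (rule P.Fubini_integral[OF int, symmetric])
  \<comment> \<open>Almost every \<xi> is a unit vector, to which the slice theorem applies; the
    inner integral no longer depends on it.\<close>
  also have "\<dots> = (\<integral>\<xi>. (\<integral>t. g t * fourier ?e t \<partial>lborel) \<partial>(sphere_uniform :: 'a measure))"
  proof (rule integral_cong_AE)
    show "AE \<xi> in sphere_uniform. (\<integral>x. g (x \<bullet> \<xi>) * ?\<theta> x \<partial>lborel) = (\<integral>t. g t * fourier ?e t \<partial>lborel)"
      using AE_sphere_uniform
    proof eventually_elim
      case (elim \<xi>)
      then show ?case
        by (intro fourier_slice[OF gc] even_part_schwartz \<psi>) (use gb in \<open>auto simp: even_part_def add.commute\<close>)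
    qed
  qed measurable
  also have "\<dots> = (\<integral>t. g t * fourier ?e t \<partial>lborel)"
    using sphere_uniform.prob_space[where 'a = 'a] by simp
  also have "\<dots> = (\<integral>t. g t * fourier \<psi> t \<partial>lborel)"
    by (rule integral_even_fourier_even_part[OF _ gb _ \<psi>]) (simp_all add: g_def even)
  finally show ?thesis by (simp add: g_def)
qed

section \<open>The inverse transform and the hypotheses on F\<close>

text \<open>\<open>inv_into\<close> chooses some preimage; injectivity leaves only one
  choice.\<close>

lemma inv_fourier_dist_eqI:
  "T \<in> tempered \<Longrightarrow> fourier_dist T = S \<Longrightarrow> inv_fourier_dist S = T"
  unfolding inv_fourier_dist_def by (metis inj_on_fourier_dist inv_into_f_f)

text \<open>Slow increase bounds the top derivative beyond R, and compactness covers [0,R]. Growth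
  then reaches the lower derivatives by descending induction.\<close>

lemma derivative_chain_nth_deriv_on:
  assumes C: "C_k_on N {0..} F" and slow: "slowly_increasing_on (nth_deriv_on N {0..} F) {0..}"
  shows "derivative_chain N (\<lambda>i. nth_deriv_on i {0..} F)"
proof -
  let ?G = "\<lambda>i. nth_deriv_on i {0..} F"
  have cont: "continuous_on {0..} (?G i)" if "i \<le> N" for i
    using C that by (simp add: C_k_on_def)
  have der: "(?G i has_real_derivative ?G (Suc i) r) (at r within {0..})" if "i < N" "r \<ge> 0" for i r
  proof -
    have "?G i differentiable (at r within {0..})"
      using C that by (auto simp: C_k_on_def differentiable_on_def)
    then show ?thesis
      by (simp add: nth_deriv_on_def has_real_derivative_iff_has_vector_derivative vector_derivative_works)
  qed
  obtain c p R :: real where cpR: "c > 1" "p > 1" "R > 1"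
    "\<And>x. x \<ge> 0 \<Longrightarrow> norm x > R \<Longrightarrow> norm (?G N x) \<le> c * norm x powr p"
    using slow unfolding slowly_increasing_on_def by auto
  have "compact (?G N ` {0..R})"
    by (intro compact_continuous_image continuous_on_subset[OF cont]) auto
  from compact_imp_bounded[OF this] obtain B where B: "\<And>x. x \<in> {0..R} \<Longrightarrow> \<bar>?G N x\<bar> \<le> B"
    unfolding bounded_iff by (metis imageI real_norm_def)
  \<comment> \<open>Rounding the real exponent up gives a natural power, which is no smaller because
    r > R > 1 in the case where it is used.\<close>
  define k where "k = nat \<lceil>p\<rceil>"
  have "\<bar>?G N r\<bar> \<le> (\<bar>B\<bar> + c) * (1 + r) ^ k" if r: "r \<ge> 0" for r
  proof (cases "r \<le> R")
    case True
    then have "\<bar>?G N r\<bar> \<le> \<bar>B\<bar> * 1" using B[of r] r by simp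
    also have "\<dots> \<le> (\<bar>B\<bar> + c) * (1 + r) ^ k"
      using r cpR(1) by (intro mult_mono one_le_power) auto
    finally show ?thesis .
  next
    case False
    then have "\<bar>?G N r\<bar> \<le> c * r powr p" using cpR(4)[of r] r by simp
    also have "r powr p \<le> r powr real k"
      using False cpR(3) by (intro powr_mono) (auto simp: k_def intro: real_nat_ceiling_ge)
    also have "r powr real k = r ^ k" using False cpR(3) by (simp add: powr_realpow)
    also have "r ^ k \<le> (1 + r) ^ k" using r by (intro power_mono) auto
    finally have "\<bar>?G N r\<bar> \<le> c * (1 + r) ^ k" using cpR(1) by simp
    also have "\<dots> \<le> (\<bar>B\<bar> + c) * (1 + r) ^ k" using r by (intro mult_right_mono) auto
    finally show ?thesis .
  qed
  then have "poly_growth (?G N)" unfolding poly_growth_def by blast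
  then have "poly_growth (?G i)" if "i \<le> N" for i
    by (rule inc_induct[OF that]) (rule poly_growth_antiderivative[OF der])
  with der cont show ?thesis by (simp add: derivative_chain_def)
qed

theorem corollary4p9:
  fixes F :: "real \<Rightarrow> real"
  assumes "CARD('n::finite) \<ge> 3"
    and "C_k_on (CARD('n) div 2) {0..} F"
    and "slowly_increasing_on (nth_deriv_on (CARD('n) div 2) {0..} F) {0..}"
  shows "\<exists>f :: real \<Rightarrow> real.
    continuous_on UNIV f \<and>
    regular_tempered_generated_by
      ((inv_fourier_dist \<circ> rot_adjoint \<circ> fourier_dist)
         (regular_dist (rot (\<lambda>r. complex_of_real (F r)) :: real ^ 'n \<Rightarrow> complex)))
      (\<lambda>t. complex_of_real (f t)) \<and>
    (\<forall>z :: real ^ 'n. F (norm z) = (\<integral>\<xi>. f \<bar>z \<bullet> \<xi>\<bar> \<partial>sphere_uniform))"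
proof -
  let ?T = "regular_dist (rot (\<lambda>r. complex_of_real (F r)) :: real ^ 'n \<Rightarrow> complex)"
  have chain: "derivative_chain (CARD('n) div 2) (\<lambda>i. nth_deriv_on i {0..} F)"
    by (rule derivative_chain_nth_deriv_on[OF assms(2,3)])
  have F0: "nth_deriv_on 0 {0..} F = F" by (simp add: nth_deriv_on_def)
  obtain f where f: "continuous_on UNIV f" "poly_growth f" "\<And>t. f (- t) = f t"
    "\<And>r. r \<ge> 0 \<Longrightarrow> F r = ridge_mean CARD('n) (\<lambda>u. f (r * u))"
    using ridge_mean_inversion[OF _ chain] assms(1) by (auto simp: F0)
  have slice: "F (norm z) = (\<integral>\<xi>. f \<bar>z \<bullet> \<xi>\<bar> \<partial>sphere_uniform)" for z :: "real ^ 'n"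
    using sphere_uniform_ridge_mean[OF f(1), of z] f(4)[of "norm z"] by simp
  obtain C k where Ck: "\<And>r. r \<ge> 0 \<Longrightarrow> \<bar>f r\<bar> \<le> C * (1 + r) ^ k"
    using poly_growthE[OF f(2)] by blast
  have bound: "\<bar>f t\<bar> \<le> C * (1 + \<bar>t\<bar>) ^ k" for t
    using Ck[of "\<bar>t\<bar>"] by (cases "t \<ge> 0") (auto simp: f(3))
  let ?g = "\<lambda>t. complex_of_real (f t)"
  have g: "continuous_on UNIV ?g" "\<And>t. norm (?g t) \<le> C * (1 + norm t) ^ k"
    using bound by (auto intro!: continuous_intros f)
  have reg: "regular_tempered_generated_by (regular_dist ?g) ?g"
    by (rule regular_tempered_generated_by_continuous[OF g])
  have Fc: "(\<lambda>x :: real ^ 'n. complex_of_real (F (norm x))) \<in> borel_measurable borel"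
  proof (intro borel_measurable_continuous_onI continuous_on_of_real)
    have "continuous_on {0..} F"
      using assms(2) F0 by (auto simp: C_k_on_def dest!: spec[of _ 0])
    then show "continuous_on UNIV (\<lambda>x :: real ^ 'n. F (norm x))"
      by (rule continuous_on_compose2) (auto intro!: continuous_intros)
  qed
  \<comment> \<open>By \<open>inv_fourier_dist_eqI\<close> it suffices that the explicit candidate
    has the prescribed Fourier transform.\<close>
  have "fourier_dist (regular_dist ?g) = rot_adjoint (fourier_dist ?T)"
  proof
    fix \<psi> :: "real \<Rightarrow> complex"
    show "fourier_dist (regular_dist ?g) \<psi> = rot_adjoint (fourier_dist ?T) \<psi>"
    proof (cases "\<psi> \<in> schwartz")
      case True
      let ?\<phi> = "rot (even_part \<psi>) :: real ^ 'n \<Rightarrow> complex"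
      have \<phi>: "?\<phi> \<in> schwartz" by (rule rot_even_part_schwartz[OF True])
      have "rot_adjoint (fourier_dist ?T) \<psi> = (\<integral>x. of_real (F (norm x)) * fourier ?\<phi> x \<partial>lebesgue)"
        using True \<phi> fourier_schwartz[OF \<phi>]
        by (simp add: rot_adjoint_def fourier_dist_def regular_dist_def rot_def[of "\<lambda>r. complex_of_real (F r)"])
      also have "\<dots> = (\<integral>x. of_real (F (norm x)) * fourier ?\<phi> x \<partial>lborel)"
        by (intro lebesgue_integral_eq_lborel borel_measurable_times Fc schwartz_measurable fourier_schwartz \<phi>)
      also have "\<dots> = (\<integral>t. ?g t * fourier \<psi> t \<partial>lborel)"
        by (rule slice_fourier_duality[OF slice f(1) bound f(3) True])
      also have "\<dots> = (\<integral>t. ?g t * fourier \<psi> t \<partial>lebesgue)"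
        by (intro lebesgue_integral_eq_lborel[symmetric] borel_measurable_times schwartz_measurable
            fourier_schwartz True borel_measurable_continuous_onI[OF g(1)])
      finally show ?thesis
        using True fourier_schwartz[OF True] by (simp add: fourier_dist_def regular_dist_def)
    \<comment> \<open>Outside \<open>schwartz\<close> both functionals take the value
      \<open>undefined\<close>.\<close>
    qed (simp add: fourier_dist_def rot_adjoint_def)
  qed
  moreover have "regular_dist ?g \<in> tempered"
    using reg by (simp add: regular_tempered_generated_by_def)
  ultimately have "inv_fourier_dist (rot_adjoint (fourier_dist ?T)) = regular_dist ?g"
    by (intro inv_fourier_dist_eqI)
  with reg f(1) slice show ?thesis by auto
qed

end
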